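(* Let $n\ge 4$ be an even integer and let $u\in C^\infty(\mathbb{R}^n)$ be such that the conformal metric $g=e^{2u}|dx|^2$ on $\mathbb{R}^n$ has finite total Q-curvature, with Q-curvature $Q$. (1) If there is a constant $C>0$ such that the scalar curvature satisfies $0\le R_g\le C$ near infinity, then $$0\le\int_{\mathbb{R}^n}Qe^{nu}\,dx\le\frac{(n-1)!\,|\mathbb{S}^n|}{2}\quad\text{or}\quad \int_{\mathbb{R}^n}Qe^{nu}\,dx=(n-1)!\,|\mathbb{S}^n|.$$ (2) If there is a constant $C>0$ such that $0\le R_g\le C$ near infinity, and the volume is finite, i.e. $e^{nu}\in L^1(\mathbb{R}^n)$, then $$\int_{\mathbb{R}^n}Qe^{nu}\,dx=(n-1)!\,|\mathbb{S}^n|.$$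
   Context: For a smooth function $u$ on $\mathbb{R}^n$ ($n\ge4$ even) and $g=e^{2u}|dx|^2$ (with $|dx|^2$ the Euclidean metric), the Q-curvature $Q$ of $g$ is the function defined by $(-\Delta)^{n/2}u=Qe^{nu}$, where $\Delta$ is the Euclidean Laplacian. The metric has finite total Q-curvature if $Qe^{nu}\in L^1(\mathbb{R}^n)$. The scalar curvature of $g$ is $R_g=2(n-1)e^{-2u}\left(-\Delta u-\frac{n-2}{2}|\nabla u|^2\right)$. "Near infinity" means outside some compact set. $|\mathbb{S}^n|$ is the volume of the standard unit $n$-sphere. *)

theory Defs
  imports "HOL-Analysis.Analysis"
begin

definition pderiv_dir :: "'a::euclidean_space \<Rightarrow> ('a \<Rightarrow> real) \<Rightarrow> 'a \<Rightarrow> real" where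
  "pderiv_dir b f x = frechet_derivative f (at x) b"

primrec C_k :: "nat \<Rightarrow> ('a::euclidean_space \<Rightarrow> real) \<Rightarrow> bool" where
  "C_k 0 f \<longleftrightarrow> continuous_on UNIV f"
| "C_k (Suc k) f \<longleftrightarrow> (\<forall>x. f differentiable (at x)) \<and> (\<forall>b\<in>Basis. C_k k (pderiv_dir b f))"

definition smooth :: "('a::euclidean_space \<Rightarrow> real) \<Rightarrow> bool" where
  "smooth f \<longleftrightarrow> (\<forall>k. C_k k f)"

definition gradient :: "('a::euclidean_space \<Rightarrow> real) \<Rightarrow> 'a \<Rightarrow> 'a" where
  "gradient f x = (\<Sum>b\<in>Basis. pderiv_dir b f x *\<^sub>R b)"

definition laplacian :: "('a::euclidean_space \<Rightarrow> real) \<Rightarrow> 'a \<Rightarrow> real" where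
  "laplacian f x = (\<Sum>b\<in>Basis. pderiv_dir b (pderiv_dir b f) x)"

definition neg_laplacian :: "('a::euclidean_space \<Rightarrow> real) \<Rightarrow> 'a \<Rightarrow> real" where
  "neg_laplacian f x = - laplacian f x"

text \<open>Scalar curvature of the conformal metric exp(2u)|dx|^2, whose dimension is that of
  the domain of u.\<close>
definition scalar_curvature :: "('a::euclidean_space \<Rightarrow> real) \<Rightarrow> 'a \<Rightarrow> real" where
  "scalar_curvature u x =
     2 * (real DIM('a) - 1) * exp (- 2 * u x) *
       (- laplacian u x - (real DIM('a) - 2) / 2 * (norm (gradient u x))\<^sup>2)"

text \<open>The surface measure on the unit sphere of a Euclidean space of dimension d, given by
  polar coordinates: d times the Lebesgue measure of the cone over E with apex 0. This is the
  measure s for which Lebesgue measure is the product of r^(d-1) dr and s; on the unit sphere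
  it agrees with the Riemannian volume of the round metric.\<close>
definition unit_sphere_measure :: "'a::euclidean_space set \<Rightarrow> real" where
  "unit_sphere_measure E =
     real DIM('a) * measure lborel {r *\<^sub>R x |r x. 0 < r \<and> r \<le> 1 \<and> x \<in> E}"

lemma gderiv_gradient:
  assumes "f differentiable (at x)"
  shows "GDERIV f x :> gradient f x"
proof -
  have lin: "linear (frechet_derivative f (at x))"
    by (rule linear_frechet_derivative[OF assms])
  have "frechet_derivative f (at x) h = h \<bullet> gradient f x" for h
  proof -
    have "frechet_derivative f (at x) h
        = frechet_derivative f (at x) (\<Sum>b\<in>Basis. (h \<bullet> b) *\<^sub>R b)"
      by (simp add: euclidean_representation)
    also have "\<dots> = (\<Sum>b\<in>Basis. (h \<bullet> b) * frechet_derivative f (at x) b)"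
      by (simp add: linear_sum[OF lin] linear_scale[OF lin])
    finally show ?thesis
      by (simp add: gradient_def pderiv_dir_def inner_sum_right mult.commute)
  qed
  moreover have "(f has_derivative frechet_derivative f (at x)) (at x)"
    using assms frechet_derivative_works by blast
  ultimately show ?thesis
    unfolding gderiv_def by (metis (no_types, lifting) ext)
qed

lemma unit_sphere_measure_sphere:
  "unit_sphere_measure (sphere (0::'a::euclidean_space) 1)
     = 2 * pi powr (real DIM('a) / 2) / Gamma (real DIM('a) / 2)"
proof -
  have cone: "{r *\<^sub>R x |r x. 0 < r \<and> r \<le> 1 \<and> x \<in> sphere (0::'a) 1} = cball 0 1 - {0}"
  proof (intro set_eqI iffI)
    fix y :: 'a
    assume "y \<in> cball 0 1 - {0}"
    then have "y = norm y *\<^sub>R (y /\<^sub>R norm y)" "0 < norm y" "norm y \<le> 1"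
      "y /\<^sub>R norm y \<in> sphere 0 1"
      by (auto simp: divide_inverse)
    then show "y \<in> {r *\<^sub>R x |r x. 0 < r \<and> r \<le> 1 \<and> x \<in> sphere (0::'a) 1}"
      by blast
  qed auto
  have "measure lborel (cball (0::'a) 1 - {0}) = measure lborel (cball (0::'a) 1)"
    by (rule measure_Diff_null_set) auto
  also have "\<dots> = unit_ball_vol (real DIM('a))"
    using content_cball[of 1 "0::'a"] by simp
  finally have "unit_sphere_measure (sphere (0::'a) 1)
      = real DIM('a) * (pi powr (real DIM('a) / 2) / Gamma (real DIM('a) / 2 + 1))"
    by (simp only: unit_sphere_measure_def cone unit_ball_vol_def)
  also have "Gamma (real DIM('a) / 2 + 1) = real DIM('a) / 2 * Gamma (real DIM('a) / 2)"
    by (rule Gamma_plus1) (auto dest: nonpos_Ints_nonpos)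
  finally show ?thesis
    by (simp add: field_simps)
qed

end

(*
  The potential 2/c * log(1/|x|), with c = (n-1)! |S^n|, is a fundamental solution of (-Laplace)^(n/2),
  and -log(s + |x|^2) regularises it: (-Laplace)^(n/2) maps it to the standard bubble of mass c.
  Truncating this kernel at |x|^2 = T after subtracting its Taylor polynomial there gives compactly
  supported test functions. Nonnegative scalar curvature near infinity, i.e.
  -Laplace u >= (n-2)/2 |grad u|^2, bounds the energy of u on the ball of radius L by L^(n-2), which
  makes the truncation error vanish as T tends to infinity and s to 0, so that
  c grad u(x) = -2 * integral of (x-y)/|x-y|^2 f(y) dy, where f = Q exp(n u).
  Consequently the rescaled gradients r grad u(r x) converge in L^2 of an annulus to -alpha x/|x|^2,
  where alpha = 2/c * integral of f, and u(r x) + alpha log r = o(log r) in L^1 of the annulus.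
  Testing R_g >= 0 on large annuli gives alpha (2 - alpha) >= 0. Testing R_g <= C gives
  alpha (2 - alpha) <= 0 as soon as r^2 exp(2 u(r x)) tends to 0 in measure on the annulus, which
  holds if alpha > 1 by the logarithmic growth, or if the volume is finite. Finally, alpha = 0
  contradicts finite volume.
*)

theory Submission
  imports Defs
begin

section \<open>Smooth functions\<close>

text \<open>The obstacle is that f is only in L^1 and determines u only up to functions annihilated
  by (-Laplace)^(n/2), such as harmonic polynomials. The curvature sign removes these: an energy of
  order L^(n-2) bounds the mean of |grad u| over the ball of radius L by a multiple of 1/L, and this
  mean is what the truncation error measures. An L^1 density gives no pointwise control at infinity,
  but for n >= 4 the kernel x/|x|^2 is locally in L^2. Convergence of gradients in L^2 is just
  enough, since after one integration by parts the curvature is quadratic in grad u. For the model u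
  = -\<alpha> log|x| the quantity -Laplace u - (n-2)/2 |grad u|^2 equals (n-2)/2 * \<alpha> (2 -
  \<alpha>)/|x|^2, which is the origin of the product \<alpha> (2 - \<alpha>). The value \<alpha> =
  2 belongs to the round sphere, and beyond \<alpha> = 1 the factor r^2 exp(2u) decays; hence the
  gap between c/2 and c. The upper bound on R_g brings in exp(2u), for which no integrability is at
  hand; a bounded cut-off in the size of u makes convergence in measure sufficient.\<close>

lemma GDERIV_pderiv_dir:
  assumes "GDERIV f x :> D"
  shows "pderiv_dir b f x = b \<bullet> D"
  by (simp add: pderiv_dir_def flip: frechet_derivative_at[OF assms[unfolded gderiv_def]])

lemma gradient_inner_Basis:
  "b \<in> Basis \<Longrightarrow> gradient f x \<bullet> b = pderiv_dir b f x"
  by (simp add: gradient_def inner_sum_left inner_Basis if_distrib cong: if_cong)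

lemma GDERIV_imp_gradient:
  assumes "GDERIV f x :> D"
  shows "gradient f x = D"
proof (rule euclidean_eqI)
  fix b :: 'a assume "b \<in> Basis"
  then show "gradient f x \<bullet> b = D \<bullet> b"
    using GDERIV_pderiv_dir[OF assms, of b] gradient_inner_Basis[of b f x] by (simp add: inner_commute)
qed

lemma pderiv_dir_eqI:
  assumes "\<And>x. GDERIV f x :> D x"
  shows "pderiv_dir b f = (\<lambda>x. D x \<bullet> b)"
  by (rule ext) (simp add: GDERIV_pderiv_dir[OF assms] inner_commute)

lemma GDERIV_imp_differentiable: "GDERIV f x :> D \<Longrightarrow> f differentiable (at x)"
  unfolding gderiv_def differentiable_def by blast

lemma GDERIV_isCont: "GDERIV f x :> D \<Longrightarrow> isCont f x"
  unfolding gderiv_def by (rule has_derivative_continuous)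

lemma smooth_differentiable: "smooth f \<Longrightarrow> f differentiable (at x)"
  unfolding smooth_def by (metis C_k.simps(2))

lemma smooth_pderiv_dir: "smooth f \<Longrightarrow> b \<in> Basis \<Longrightarrow> smooth (pderiv_dir b f)"
  unfolding smooth_def by (metis C_k.simps(2))

lemma smooth_continuous_on: "smooth f \<Longrightarrow> continuous_on S f"
  unfolding smooth_def by (metis C_k.simps(1) continuous_on_subset subset_UNIV)

lemma smooth_GDERIV: "smooth f \<Longrightarrow> GDERIV f x :> gradient f x"
  by (simp add: gderiv_gradient smooth_differentiable)

lemma smooth_continuous_on_gradient: "smooth f \<Longrightarrow> continuous_on S (gradient f)"
  unfolding gradient_def[abs_def]
  by (intro continuous_intros smooth_continuous_on smooth_pderiv_dir)

lemma C_k_differentiable: "C_k (Suc k) f \<Longrightarrow> GDERIV f x :> gradient f x"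
  by (simp add: gderiv_gradient)

lemma C_k_add: "C_k k f \<Longrightarrow> C_k k g \<Longrightarrow> C_k k (\<lambda>x. f x + g x)"
proof (induction k arbitrary: f g)
  case (Suc k)
  have G: "GDERIV (\<lambda>x. f x + g x) x :> gradient f x + gradient g x" for x
    using Suc.prems by (intro GDERIV_add C_k_differentiable)
  have "(\<lambda>x. f x + g x) differentiable (at x)" for x
    using G by (rule GDERIV_imp_differentiable)
  moreover have "C_k k (pderiv_dir b (\<lambda>x. f x + g x))" if "b \<in> Basis" for b
    using Suc that by (simp add: pderiv_dir_eqI[OF G] inner_add_left gradient_inner_Basis)
  ultimately show ?case by simp
qed (simp add: continuous_on_add)

lemma C_k_minus: "C_k k f \<Longrightarrow> C_k k (\<lambda>x. - f x)"
proof (induction k arbitrary: f)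
  case (Suc k)
  have G: "GDERIV (\<lambda>x. - f x) x :> - gradient f x" for x
    using Suc.prems by (intro GDERIV_minus C_k_differentiable)
  have "(\<lambda>x. - f x) differentiable (at x)" for x
    using G by (rule GDERIV_imp_differentiable)
  moreover have "C_k k (pderiv_dir b (\<lambda>x. - f x))" if "b \<in> Basis" for b
    using Suc that by (simp add: pderiv_dir_eqI[OF G] gradient_inner_Basis)
  ultimately show ?case by simp
qed (simp add: continuous_on_minus)

section \<open>Translations, and smoothness of the iterates of -Laplace\<close>

lemma GDERIV_shift:
  assumes "GDERIV f (a + x) :> D"
  shows "GDERIV (\<lambda>x. f (a + x)) x :> D"
proof -
  have "((\<lambda>x. a + x) has_derivative (\<lambda>h. h)) (at x)"
    by (auto intro!: derivative_eq_intros)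
  from has_derivative_compose[OF this assms[unfolded gderiv_def]] show ?thesis
    by (simp add: gderiv_def)
qed

lemma pderiv_dir_shift:
  assumes "\<And>x. f differentiable (at x)" "b \<in> Basis"
  shows "pderiv_dir b (\<lambda>x. f (a + x)) = (\<lambda>x. pderiv_dir b f (a + x))"
  by (simp add: pderiv_dir_eqI[OF GDERIV_shift[OF gderiv_gradient[OF assms(1)]]] gradient_inner_Basis assms(2))

lemma C_k_shift: "C_k k f \<Longrightarrow> C_k k (\<lambda>x. f (a + x))"
proof (induction k arbitrary: f)
  case 0
  then show ?case
    by (auto intro!: continuous_on_compose2[of UNIV f] continuous_intros)
next
  case (Suc k)
  have "GDERIV (\<lambda>x. f (a + x)) x :> gradient f (a + x)" for x
    using Suc.prems by (intro GDERIV_shift C_k_differentiable)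
  then have "(\<lambda>x. f (a + x)) differentiable (at x)" for x
    using GDERIV_imp_differentiable by blast
  then show ?case
    using Suc by (simp add: pderiv_dir_shift)
qed

lemma smooth_shift: "smooth f \<Longrightarrow> smooth (\<lambda>x. f (a + x))"
  by (simp add: smooth_def C_k_shift)

lemma smooth_minus: "smooth f \<Longrightarrow> smooth (\<lambda>x. - f x)"
  by (simp add: smooth_def C_k_minus)

lemma smooth_const_0: "smooth (\<lambda>x. 0)"
proof -
  have "C_k k (\<lambda>x::'a. 0)" for k
  proof (induction k)
    case (Suc k)
    have "pderiv_dir b (\<lambda>x::'a. 0) = (\<lambda>x. 0)" for b
      using pderiv_dir_eqI[OF GDERIV_const] by simp
    with Suc show ?case by simp
  qed simp
  then show ?thesis by (simp add: smooth_def)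
qed

lemma smooth_sum:
  assumes "\<And>i. i \<in> I \<Longrightarrow> smooth (f i)"
  shows "smooth (\<lambda>x. \<Sum>i\<in>I. f i x)"
  using assms
proof (induction I rule: infinite_finite_induct)
  case (insert i I)
  then show ?case
    by (simp add: smooth_def C_k_add)
qed (simp_all add: smooth_const_0)

lemma smooth_neg_laplacian: "smooth f \<Longrightarrow> smooth (neg_laplacian f)"
  unfolding neg_laplacian_def[abs_def] laplacian_def
  by (intro smooth_minus smooth_sum smooth_pderiv_dir)

lemma smooth_neg_laplacian_funpow: "smooth f \<Longrightarrow> smooth ((neg_laplacian ^^ k) f)"
  by (induction k) (simp_all add: smooth_neg_laplacian)

lemma neg_laplacian_shift:
  assumes "smooth f"
  shows "neg_laplacian (\<lambda>x. f (a + x)) = (\<lambda>x. neg_laplacian f (a + x))"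
  by (rule ext) (simp add: neg_laplacian_def laplacian_def pderiv_dir_shift assms
      smooth_differentiable smooth_pderiv_dir cong: sum.cong)

lemma neg_laplacian_funpow_shift:
  assumes "smooth f"
  shows "(neg_laplacian ^^ k) (\<lambda>x. f (a + x)) = (\<lambda>x. (neg_laplacian ^^ k) f (a + x))"
  by (induction k) (simp_all add: neg_laplacian_shift smooth_neg_laplacian_funpow assms)

section \<open>Integration by parts\<close>

lemma integrable_continuous_compact_support:
  fixes f :: "'a::euclidean_space \<Rightarrow> real"
  assumes "continuous_on UNIV f" "\<And>x. x \<notin> cball 0 R \<Longrightarrow> f x = 0"
  shows "integrable lborel f"
proof -
  have "integrable lborel (\<lambda>x. indicator (cball 0 R) x *\<^sub>R f x)"
    using assms(1) by (intro borel_integrable_compact) (auto intro: continuous_on_subset)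
  moreover have "(\<lambda>x. indicator (cball 0 R) x *\<^sub>R f x) = f"
    using assms(2) by (auto simp: indicator_def fun_eq_iff)
  ultimately show ?thesis by simp
qed

lemma lborel_integral_shift:
  fixes f :: "'a::euclidean_space \<Rightarrow> real"
  assumes "f \<in> borel_measurable borel"
  shows "(\<integral>x. f (a + x) \<partial>lborel) = (\<integral>x. f x \<partial>lborel)"
proof -
  have "(\<integral>x. f x \<partial>lborel) = (\<integral>x. f x \<partial>distr lborel borel ((+) a))"
    by (simp add: lborel_distr_plus)
  also have "\<dots> = (\<integral>x. f (a + x) \<partial>lborel)"
    using assms by (subst integral_distr) auto
  finally show ?thesis by simp
qed

lemma lborel_integrable_shift:
  fixes f :: "'a::euclidean_space \<Rightarrow> real"
  assumes "integrable lborel f"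
  shows "integrable lborel (\<lambda>x. f (a + x))"
proof -
  have "integrable (distr lborel borel ((+) a)) f"
    using assms by (simp add: lborel_distr_plus)
  then show ?thesis
    using assms by (subst (asm) integrable_distr_eq) auto
qed

text \<open>The difference quotients integrate to 0 by translation invariance, so no Fubini is needed.\<close>

lemma integral_directional_derivative_eq_0:
  fixes g :: "'a::euclidean_space \<Rightarrow> real"
  assumes g: "\<And>x. GDERIV g x :> g' x" and cont: "continuous_on UNIV g'"
    and supp: "\<And>x. x \<notin> cball 0 R \<Longrightarrow> g x = 0" and b: "norm b = 1"
  shows "(\<integral>x. g' x \<bullet> b \<partial>lborel) = 0"
proof -
  have contg: "continuous_on UNIV g"
    using g GDERIV_isCont by (blast intro: continuous_at_imp_continuous_on)
  have [measurable]: "g \<in> borel_measurable borel"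
    using contg by (rule borel_measurable_continuous_onI)
  have [measurable]: "g' \<in> borel_measurable borel"
    using cont by (rule borel_measurable_continuous_onI)
  have intg: "integrable lborel g"
    using contg supp by (rule integrable_continuous_compact_support)
  \<comment> \<open>The step sizes \<open>d k\<close> below are at most 1, so the difference
    quotients vanish off the ball of radius \<open>R + 1\<close> and the mean-value points stay in
    the ball of radius \<open>R + 2\<close>.\<close>
  have "compact (g' ` cball 0 (R + 2))"
    using cont by (intro compact_continuous_image) (auto intro: continuous_on_subset)
  then obtain B where B: "\<And>x. x \<in> cball 0 (R + 2) \<Longrightarrow> norm (g' x) \<le> B"
    by (meson bounded_iff compact_imp_bounded imageI)
  define d where "d k = (1::real) / Suc k" for k :: nat
  have d: "0 < d k" "d k \<le> 1" for k by (auto simp: d_def)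
  define q where "q k x = (g (d k *\<^sub>R b + x) - g x) / d k" for k x
  have line: "((\<lambda>t. g (t *\<^sub>R b + x)) has_real_derivative g' (t *\<^sub>R b + x) \<bullet> b) (at t within S)" for t x S
  proof -
    have "((\<lambda>t. t *\<^sub>R b + x) has_derivative (\<lambda>h. h *\<^sub>R b)) (at t)"
      by (auto intro!: derivative_eq_intros)
    from has_derivative_compose[OF this g[unfolded gderiv_def]]
    have "((\<lambda>t. g (t *\<^sub>R b + x)) has_real_derivative g' (t *\<^sub>R b + x) \<bullet> b) (at t)"
      by (simp add: has_field_derivative_def inner_commute mult_commute_abs)
    then show ?thesis by (rule has_field_derivative_at_within)
  qed
  have "(\<lambda>k. \<integral>x. q k x \<partial>lborel) \<longlonglongrightarrow> (\<integral>x. g' x \<bullet> b \<partial>lborel)"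
  proof (rule integral_dominated_convergence)
    show "integrable lborel (\<lambda>x::'a. B * indicator (cball 0 (R + 1)) x)"
      by (intro integrable_mult_right integrable_real_indicator) (use emeasure_bounded_finite[of "cball (0::'a) (R + 1)"] in auto)
    show "AE x in lborel. (\<lambda>k. q k x) \<longlonglongrightarrow> g' x \<bullet> b"
    proof (rule AE_I2)
      fix x
      have "((\<lambda>h. (g (h *\<^sub>R b + x) - g x) / h) \<longlongrightarrow> g' x \<bullet> b) (at 0)"
        using line[of x 0 UNIV] by (simp add: DERIV_def)
      moreover have "filterlim d (at 0) sequentially"
        unfolding filterlim_at using LIMSEQ_inverse_real_of_nat
        by (auto simp: d_def[abs_def] inverse_eq_divide)
      ultimately show "(\<lambda>k. q k x) \<longlonglongrightarrow> g' x \<bullet> b"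
        unfolding q_def by (rule filterlim_compose)
    qed
    show "AE x in lborel. norm (q k x) \<le> B * indicator (cball 0 (R + 1)) x" for k
    proof (rule AE_I2)
      fix x
      show "norm (q k x) \<le> B * indicator (cball 0 (R + 1)) x"
      proof (cases "x \<in> cball 0 (R + 1)")
        case True
        have nb: "norm (t *\<^sub>R b + x) \<le> R + 2" if "0 \<le> t" "t \<le> d k" for t
          using norm_triangle_ineq[of "t *\<^sub>R b" x] True that d[of k] b by simp
        obtain z where z: "0 < z" "z < d k" "g (d k *\<^sub>R b + x) - g (0 *\<^sub>R b + x) = (d k - 0) * (g' (z *\<^sub>R b + x) \<bullet> b)"
          using MVT2[OF d(1)[of k], where f = "\<lambda>t. g (t *\<^sub>R b + x)" and f' = "\<lambda>t. g' (t *\<^sub>R b + x) \<bullet> b"] line by blast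
        have "q k x = g' (z *\<^sub>R b + x) \<bullet> b"
          using z(3) d[of k] by (simp add: q_def field_simps)
        also have "norm \<dots> \<le> norm (g' (z *\<^sub>R b + x)) * norm b"
          by (simp add: Cauchy_Schwarz_ineq2)
        also have "\<dots> \<le> B"
          using B nb[of z] z b by simp
        finally show ?thesis using True by simp
      next
        case False
        have "norm x \<le> norm (d k *\<^sub>R b + x) + norm (d k *\<^sub>R b)"
          by (metis add_diff_cancel_left' norm_triangle_ineq4 add.commute)
        with False d[of k] b have "d k *\<^sub>R b + x \<notin> cball 0 R" "x \<notin> cball 0 R"
          by auto
        then show ?thesis using supp False by (simp add: q_def)
      qed
    qed
  qed (simp_all add: q_def[abs_def])
  moreover have "(\<integral>x. q k x \<partial>lborel) = 0" for k
    unfolding q_def using lborel_integral_shift[of g "d k *\<^sub>R b"] lborel_integrable_shift[OF intg] intg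
    by simp
  ultimately show ?thesis
    using LIMSEQ_unique[of "\<lambda>k. 0"] by auto
qed

lemma GDERIV_eq_0_outside_support:
  fixes \<Phi> :: "'a::euclidean_space \<Rightarrow> real"
  assumes \<Phi>: "\<And>x. GDERIV \<Phi> x :> \<Phi>' x" and supp: "\<And>x. x \<notin> cball 0 R \<Longrightarrow> \<Phi> x = 0"
    and x: "x \<notin> cball 0 R"
  shows "\<Phi>' x = 0"
proof -
  have "((\<lambda>x. 0) has_derivative (\<lambda>h. h \<bullet> \<Phi>' x)) (at x)"
  proof (rule has_derivative_transform_within_open[OF \<Phi>[of x, unfolded gderiv_def]])
    show "open (- cball (0::'a) R)" by (simp add: open_Compl)
  qed (use x supp in auto)
  from has_derivative_unique[OF this has_derivative_const] show ?thesis
    by (metis inner_eq_zero_iff)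
qed

lemma integral_by_parts_directional:
  fixes g \<Phi> :: "'a::euclidean_space \<Rightarrow> real"
  assumes g: "\<And>x. GDERIV g x :> g' x" "continuous_on UNIV g'"
    and \<Phi>: "\<And>x. GDERIV \<Phi> x :> \<Phi>' x" "continuous_on UNIV \<Phi>'"
    and supp: "\<And>x. x \<notin> cball 0 R \<Longrightarrow> \<Phi> x = 0" and b: "norm b = 1"
  shows "(\<integral>x. g x * (\<Phi>' x \<bullet> b) \<partial>lborel) = - (\<integral>x. (g' x \<bullet> b) * \<Phi> x \<partial>lborel)"
proof -
  have cg: "continuous_on UNIV g" and c\<Phi>: "continuous_on UNIV \<Phi>"
    using g \<Phi> GDERIV_isCont by (blast intro: continuous_at_imp_continuous_on)+
  have supp': "\<Phi>' x = 0" if "x \<notin> cball 0 R" for x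
    using \<Phi>(1) supp that by (rule GDERIV_eq_0_outside_support)
  have "(\<integral>x. (g x *\<^sub>R \<Phi>' x + \<Phi> x *\<^sub>R g' x) \<bullet> b \<partial>lborel) = 0"
    by (rule integral_directional_derivative_eq_0[where g = "\<lambda>x. g x * \<Phi> x" and R = R])
       (use supp in \<open>auto intro!: GDERIV_mult continuous_intros g \<Phi> cg c\<Phi> b\<close>)
  moreover have "integrable lborel (\<lambda>x. g x * (\<Phi>' x \<bullet> b))"
    by (rule integrable_continuous_compact_support[where R = R])
       (use supp' in \<open>auto intro!: continuous_intros g \<Phi> cg c\<Phi>\<close>)
  moreover have "integrable lborel (\<lambda>x. (g' x \<bullet> b) * \<Phi> x)"
    by (rule integrable_continuous_compact_support[where R = R])
       (use supp in \<open>auto intro!: continuous_intros g \<Phi> cg c\<Phi>\<close>)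
  ultimately show ?thesis
    by (simp add: inner_add_left mult.commute)
qed

text \<open>Only one derivative falls on \<open>\<Phi>\<close>, so a C^1 cut-off is admissible. The
  energy estimate and the weight on the annulus use it in this form.\<close>

lemma integral_neg_laplacian_mult:
  fixes g \<Phi> :: "'a::euclidean_space \<Rightarrow> real"
  assumes g: "smooth g"
    and \<Phi>: "\<And>x. GDERIV \<Phi> x :> \<Phi>' x" "continuous_on UNIV \<Phi>'"
    and supp: "\<And>x. x \<notin> cball 0 R \<Longrightarrow> \<Phi> x = 0"
  shows "(\<integral>x. neg_laplacian g x * \<Phi> x \<partial>lborel) = (\<integral>x. gradient g x \<bullet> \<Phi>' x \<partial>lborel)"
proof -
  have c\<Phi>: "continuous_on UNIV \<Phi>"
    using \<Phi> GDERIV_isCont by (blast intro: continuous_at_imp_continuous_on)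
  have supp': "\<Phi>' x = 0" if "x \<notin> cball 0 R" for x
    using \<Phi>(1) supp that by (rule GDERIV_eq_0_outside_support)
  have c: "continuous_on UNIV (pderiv_dir b g)" "continuous_on UNIV (pderiv_dir b (pderiv_dir b g))"
    if "b \<in> Basis" for b
    using that by (auto intro: smooth_continuous_on smooth_pderiv_dir g)
  have i1: "integrable lborel (\<lambda>x. pderiv_dir b (pderiv_dir b g) x * \<Phi> x)" if "b \<in> Basis" for b
    by (rule integrable_continuous_compact_support[where R = R])
       (use supp that in \<open>auto intro!: continuous_intros c c\<Phi>\<close>)
  have i2: "integrable lborel (\<lambda>x. pderiv_dir b g x * (\<Phi>' x \<bullet> b))" if "b \<in> Basis" for b
    by (rule integrable_continuous_compact_support[where R = R])
       (use supp' that in \<open>auto intro!: continuous_intros c \<Phi>\<close>)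
  have "(\<integral>x. neg_laplacian g x * \<Phi> x \<partial>lborel)
      = - (\<Sum>b\<in>Basis. \<integral>x. pderiv_dir b (pderiv_dir b g) x * \<Phi> x \<partial>lborel)"
    using i1 by (simp add: neg_laplacian_def laplacian_def sum_distrib_right flip: sum_negf)
  also have "\<dots> = (\<Sum>b\<in>Basis. \<integral>x. pderiv_dir b g x * (\<Phi>' x \<bullet> b) \<partial>lborel)"
    unfolding sum_negf[symmetric]
  proof (rule sum.cong)
    fix b :: 'a assume b: "b \<in> Basis"
    have "(\<integral>x. pderiv_dir b g x * (\<Phi>' x \<bullet> b) \<partial>lborel)
        = - (\<integral>x. (gradient (pderiv_dir b g) x \<bullet> b) * \<Phi> x \<partial>lborel)"
      using b by (intro integral_by_parts_directional[where R = R])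
        (auto intro!: \<Phi> supp smooth_GDERIV smooth_continuous_on_gradient smooth_pderiv_dir g)
    then show "- (\<integral>x. pderiv_dir b (pderiv_dir b g) x * \<Phi> x \<partial>lborel) = (\<integral>x. pderiv_dir b g x * (\<Phi>' x \<bullet> b) \<partial>lborel)"
      using b by (simp add: gradient_inner_Basis)
  qed simp
  also have "\<dots> = (\<integral>x. (\<Sum>b\<in>Basis. pderiv_dir b g x * (\<Phi>' x \<bullet> b)) \<partial>lborel)"
    using i2 by simp
  also have "\<dots> = (\<integral>x. gradient g x \<bullet> \<Phi>' x \<partial>lborel)"
    unfolding gradient_def inner_sum_left by (simp add: inner_commute)
  finally show ?thesis .
qed

text \<open>\<open>W b\<close> is the gradient of the \<open>b\<close>-component of
  \<open>\<Phi>'\<close>, so the sum on the right is the Laplacian of \<open>\<Phi>\<close>; the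
  second integration by parts is done coordinate by coordinate.\<close>

lemma integral_neg_laplacian_swap:
  fixes g \<Phi> :: "'a::euclidean_space \<Rightarrow> real"
  assumes g: "smooth g"
    and \<Phi>: "\<And>x. GDERIV \<Phi> x :> \<Phi>' x" "continuous_on UNIV \<Phi>'"
    and W: "\<And>b x. b \<in> Basis \<Longrightarrow> GDERIV (\<lambda>x. \<Phi>' x \<bullet> b) x :> W b x"
      "\<And>b. b \<in> Basis \<Longrightarrow> continuous_on UNIV (W b)"
    and supp: "\<And>x. x \<notin> cball 0 R \<Longrightarrow> \<Phi> x = 0"
  shows "(\<integral>x. neg_laplacian g x * \<Phi> x \<partial>lborel) = - (\<integral>x. g x * (\<Sum>b\<in>Basis. W b x \<bullet> b) \<partial>lborel)"
proof -
  have supp': "\<Phi>' x = 0" if "x \<notin> cball 0 R" for x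
    using \<Phi>(1) supp that by (rule GDERIV_eq_0_outside_support)
  have supp'': "W b x = 0" if "b \<in> Basis" "x \<notin> cball 0 R" for b x
    by (rule GDERIV_eq_0_outside_support[where R = R, OF W(1)[OF that(1)]]) (use supp' that in auto)
  have i1: "integrable lborel (\<lambda>x. (gradient g x \<bullet> b) * (\<Phi>' x \<bullet> b))" if "b \<in> Basis" for b
    by (rule integrable_continuous_compact_support[where R = R])
      (auto simp: supp' intro!: continuous_intros smooth_continuous_on_gradient g \<Phi>)
  have i2: "integrable lborel (\<lambda>x. g x * (W b x \<bullet> b))" if "b \<in> Basis" for b
    by (rule integrable_continuous_compact_support[where R = R])
      (auto simp: supp'' that intro!: continuous_intros smooth_continuous_on[OF g] W)
  have "(\<integral>x. neg_laplacian g x * \<Phi> x \<partial>lborel) = (\<integral>x. gradient g x \<bullet> \<Phi>' x \<partial>lborel)"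
    by (rule integral_neg_laplacian_mult[OF g \<Phi> supp])
  also have "\<dots> = (\<Sum>b\<in>Basis. \<integral>x. (gradient g x \<bullet> b) * (\<Phi>' x \<bullet> b) \<partial>lborel)"
    using i1 by (subst euclidean_inner) simp
  also have "\<dots> = (\<Sum>b\<in>Basis. - (\<integral>x. g x * (W b x \<bullet> b) \<partial>lborel))"
  proof (rule sum.cong)
    fix b :: 'a assume b: "b \<in> Basis"
    show "(\<integral>x. (gradient g x \<bullet> b) * (\<Phi>' x \<bullet> b) \<partial>lborel) = - (\<integral>x. g x * (W b x \<bullet> b) \<partial>lborel)"
      by (subst integral_by_parts_directional[where R = R, OF smooth_GDERIV smooth_continuous_on_gradient W(1) W(2)])
        (auto simp: supp' g b)
  qed simp
  also have "\<dots> = - (\<integral>x. g x * (\<Sum>b\<in>Basis. W b x \<bullet> b) \<partial>lborel)"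
    using i2 by (simp add: sum_distrib_left sum_negf)
  finally show ?thesis .
qed

section \<open>Truncated radial functions\<close>

text \<open>Cutting off by 0 keeps as many derivatives as vanish at \<open>T\<close>. This gives
  explicit compactly supported test functions in place of smooth bumps.\<close>

definition trunc :: "real \<Rightarrow> (real \<Rightarrow> real) \<Rightarrow> real \<Rightarrow> real" where
  "trunc T h \<rho> = (if \<rho> < T then h \<rho> else 0)"

lemma trunc_isCont:
  assumes "isCont h \<rho>" "h T = 0"
  shows "isCont (trunc T h) \<rho>"
proof -
  consider "\<rho> < T" | "\<rho> > T" | "\<rho> = T" by linarith
  then show ?thesis
  proof cases
    case 1
    then have "eventually (\<lambda>y. trunc T h y = h y) (nhds \<rho>)"
      unfolding eventually_nhds by (intro exI[of _ "{..<T}"]) (auto simp: trunc_def)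
    then show ?thesis using assms(1) isCont_cong by blast
  next
    case 2
    then have "eventually (\<lambda>y. trunc T h y = 0) (nhds \<rho>)"
      unfolding eventually_nhds by (intro exI[of _ "{T<..}"]) (auto simp: trunc_def)
    then show ?thesis using isCont_cong[of "trunc T h" "\<lambda>_. 0"] by simp
  next
    case 3
    have "(h \<longlongrightarrow> 0) (at T)" using assms 3 by (simp add: isCont_def)
    then have "(trunc T h \<longlongrightarrow> 0) (at T)"
      by (rule Lim_null_comparison[rotated, OF tendsto_rabs_zero]) (auto simp: trunc_def)
    then show ?thesis using 3 by (simp add: isCont_def trunc_def)
  qed
qed

lemma trunc_DERIV:
  assumes h: "(h has_real_derivative h' \<rho>) (at \<rho>)" and T: "h T = 0" "h' T = 0"
  shows "(trunc T h has_real_derivative trunc T h' \<rho>) (at \<rho>)"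
proof -
  consider "\<rho> < T" | "\<rho> > T" | "\<rho> = T" by linarith
  then show ?thesis
  proof cases
    case 1
    then have "eventually (\<lambda>y. trunc T h y = h y) (nhds \<rho>)"
      unfolding eventually_nhds by (intro exI[of _ "{..<T}"]) (auto simp: trunc_def)
    then show ?thesis using h 1 by (subst DERIV_cong_ev[OF refl _ refl]) (simp_all add: trunc_def[of T h'])
  next
    case 2
    then have "eventually (\<lambda>y. trunc T h y = 0) (nhds \<rho>)"
      unfolding eventually_nhds by (intro exI[of _ "{T<..}"]) (auto simp: trunc_def)
    then show ?thesis using 2 by (subst DERIV_cong_ev[OF refl _ refl, where g = "\<lambda>_. 0"]) (simp_all add: trunc_def[of T h'])
  next
    case 3
    \<comment> \<open>At \<open>T\<close> each difference quotient of the truncation is either that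
      of \<open>h\<close> or 0, hence dominated by a quantity tending to
      \<open>h' T = 0\<close>.\<close>
    have "((\<lambda>k. h (T + k) / k) \<longlongrightarrow> 0) (at 0)"
      using h T 3 by (simp add: DERIV_def)
    then have "((\<lambda>k. trunc T h (T + k) / k) \<longlongrightarrow> 0) (at 0)"
      by (rule Lim_null_comparison[rotated, OF tendsto_rabs_zero]) (auto simp: trunc_def)
    then show ?thesis using 3 by (simp add: DERIV_def trunc_def)
  qed
qed

section \<open>Radial functions of |x|^2 and the radial Laplacian\<close>

lemma GDERIV_radial:
  fixes x :: "'a::euclidean_space"
  assumes "(G has_real_derivative G' (x \<bullet> x)) (at (x \<bullet> x))"
  shows "GDERIV (\<lambda>x. G (x \<bullet> x)) x :> (2 * G' (x \<bullet> x)) *\<^sub>R x"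
proof -
  have "GDERIV (\<lambda>x. x \<bullet> x) x :> 2 *\<^sub>R x"
    unfolding gderiv_def by (auto intro!: derivative_eq_intros simp: inner_commute)
  from GDERIV_DERIV_compose[OF this assms] show ?thesis by (simp add: mult.commute)
qed

lemma GDERIV_inner_left: "GDERIV (\<lambda>x. x \<bullet> e) x :> e"
  unfolding gderiv_def by (auto intro!: derivative_eq_intros)

text \<open>A radial profile is handled together with all its derivatives: \<open>H j\<close> is the \<open>j\<close>-th
  derivative of \<open>H 0\<close> as a function of \<open>\<rho> = \<bar>x\<bar>\<^sup>2\<close>.\<close>

definition derivative_sequence :: "real \<Rightarrow> (nat \<Rightarrow> real \<Rightarrow> real) \<Rightarrow> bool" where
  "derivative_sequence s H \<longleftrightarrow> (\<forall>j \<rho>. - s < \<rho> \<longrightarrow> (H j has_real_derivative H (Suc j) \<rho>) (at \<rho>))"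

text \<open>The profile of \<open>-\<Delta>\<close> applied to a radial function in dimension \<open>N\<close>.\<close>

definition radial_op :: "real \<Rightarrow> (nat \<Rightarrow> real \<Rightarrow> real) \<Rightarrow> nat \<Rightarrow> real \<Rightarrow> real" where
  "radial_op N H j \<rho> = - (4 * \<rho> * H (j + 2) \<rho> + (4 * real j + 2 * N) * H (j + 1) \<rho>)"

lemma radial_op_funpow_Suc:
  "(radial_op N ^^ Suc k) H j \<rho> = - (4 * \<rho> * (radial_op N ^^ k) H (j + 2) \<rho>
     + (4 * real j + 2 * N) * (radial_op N ^^ k) H (j + 1) \<rho>)"
  by (simp only: funpow.simps o_apply radial_op_def)

lemma derivative_sequenceD:
  "derivative_sequence s H \<Longrightarrow> - s < \<rho> \<Longrightarrow> (H j has_real_derivative H (Suc j) \<rho>) (at \<rho>)"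
  by (simp add: derivative_sequence_def)

lemma derivative_sequence_radial_op:
  assumes "derivative_sequence s H"
  shows "derivative_sequence s (radial_op N H)"
  unfolding derivative_sequence_def radial_op_def
  by (auto intro!: derivative_eq_intros derivative_sequenceD[OF assms] simp: algebra_simps)

lemma derivative_sequence_Suc:
  "derivative_sequence s H \<Longrightarrow> derivative_sequence s (\<lambda>j. H (Suc j))"
  by (simp add: derivative_sequence_def)

lemma derivative_sequence_funpow:
  "derivative_sequence s H \<Longrightarrow> derivative_sequence s ((radial_op N ^^ k) H)"
  by (induction k) (simp_all add: derivative_sequence_radial_op)

text \<open>Differentiating 4 \<rho> h'' + 2 N h' gives 4 \<rho> h''' + 2 (N + 2) h'': the
  derivative of a profile evolves as a profile in dimension \<open>N + 2\<close>. This matches the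
  dimension shift caused by a factor \<open>x \<bullet> e\<close>.\<close>

lemma radial_op_Suc: "(radial_op N ^^ k) H (Suc j) \<rho> = (radial_op (N + 2) ^^ k) (\<lambda>j. H (Suc j)) j \<rho>"
proof (induction k arbitrary: j)
  case (Suc k)
  have "(radial_op N ^^ k) H (Suc j + i) \<rho> = (radial_op (N + 2) ^^ k) (\<lambda>j. H (Suc j)) (j + i) \<rho>" for i
    using Suc.IH by simp
  then show ?case
    by (simp only: radial_op_funpow_Suc) (simp add: algebra_simps)
qed simp

text \<open>Each application of \<open>radial_op\<close> consumes two orders of vanishing at
  \<open>T\<close>.\<close>

lemma radial_op_funpow_eq_0:
  "(\<And>j. j \<le> 2 * k + i \<Longrightarrow> H j T = 0) \<Longrightarrow> j \<le> i \<Longrightarrow> (radial_op N ^^ k) H j T = 0"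
proof (induction k arbitrary: i j)
  case (Suc k)
  have "(radial_op N ^^ k) H l T = 0" if "l \<le> i + 2" for l
    using Suc.prems(1) that by (intro Suc.IH[of "i + 2"]) auto
  then show ?case
    unfolding radial_op_funpow_Suc using Suc.prems(2) by simp
qed simp

lemma radial_op_funpow_diff:
  "(radial_op N ^^ k) (\<lambda>j \<rho>. F j \<rho> - P j \<rho>) j \<rho> = (radial_op N ^^ k) F j \<rho> - (radial_op N ^^ k) P j \<rho>"
proof (induction k arbitrary: j)
  case (Suc k)
  show ?case
    by (simp only: radial_op_funpow_Suc Suc.IH) (simp add: algebra_simps)
qed simp

lemma continuous_trunc_radial:
  assumes H: "derivative_sequence s H" and s: "0 < s" and "H j T = 0"
  shows "continuous_on UNIV (\<lambda>x::'a::euclidean_space. trunc T (H j) (x \<bullet> x))"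
proof (intro continuous_at_imp_continuous_on ballI)
  fix x :: 'a
  have "- s < x \<bullet> x" using s inner_ge_zero[of x] by linarith
  then have "isCont (H j) (x \<bullet> x)"
    using derivative_sequenceD[OF H] DERIV_isCont by blast
  then have "isCont (trunc T (H j)) (x \<bullet> x)"
    using assms(3) by (rule trunc_isCont)
  moreover have "isCont (\<lambda>x. x \<bullet> x) x"
    by (intro continuous_intros)
  ultimately show "isCont (\<lambda>x. trunc T (H j) (x \<bullet> x)) x"
    by (rule isCont_o2[rotated])
qed

lemma GDERIV_trunc_radial:
  fixes x :: "'a::euclidean_space"
  assumes H: "derivative_sequence s H" and s: "0 < s" and "H j T = 0" "H (Suc j) T = 0"
  shows "GDERIV (\<lambda>x. trunc T (H j) (x \<bullet> x)) x :> (2 * trunc T (H (Suc j)) (x \<bullet> x)) *\<^sub>R x"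
proof (rule GDERIV_radial)
  have "- s < x \<bullet> x" using s inner_ge_zero[of x] by linarith
  then show "(trunc T (H j) has_real_derivative trunc T (H (Suc j)) (x \<bullet> x)) (at (x \<bullet> x))"
    by (intro trunc_DERIV derivative_sequenceD[OF H] assms)
qed

lemma trunc_outside_cball:
  fixes x :: "'a::euclidean_space"
  assumes "x \<notin> cball 0 (sqrt T)" "0 \<le> T"
  shows "trunc T h (x \<bullet> x) = 0"
proof -
  have "sqrt T < norm x" using assms by simp
  then have "T < x \<bullet> x"
    using assms(2) by (metis norm_eq_sqrt_inner real_sqrt_less_iff)
  then show ?thesis by (simp add: trunc_def)
qed

lemma sum_Basis_inner_mult: "(\<Sum>b\<in>Basis. (x \<bullet> b) * (y \<bullet> b)) = x \<bullet> y"
  by (rule euclidean_inner[symmetric])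

text \<open>The Laplacian of (x.e) h(|x|^2) is (x.e) times the radial Laplacian of h in two
  dimensions more, because the cross term of the two gradients contributes an extra 4 h'. The family
  of such test functions is therefore stable under -Laplace and the step can be iterated.\<close>

lemma integral_neg_laplacian_radial:
  fixes g :: "'a::euclidean_space \<Rightarrow> real"
  assumes g: "smooth g" and H: "derivative_sequence s H" and s: "0 < s" and T: "0 \<le> T"
    and vanish: "\<And>j. j \<le> 2 \<Longrightarrow> H j T = 0"
  shows "(\<integral>x. neg_laplacian g x * ((x \<bullet> e) * trunc T (H 0) (x \<bullet> x)) \<partial>lborel)
    = (\<integral>x. g x * ((x \<bullet> e) * trunc T (radial_op (DIM('a) + 2) H 0) (x \<bullet> x)) \<partial>lborel)"
proof -
  define t where "t j x = trunc T (H j) (x \<bullet> x)" for j and x :: 'a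
  define \<Phi>' where "\<Phi>' x = t 0 x *\<^sub>R e + (2 * (x \<bullet> e) * t 1 x) *\<^sub>R x" for x
  define W where "W b x = (2 * t 1 x * (e \<bullet> b)) *\<^sub>R x
    + 2 *\<^sub>R ((2 * (x \<bullet> e) * (x \<bullet> b) * t 2 x) *\<^sub>R x + t 1 x *\<^sub>R ((x \<bullet> e) *\<^sub>R b + (x \<bullet> b) *\<^sub>R e))" for b x
  have t: "GDERIV (t j) x :> (2 * t (Suc j) x) *\<^sub>R x" if "j \<le> 1" for j x
    unfolding t_def using that by (intro GDERIV_trunc_radial[OF H s] vanish) auto
  have ct: "continuous_on UNIV (t j)" if "j \<le> 2" for j
    unfolding t_def using that by (intro continuous_trunc_radial[OF H s] vanish)
  have ct': "continuous_on UNIV (t 0)" "continuous_on UNIV (t 1)" "continuous_on UNIV (t 2)"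
    "continuous_on UNIV (t (Suc 0))"
    by (auto intro: ct)
  have "(\<integral>x. neg_laplacian g x * ((x \<bullet> e) * t 0 x) \<partial>lborel) = - (\<integral>x. g x * (\<Sum>b\<in>Basis. W b x \<bullet> b) \<partial>lborel)"
  proof (rule integral_neg_laplacian_swap[where R = "sqrt T" and \<Phi>' = \<Phi>', OF g])
    show "GDERIV (\<lambda>x. (x \<bullet> e) * t 0 x) x :> \<Phi>' x" for x
      by (rule GDERIV_subst[OF GDERIV_mult[OF GDERIV_inner_left t]])
        (simp_all add: \<Phi>'_def algebra_simps)
    show "GDERIV (\<lambda>x. \<Phi>' x \<bullet> b) x :> W b x" if "b \<in> Basis" for b x
    proof -
      have "(\<lambda>x. \<Phi>' x \<bullet> b) = (\<lambda>x. t 0 x * (e \<bullet> b) + 2 * ((x \<bullet> e) * (x \<bullet> b) * t 1 x))"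
        by (simp add: \<Phi>'_def inner_add_left fun_eq_iff)
      moreover have "GDERIV (\<lambda>x. t 0 x * (e \<bullet> b) + 2 * ((x \<bullet> e) * (x \<bullet> b) * t 1 x)) x :> W b x"
        by (rule GDERIV_subst, rule GDERIV_add, rule GDERIV_mult[OF t GDERIV_const], simp,
            rule GDERIV_mult[OF GDERIV_const GDERIV_mult[OF GDERIV_mult[OF GDERIV_inner_left GDERIV_inner_left] t]])
          (simp_all add: W_def algebra_simps numeral_2_eq_2)
      ultimately show ?thesis by simp
    qed
    show "continuous_on UNIV \<Phi>'" unfolding \<Phi>'_def by (intro continuous_intros ct')
    show "continuous_on UNIV (W b)" for b unfolding W_def by (intro continuous_intros ct')
    show "(x \<bullet> e) * t 0 x = 0" if "x \<notin> cball 0 (sqrt T)" for x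
      using trunc_outside_cball[OF that T] by (simp add: t_def)
  qed
  also have "- (\<integral>x. g x * (\<Sum>b\<in>Basis. W b x \<bullet> b) \<partial>lborel)
      = (\<integral>x. g x * ((x \<bullet> e) * trunc T (radial_op (DIM('a) + 2) H 0) (x \<bullet> x)) \<partial>lborel)"
    unfolding Bochner_Integration.integral_minus[symmetric]
  proof (rule Bochner_Integration.integral_cong)
    fix x :: 'a
    have "(\<Sum>b\<in>Basis. W b x \<bullet> b)
        = (\<Sum>b\<in>Basis. 4 * t 1 x * ((x \<bullet> b) * (e \<bullet> b)) + 4 * (x \<bullet> e) * t 2 x * ((x \<bullet> b) * (x \<bullet> b)) + 2 * t 1 x * (x \<bullet> e))"
      by (rule sum.cong) (auto simp: W_def inner_add_left algebra_simps)
    also have "\<dots> = 4 * t 1 x * (x \<bullet> e) + 4 * (x \<bullet> e) * t 2 x * (x \<bullet> x) + 2 * DIM('a) * t 1 x * (x \<bullet> e)"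
      by (simp only: sum.distrib sum_distrib_left[symmetric] sum_Basis_inner_mult sum_constant) simp
    also have "\<dots> = - ((x \<bullet> e) * trunc T (radial_op (DIM('a) + 2) H 0) (x \<bullet> x))"
      by (auto simp: t_def trunc_def radial_op_def algebra_simps numeral_2_eq_2)
    finally show "- (g x * (\<Sum>b\<in>Basis. W b x \<bullet> b)) = g x * ((x \<bullet> e) * trunc T (radial_op (DIM('a) + 2) H 0) (x \<bullet> x))"
      by simp
  qed simp
  finally show ?thesis by (simp add: t_def)
qed

lemma integral_neg_laplacian_funpow_radial:
  fixes g :: "'a::euclidean_space \<Rightarrow> real"
  assumes g: "smooth g" and H: "derivative_sequence s H" and s: "0 < s" and T: "0 \<le> T"
    and vanish: "\<And>j. j \<le> 2 * k \<Longrightarrow> H j T = 0"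
  shows "(\<integral>x. (neg_laplacian ^^ k) g x * ((x \<bullet> e) * trunc T (H 0) (x \<bullet> x)) \<partial>lborel)
    = (\<integral>x. g x * ((x \<bullet> e) * trunc T ((radial_op (DIM('a) + 2) ^^ k) H 0) (x \<bullet> x)) \<partial>lborel)"
  using H vanish
proof (induction k arbitrary: H)
  case (Suc k)
  have "(\<integral>x. (neg_laplacian ^^ Suc k) g x * ((x \<bullet> e) * trunc T (H 0) (x \<bullet> x)) \<partial>lborel)
    = (\<integral>x. (neg_laplacian ^^ k) g x * ((x \<bullet> e) * trunc T (radial_op (DIM('a) + 2) H 0) (x \<bullet> x)) \<partial>lborel)"
    using integral_neg_laplacian_radial[OF smooth_neg_laplacian_funpow[OF g] Suc.prems(1) s T] Suc.prems(2)
    by simp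
  also have "\<dots> = (\<integral>x. g x * ((x \<bullet> e) * trunc T ((radial_op (DIM('a) + 2) ^^ k) (radial_op (DIM('a) + 2) H) 0) (x \<bullet> x)) \<partial>lborel)"
    by (intro Suc.IH derivative_sequence_radial_op Suc.prems) (auto simp: radial_op_def Suc.prems)
  finally show ?case by (simp only: funpow_Suc_right[of k "radial_op _"] o_apply)
qed simp

text \<open>Testing the equation for \<open>u\<close> against a directional derivative of a radial function, rather
  than the differentiated equation against the radial function itself, avoids commuting partial
  derivatives.\<close>

lemma integral_pderiv_radial:
  fixes g :: "'a::euclidean_space \<Rightarrow> real"
  assumes g: "smooth g" and H: "derivative_sequence s H" and s: "0 < s" and T: "0 \<le> T"
    and vanish: "\<And>j. j \<le> 2 * k + 1 \<Longrightarrow> H j T = 0" and e: "e \<in> Basis"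
  shows "2 * (\<integral>x. (neg_laplacian ^^ k) g x * ((x \<bullet> e) * trunc T (H 1) (x \<bullet> x)) \<partial>lborel)
    = - (\<integral>x. pderiv_dir e g x * trunc T ((radial_op DIM('a) ^^ k) H 0) (x \<bullet> x) \<partial>lborel)"
proof -
  define K where "K = (radial_op DIM('a) ^^ k) H"
  have K: "derivative_sequence s K" "K 0 T = 0" "K (Suc 0) T = 0"
    unfolding K_def using vanish by (auto intro: derivative_sequence_funpow H radial_op_funpow_eq_0[of _ 1])
  have "(\<integral>x. (neg_laplacian ^^ k) g x * ((x \<bullet> e) * trunc T (H (Suc 0)) (x \<bullet> x)) \<partial>lborel)
    = (\<integral>x. g x * ((x \<bullet> e) * trunc T ((radial_op (DIM('a) + 2) ^^ k) (\<lambda>j. H (Suc j)) 0) (x \<bullet> x)) \<partial>lborel)"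
    using vanish by (intro integral_neg_laplacian_funpow_radial[OF g derivative_sequence_Suc[OF H] s T]) auto
  \<comment> \<open>The profile reached in dimension \<open>DIM('a) + 2\<close> is the derivative of
    the profile \<open>K 0\<close> in the original dimension. Hence twice (x.e) times it is the
    \<open>e\<close>-derivative of K 0 (|x|^2), and one more integration by parts moves that
    derivative onto \<open>g\<close>.\<close>
  also have "(radial_op (DIM('a) + 2) ^^ k) (\<lambda>j. H (Suc j)) 0 = K (Suc 0)"
    unfolding K_def fun_eq_iff radial_op_Suc by (simp add: add.commute)
  also have "2 * (\<integral>x. g x * ((x \<bullet> e) * trunc T (K (Suc 0)) (x \<bullet> x)) \<partial>lborel)
      = (\<integral>x. g x * (((2 * trunc T (K (Suc 0)) (x \<bullet> x)) *\<^sub>R x) \<bullet> e) \<partial>lborel)"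
    by (subst integral_mult_right_zero[symmetric]) (simp add: ac_simps)
  also have "\<dots> = - (\<integral>x. (gradient g x \<bullet> e) * trunc T (K 0) (x \<bullet> x) \<partial>lborel)"
  proof (rule integral_by_parts_directional[where R = "sqrt T"])
    show "GDERIV (\<lambda>x. trunc T (K 0) (x \<bullet> x)) x :> (2 * trunc T (K (Suc 0)) (x \<bullet> x)) *\<^sub>R x" for x :: 'a
      by (intro GDERIV_trunc_radial[OF K(1) s] K)
    show "continuous_on UNIV (\<lambda>x::'a. (2 * trunc T (K (Suc 0)) (x \<bullet> x)) *\<^sub>R x)"
      by (intro continuous_intros continuous_trunc_radial[OF K(1) s] K)
  qed (use e T in \<open>auto intro!: smooth_GDERIV smooth_continuous_on_gradient g trunc_outside_cball\<close>)
  finally show ?thesis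
    by (simp add: K_def gradient_inner_Basis e)
qed

section \<open>The logarithmic kernel\<close>

text \<open>Closed form of the \<open>j\<close>-th derivative of - ln (s + \<rho>). With \<rho> =
  |x|^2 and s = 0 the profile is 2 log (1/|x|), which is where the factor 2 in the representation of
  the gradient comes from.\<close>

definition log_profile :: "real \<Rightarrow> nat \<Rightarrow> real \<Rightarrow> real" where
  "log_profile s j \<rho> = (if j = 0 then - ln (s + \<rho>) else (- 1) ^ j * fact (j - 1) / (s + \<rho>) ^ j)"

text \<open>The Taylor polynomial at \<open>T\<close> of degree \<open>M - 1\<close>, and its derivatives. Subtracting it from the
  logarithm makes the truncation at \<open>T\<close> as smooth as needed.\<close>

definition log_taylor :: "real \<Rightarrow> real \<Rightarrow> nat \<Rightarrow> nat \<Rightarrow> real \<Rightarrow> real" where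
  "log_taylor s T M j \<rho> = (\<Sum>i<M - j. log_profile s (i + j) T * (\<rho> - T) ^ i / fact i)"

text \<open>This is (n-1)! (2 sqrt s / (s + |x|^2))^n with n = 2 m: the Q-curvature (n-1)! of the
  unit sphere times its volume density in stereographic coordinates dilated by sqrt s.\<close>

definition bubble :: "nat \<Rightarrow> real \<Rightarrow> real \<Rightarrow> real" where
  "bubble m s \<rho> = 4 ^ m * fact (2 * m - 1) * s ^ m / (s + \<rho>) ^ (2 * m)"

lemma derivative_sequence_log_profile: "derivative_sequence s (log_profile s)"
  unfolding derivative_sequence_def
proof (intro allI impI)
  fix j and \<rho> :: real assume \<rho>: "- s < \<rho>"
  show "(log_profile s j has_real_derivative log_profile s (Suc j) \<rho>) (at \<rho>)"
  proof (cases j)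
    case 0
    then show ?thesis using \<rho>
      by (auto simp: log_profile_def[abs_def] intro!: derivative_eq_intros)
  next
    case (Suc l)
    have "((\<lambda>x. inverse (s + x)) has_real_derivative - (inverse (s + \<rho>) * inverse (s + \<rho>))) (at \<rho>)"
      using \<rho> by (auto intro!: derivative_eq_intros)
    from DERIV_cmult[OF DERIV_power_Suc[OF this], of "(- 1) ^ Suc l * fact l" l]
    have "((\<lambda>x. (- 1) ^ Suc l * fact l * inverse (s + x) ^ Suc l) has_real_derivative
        (- 1) ^ Suc (Suc l) * fact (Suc l) * inverse (s + \<rho>) ^ Suc (Suc l)) (at \<rho>)"
      by (rule DERIV_cong) (simp add: algebra_simps)
    then show ?thesis
      using Suc by (simp add: log_profile_def[abs_def] divide_inverse power_inverse)
  qed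
qed

lemma derivative_sequence_log_taylor: "derivative_sequence s (log_taylor s T M)"
  unfolding derivative_sequence_def
proof (intro allI impI)
  fix j and \<rho> :: real
  have "(log_taylor s T M j has_real_derivative
      (\<Sum>i<M - j. log_profile s (i + j) T * (real i * (\<rho> - T) ^ (i - 1)) / fact i)) (at \<rho>)"
    unfolding log_taylor_def[abs_def] by (auto intro!: derivative_eq_intros sum.cong)
  also have "(\<Sum>i<M - j. log_profile s (i + j) T * (real i * (\<rho> - T) ^ (i - 1)) / fact i) = log_taylor s T M (Suc j) \<rho>"
  proof (cases "M - j")
    case (Suc l)
    then have "M - Suc j = l" by simp
    moreover have "log_profile s (Suc i + j) T * (real (Suc i) * (\<rho> - T) ^ (Suc i - 1)) / fact (Suc i)
        = log_profile s (i + Suc j) T * (\<rho> - T) ^ i / fact i" for i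
      by (simp add: fact_Suc divide_simps del: of_nat_Suc)
    ultimately show ?thesis
      unfolding Suc by (subst sum.lessThan_Suc_shift) (simp add: log_taylor_def del: fact_Suc of_nat_Suc)
  qed (simp add: log_taylor_def)
  finally show "(log_taylor s T M j has_real_derivative log_taylor s T M (Suc j) \<rho>) (at \<rho>)" .
qed

lemma log_taylor_center:
  assumes "j < M"
  shows "log_taylor s T M j T = log_profile s j T"
proof -
  obtain l where "M - j = Suc l" using assms by (metis Suc_diff_Suc)
  then show ?thesis
    by (simp add: log_taylor_def sum.lessThan_Suc_shift)
qed

text \<open>By scaling, the derivative of order i + j of the logarithm at \<open>T\<close> is of
  size at most T^(-i-j), while |\<rho> - T|^i is at most T^i; every \<open>radial_op\<close> then
  costs one more factor 1/T. The bound is uniform in \<open>s\<close>, so that s can tend to 0 at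
  fixed T. The case \<open>k = j = 0\<close> is excluded because the logarithm itself has no such
  bound.\<close>

lemma log_taylor_bound:
  assumes "0 < k + j"
  shows "\<exists>C\<ge>0. \<forall>s T \<rho>. 0 < s \<and> 0 < T \<and> 0 \<le> \<rho> \<and> \<rho> \<le> T \<longrightarrow>
    \<bar>(radial_op N ^^ k) (log_taylor s T M) j \<rho>\<bar> \<le> C / T ^ (k + j)"
  using assms
proof (induction k arbitrary: j)
  case 0
  define C :: real where "C = (\<Sum>i<M - j. fact (i + j - 1))"
  have "\<bar>log_taylor s T M j \<rho>\<bar> \<le> C / T ^ j" if *: "0 < s" "0 < T" "0 \<le> \<rho>" "\<rho> \<le> T" for s T \<rho>
  proof -
    have "\<bar>log_profile s (i + j) T * (\<rho> - T) ^ i / fact i\<bar> \<le> fact (i + j - 1) / T ^ j" for i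
    proof -
      have "\<bar>log_profile s (i + j) T * (\<rho> - T) ^ i / fact i\<bar> = \<bar>log_profile s (i + j) T\<bar> * \<bar>\<rho> - T\<bar> ^ i / fact i"
        by (simp add: abs_mult power_abs)
      also have "\<dots> \<le> \<bar>log_profile s (i + j) T\<bar> * \<bar>\<rho> - T\<bar> ^ i / 1"
        by (intro divide_left_mono) (auto simp: fact_ge_1)
      also have "\<dots> = \<bar>log_profile s (i + j) T\<bar> * \<bar>\<rho> - T\<bar> ^ i" by simp
      also have "\<bar>log_profile s (i + j) T\<bar> = fact (i + j - 1) / (s + T) ^ (i + j)"
        using 0 * by (simp add: log_profile_def abs_mult power_abs)
      also have "\<dots> * \<bar>\<rho> - T\<bar> ^ i \<le> fact (i + j - 1) / T ^ (i + j) * T ^ i"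
        using * by (intro mult_mono divide_left_mono power_mono mult_pos_pos zero_less_power) auto
      also have "\<dots> = fact (i + j - 1) / T ^ j"
        using * by (simp add: power_add)
      finally show ?thesis .
    qed
    then have "\<bar>log_taylor s T M j \<rho>\<bar> \<le> (\<Sum>i<M - j. fact (i + j - 1) / T ^ j)"
      unfolding log_taylor_def by (intro order_trans[OF sum_abs] sum_mono) blast
    then show ?thesis by (simp add: C_def sum_divide_distrib)
  qed
  moreover have "0 \<le> C" unfolding C_def by (intro sum_nonneg) simp
  ultimately show ?case by auto
next
  case (Suc k)
  obtain C1 where C1: "C1 \<ge> 0" "\<And>s T \<rho>. 0 < s \<and> 0 < T \<and> 0 \<le> \<rho> \<and> \<rho> \<le> T \<Longrightarrow>
    \<bar>(radial_op N ^^ k) (log_taylor s T M) (j + 1) \<rho>\<bar> \<le> C1 / T ^ (k + (j + 1))"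
    using Suc.IH[of "j + 1"] by auto
  obtain C2 where C2: "C2 \<ge> 0" "\<And>s T \<rho>. 0 < s \<and> 0 < T \<and> 0 \<le> \<rho> \<and> \<rho> \<le> T \<Longrightarrow>
    \<bar>(radial_op N ^^ k) (log_taylor s T M) (j + 2) \<rho>\<bar> \<le> C2 / T ^ (k + (j + 2))"
    using Suc.IH[of "j + 2"] by auto
  have "\<bar>(radial_op N ^^ Suc k) (log_taylor s T M) j \<rho>\<bar> \<le> (4 * C2 + (4 * real j + 2 * \<bar>N\<bar>) * C1) / T ^ (Suc k + j)"
    if *: "0 < s" "0 < T" "0 \<le> \<rho>" "\<rho> \<le> T" for s T \<rho>
  proof -
    let ?R = "(radial_op N ^^ k) (log_taylor s T M)"
    have "\<bar>(radial_op N ^^ Suc k) (log_taylor s T M) j \<rho>\<bar>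
      \<le> \<bar>4 * \<rho> * ?R (j + 2) \<rho>\<bar> + \<bar>(4 * real j + 2 * N) * ?R (j + 1) \<rho>\<bar>"
      unfolding radial_op_funpow_Suc abs_minus_cancel by (rule abs_triangle_ineq)
    also have "\<dots> = 4 * \<rho> * \<bar>?R (j + 2) \<rho>\<bar> + \<bar>4 * real j + 2 * N\<bar> * \<bar>?R (j + 1) \<rho>\<bar>"
      using * by (simp add: abs_mult)
    also have "\<dots> \<le> 4 * T * (C2 / T ^ (k + (j + 2))) + (4 * real j + 2 * \<bar>N\<bar>) * (C1 / T ^ (k + (j + 1)))"
      using * C1 C2 by (intro add_mono mult_mono) auto
    also have "\<dots> = (4 * C2 + (4 * real j + 2 * \<bar>N\<bar>) * C1) / T ^ (Suc k + j)"
      using * by (simp add: power_add add_divide_distrib)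
    finally show ?thesis .
  qed
  moreover have "0 \<le> 4 * C2 + (4 * real j + 2 * \<bar>N\<bar>) * C1"
    using C1(1) C2(1) by simp
  ultimately show ?case by blast
qed

text \<open>The coefficients in the expansion of \<open>(-\<Delta>)\<^sup>k (- ln (s + \<rho>))\<close> in powers of \<open>s + \<rho>\<close>, in dimension
  \<open>2 m\<close>; for \<open>k = m\<close> all but the last one vanish, which leaves the bubble.\<close>

definition bubble_coeff :: "real \<Rightarrow> nat \<Rightarrow> nat \<Rightarrow> real" where
  "bubble_coeff m k i = real (k choose i) * (\<Prod>l=Suc i..k. m - real l)"

text \<open>One application of \<open>radial_op\<close> raises a power by one or by two, which
  yields this two-term recursion. After the common product \<open>P\<close> is cancelled it reduces
  to Pascal's rule and (j+1) binom(k, j+1) = (k-j) binom(k, j).\<close>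

lemma bubble_coeff_Suc:
  "bubble_coeff m (Suc k) i
    = (m - 1 - real k - real i) * bubble_coeff m k i + (if i = 0 then 0 else bubble_coeff m k (i - 1))"
proof (cases i)
  case 0
  then show ?thesis by (simp add: bubble_coeff_def)
next
  case i: (Suc j)
  consider "Suc j \<le> k" | "j = k" | "j > k" by linarith
  then show ?thesis
  proof cases
    case 1
    define P where "P = (\<Prod>l=Suc (Suc j)..k. m - real l)"
    have P1: "(\<Prod>l=Suc (Suc j)..Suc k. m - real l) = P * (m - real (Suc k))"
      using 1 by (simp add: P_def)
    have P2: "(\<Prod>l=Suc j..k. m - real l) = (m - real (Suc j)) * P"
      using 1 unfolding P_def by (rule prod.atLeast_Suc_atMost)
    have "Suc j * (k choose Suc j) = (k - j) * (k choose j)"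
      using binomial_absorption[of j k] binomial_absorb_comp[of k j] by simp
    then have "real (Suc j) * real (k choose Suc j) = (real k - real j) * real (k choose j)"
      using 1 by (metis of_nat_diff of_nat_mult Suc_leD)
    then have "(real (k choose Suc j) + real (k choose j)) * (m - real (Suc k))
      = (m - 1 - real k - real (Suc j)) * real (k choose Suc j) + (m - real (Suc j)) * real (k choose j)"
      by (simp add: algebra_simps)
    moreover have "(c1 + c0) * (P * q) = a * (c1 * P) + c0 * (b * P)" if "(c1 + c0) * q = a * c1 + b * c0"
      for c1 c0 q a b :: real
    proof -
      have "(c1 + c0) * (P * q) = ((c1 + c0) * q) * P" by simp
      also have "\<dots> = a * (c1 * P) + c0 * (b * P)" unfolding that by (simp add: algebra_simps)
      finally show ?thesis .
    qed
    ultimately show ?thesis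
      unfolding i bubble_coeff_def P1 P2[symmetric] by (simp only: binomial_Suc_Suc of_nat_add P_def[symmetric] P2
          nat.distinct if_False diff_Suc_1 add.commute[of "real (k choose j)"])
  qed (simp_all add: i bubble_coeff_def)
qed

text \<open>All functions involved are combinations of powers of 1/(s + \<rho>) once the logarithm
  has been differentiated, whence the condition \<open>0 < k + j\<close>. The factorials make each
  basis function, together with its derivatives, keep one shape.\<close>

lemma radial_op_log_profile:
  assumes "0 < k + j" "- s < \<rho>"
  shows "(radial_op (2 * m) ^^ k) (log_profile s) j \<rho>
    = (\<Sum>i\<le>k. 4 ^ k * bubble_coeff m k i * s ^ i * ((- 1) ^ j * fact (k + i + j - 1) / (s + \<rho>) ^ (k + i + j)))"
  using assms(1)
proof (induction k arbitrary: j)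
  case 0
  then show ?case by (simp add: log_profile_def bubble_coeff_def)
next
  case (Suc k)
  define E where "E p l = (- 1) ^ l * fact (p + l - 1) / (s + \<rho>) ^ (p + l)" for p l
  let ?b = "bubble_coeff m k"
  have pos: "s + \<rho> > 0" using assms(2) by simp
  \<comment> \<open>Writing \<rho> = (s + \<rho>) - s splits the result into the powers p + 1 and p
    + 2. In dimension 2 m the coefficient of the first vanishes at p = m - 1.\<close>
  have E: "- (4 * \<rho> * E p (j + 2) + (4 * real j + 2 * (2 * m)) * E p (j + 1))
      = 4 * ((m - 1 - real p) * E (Suc p) j + s * E (Suc (Suc p)) j)" for p
  proof -
    define w where "w = (- 1) ^ j * fact (p + j) / (s + \<rho>) ^ Suc (p + j)"
    define q where "q = real (Suc (p + j)) * w / (s + \<rho>)"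
    have "E p (j + 2) = q" "E p (j + 1) = - w" "E (Suc p) j = w" "E (Suc (Suc p)) j = q"
      by (simp_all add: E_def w_def q_def algebra_simps)
    moreover have "\<rho> * q = real (Suc (p + j)) * w - s * q"
      using pos by (simp add: q_def field_simps)
    ultimately show ?thesis
      by (simp add: mult.assoc) (simp add: algebra_simps)
  qed
  have IH: "(radial_op (2 * m) ^^ k) (log_profile s) l \<rho> = (\<Sum>i\<le>k. 4 ^ k * ?b i * s ^ i * E (k + i) l)"
    if "0 < k + l" for l
    using Suc.IH[OF that] by (simp add: E_def)
  have "(radial_op (2 * m) ^^ Suc k) (log_profile s) j \<rho>
      = (\<Sum>i\<le>k. 4 ^ k * ?b i * s ^ i * - (4 * \<rho> * E (k + i) (j + 2) + (4 * real j + 2 * (2 * m)) * E (k + i) (j + 1)))"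
    unfolding radial_op_funpow_Suc
    by (simp add: IH sum_distrib_left flip: sum_negf sum.distrib) (simp add: algebra_simps)
  also have "\<dots> = (\<Sum>i\<le>k. 4 ^ Suc k * ((m - 1 - real k - real i) * ?b i) * s ^ i * E (Suc k + i) j)
      + (\<Sum>i\<le>k. 4 ^ Suc k * ?b i * s ^ Suc i * E (Suc k + Suc i) j)"
    unfolding E sum.distrib[symmetric] by (rule sum.cong) (simp_all add: algebra_simps)
  also have "\<dots> = (\<Sum>i\<le>Suc k. 4 ^ Suc k * ((m - 1 - real k - real i) * ?b i) * s ^ i * E (Suc k + i) j)
      + (\<Sum>i\<le>Suc k. 4 ^ Suc k * (if i = 0 then 0 else ?b (i - 1)) * s ^ i * E (Suc k + i) j)"
    by (subst (2) sum.atMost_Suc_shift) (simp add: bubble_coeff_def)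
  also have "\<dots> = (\<Sum>i\<le>Suc k. 4 ^ Suc k * bubble_coeff m (Suc k) i * s ^ i * E (Suc k + i) j)"
    unfolding sum.distrib[symmetric] bubble_coeff_Suc by (rule sum.cong) (simp_all add: algebra_simps)
  finally show ?case by (simp add: E_def)
qed

lemma radial_op_log_profile_eq_bubble:
  assumes "0 < m" "- s < \<rho>"
  shows "(radial_op (2 * real m) ^^ m) (log_profile s) 0 \<rho> = bubble m s \<rho>"
proof -
  have "bubble_coeff (real m) m i = (if i = m then 1 else 0)" if "i \<le> m" for i
  proof (cases "i = m")
    case False
    with that have "\<exists>l\<in>{Suc i..m}. real m - real l = 0"
      by (intro bexI[of _ m]) auto
    then have "(\<Prod>l=Suc i..m. real m - real l) = 0" by (intro prod_zero) auto
    then show ?thesis using False by (simp add: bubble_coeff_def)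
  qed (simp add: bubble_coeff_def)
  note coeff = this
  have "(radial_op (2 * real m) ^^ m) (log_profile s) 0 \<rho>
     = (\<Sum>i\<le>m. 4 ^ m * bubble_coeff m m i * s ^ i * ((- 1) ^ 0 * fact (m + i + 0 - 1) / (s + \<rho>) ^ (m + i + 0)))"
    using assms by (intro radial_op_log_profile) auto
  also have "\<dots> = (\<Sum>i\<le>m. if i = m then 4 ^ m * s ^ m * (fact (m + m - 1) / (s + \<rho>) ^ (m + m)) else 0)"
    by (intro sum.cong) (simp_all add: coeff)
  also have "\<dots> = bubble m s \<rho>"
    by (simp add: bubble_def mult_2)
  finally show ?thesis .
qed

lemma integrable_trunc_radial:
  fixes \<phi> :: "'a::euclidean_space \<Rightarrow> real"
  assumes \<phi>: "continuous_on UNIV \<phi>" and h: "\<And>\<rho>. 0 \<le> \<rho> \<Longrightarrow> isCont h \<rho>"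
  shows "integrable lborel (\<lambda>x. \<phi> x * trunc T h (x \<bullet> x))"
proof -
  have "continuous_on UNIV (\<lambda>x::'a. h (x \<bullet> x))"
  proof (rule continuous_on_compose2[where g = h and t = "{0..}"])
    show "continuous_on {0..} h"
      using h by (intro continuous_at_imp_continuous_on) auto
    show "continuous_on UNIV (\<lambda>x::'a. x \<bullet> x)"
      by (intro continuous_intros)
  qed auto
  then have "integrable lborel (\<lambda>x::'a. indicator (cball 0 (sqrt T)) x *\<^sub>R (\<phi> x * h (x \<bullet> x)))"
    by (intro borel_integrable_compact continuous_intros) (auto intro: continuous_on_subset \<phi>)
  \<comment> \<open>The strict inequality in \<open>trunc\<close> describes the open ball, so the
    integrand, integrable on the compact ball, is restricted once more.\<close>
  then have "integrable lborel (\<lambda>x::'a. indicator (ball 0 (sqrt T)) x *\<^sub>R (indicator (cball 0 (sqrt T)) x *\<^sub>R (\<phi> x * h (x \<bullet> x))))"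
    by (rule integrable_mult_indicator[rotated]) auto
  moreover have "x \<bullet> x < T \<longleftrightarrow> norm x < sqrt T" for x :: 'a
    by (simp add: norm_eq_sqrt_inner)
  ultimately show ?thesis
    by (elim Bochner_Integration.integrable_cong[THEN iffD1, rotated -1]) (auto simp: trunc_def indicator_def)
qed

text \<open>The test function is the truncated logarithm minus its Taylor polynomial. The logarithm
  produces the bubble on one side and the kernel x/(s + |x|^2) on the other; both error terms stem
  from the Taylor polynomial. Its derivative is O(1/T) while |x| is at most sqrt T, and its image
  under (-Laplace)^m is O(T^(-m)). The constant depends on neither \<open>s\<close> nor
  \<open>T\<close> nor \<open>g\<close>, so the two limits can be taken one after the other.\<close>

lemma gradient_approximate_representation:
  fixes m :: nat
  assumes m: "DIM('a::euclidean_space) = 2 * m"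
  shows "\<exists>C\<ge>0. \<forall>(g::'a \<Rightarrow> real) s T. \<forall>e\<in>Basis. smooth g \<and> integrable lborel ((neg_laplacian ^^ m) g) \<and> 0 < s \<and> 0 < T \<longrightarrow>
    \<bar>(\<integral>x. pderiv_dir e g x * trunc T (bubble m s) (x \<bullet> x) \<partial>lborel)
      - 2 * (\<integral>x. (neg_laplacian ^^ m) g x * ((x \<bullet> e) * trunc T (\<lambda>\<rho>. 1 / (s + \<rho>)) (x \<bullet> x)) \<partial>lborel)\<bar>
    \<le> C * ((\<integral>x. \<bar>(neg_laplacian ^^ m) g x\<bar> \<partial>lborel) / sqrt T
        + (\<integral>x. \<bar>pderiv_dir e g x\<bar> * trunc T (\<lambda>_. 1) (x \<bullet> x) \<partial>lborel) / T ^ m)"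
proof -
  \<comment> \<open>With \<open>2 * m + 2\<close> Taylor coefficients the difference vanishes at
    \<open>T\<close> together with its derivatives up to order 2 m + 1: two for each Laplacian and
    one for the derivative in direction \<open>e\<close>.\<close>
  let ?R = "\<lambda>s T. (radial_op DIM('a) ^^ m) (log_taylor s T (2 * m + 2)) 0"
  let ?P = "\<lambda>s T. log_taylor s T (2 * m + 2) 1"
  have m0: "0 < m" using m DIM_positive[where 'a='a] by simp
  obtain C1 where C1: "C1 \<ge> 0" "\<And>s T \<rho>. 0 < s \<Longrightarrow> 0 < T \<Longrightarrow> 0 \<le> \<rho> \<Longrightarrow> \<rho> \<le> T \<Longrightarrow> \<bar>?R s T \<rho>\<bar> \<le> C1 / T ^ m"
    using log_taylor_bound[of m 0 "DIM('a)" "2 * m + 2"] m0 by auto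
  obtain C2 where C2: "C2 \<ge> 0" "\<And>s T \<rho>. 0 < s \<Longrightarrow> 0 < T \<Longrightarrow> 0 \<le> \<rho> \<Longrightarrow> \<rho> \<le> T \<Longrightarrow> \<bar>?P s T \<rho>\<bar> \<le> C2 / T"
    using log_taylor_bound[of 0 1 "DIM('a)" "2 * m + 2"] by auto
  define C where "C = 2 * C2 + C1"
  have "\<bar>(\<integral>x. pderiv_dir e g x * trunc T (bubble m s) (x \<bullet> x) \<partial>lborel)
      - 2 * (\<integral>x. (neg_laplacian ^^ m) g x * ((x \<bullet> e) * trunc T (\<lambda>\<rho>. 1 / (s + \<rho>)) (x \<bullet> x)) \<partial>lborel)\<bar>
    \<le> C * ((\<integral>x. \<bar>(neg_laplacian ^^ m) g x\<bar> \<partial>lborel) / sqrt T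
        + (\<integral>x. \<bar>pderiv_dir e g x\<bar> * trunc T (\<lambda>_. 1) (x \<bullet> x) \<partial>lborel) / T ^ m)"
    if g: "smooth g" and int: "integrable lborel ((neg_laplacian ^^ m) g)" and s: "0 < s" and T: "0 < T"
      and e: "e \<in> Basis" for g :: "'a \<Rightarrow> real" and s T e
  proof -
    define f where "f = (neg_laplacian ^^ m) g"
    define d where "d = pderiv_dir e g"
    have cf: "continuous_on UNIV f" unfolding f_def by (intro smooth_continuous_on smooth_neg_laplacian_funpow g)
    have cd: "continuous_on UNIV d" unfolding d_def by (intro smooth_continuous_on smooth_pderiv_dir g e)
    define H where "H j \<rho> = log_profile s j \<rho> - log_taylor s T (2 * m + 2) j \<rho>" for j \<rho>
    have H: "derivative_sequence s H"
      using derivative_sequence_log_profile[of s] derivative_sequence_log_taylor[of s T "2 * m + 2"]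
      unfolding derivative_sequence_def H_def by (auto intro!: DERIV_diff)
    have main: "2 * (\<integral>x. f x * ((x \<bullet> e) * trunc T (H 1) (x \<bullet> x)) \<partial>lborel)
      = - (\<integral>x. d x * trunc T ((radial_op DIM('a) ^^ m) H 0) (x \<bullet> x) \<partial>lborel)"
      unfolding f_def d_def using T
      by (intro integral_pderiv_radial[OF g H s _ _ e]) (auto simp: H_def log_taylor_center)
    have contR: "isCont (?R s T) \<rho>" "isCont (?P s T) \<rho>" if "0 \<le> \<rho>" for \<rho>
      using derivative_sequence_log_taylor[of s T "2 * m + 2"] that s
      by (auto intro!: DERIV_isCont derivative_sequenceD derivative_sequence_funpow)
    have contB: "isCont (bubble m s) \<rho>" "isCont (\<lambda>\<rho>. 1 / (s + \<rho>)) \<rho>" if "0 \<le> \<rho>" for \<rho>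
      unfolding bubble_def[abs_def] using that s by (auto intro!: continuous_intros)
    have 1: "trunc T (H 1) (x \<bullet> x) = - trunc T (\<lambda>\<rho>. 1 / (s + \<rho>)) (x \<bullet> x) - trunc T (?P s T) (x \<bullet> x)" for x :: 'a
      by (simp add: trunc_def H_def log_profile_def)
    have 2: "trunc T ((radial_op DIM('a) ^^ m) H 0) (x \<bullet> x)
        = trunc T (bubble m s) (x \<bullet> x) - trunc T (?R s T) (x \<bullet> x)" for x :: 'a
    proof -
      have "- s < x \<bullet> x" using s inner_ge_zero[of x] by linarith
      then show ?thesis
        unfolding H_def trunc_def radial_op_funpow_diff
        using radial_op_log_profile_eq_bubble[OF m0] m by simp
    qed
    have I1: "integrable lborel (\<lambda>x. d x * trunc T (bubble m s) (x \<bullet> x))"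
      by (rule integrable_trunc_radial[OF cd contB(1)])
    have I2: "integrable lborel (\<lambda>x. d x * trunc T (?R s T) (x \<bullet> x))"
      by (rule integrable_trunc_radial[OF cd contR(1)])
    have cfe: "continuous_on UNIV (\<lambda>x. f x * (x \<bullet> e))" by (intro continuous_intros cf)
    have I3: "integrable lborel (\<lambda>x. f x * ((x \<bullet> e) * trunc T (\<lambda>\<rho>. 1 / (s + \<rho>)) (x \<bullet> x)))"
      and I4: "integrable lborel (\<lambda>x. f x * ((x \<bullet> e) * trunc T (?P s T) (x \<bullet> x)))"
      using integrable_trunc_radial[OF cfe contB(2), where T = T] integrable_trunc_radial[OF cfe contR(2), where T = T]
      by (simp_all only: mult.assoc)
    have "(\<integral>x. d x * trunc T (bubble m s) (x \<bullet> x) \<partial>lborel)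
        - 2 * (\<integral>x. f x * ((x \<bullet> e) * trunc T (\<lambda>\<rho>. 1 / (s + \<rho>)) (x \<bullet> x)) \<partial>lborel)
      = (\<integral>x. d x * trunc T (?R s T) (x \<bullet> x) \<partial>lborel) + 2 * (\<integral>x. f x * ((x \<bullet> e) * trunc T (?P s T) (x \<bullet> x)) \<partial>lborel)"
      using main unfolding 1 2 right_diff_distrib mult_minus_right Bochner_Integration.integral_diff[OF I1 I2]
        Bochner_Integration.integral_diff[OF integrable_minus[OF I3] I4] Bochner_Integration.integral_minus
      by linarith
    moreover have "\<bar>\<integral>x. d x * trunc T (?R s T) (x \<bullet> x) \<partial>lborel\<bar> \<le> C1 * ((\<integral>x. \<bar>d x\<bar> * trunc T (\<lambda>_. 1) (x \<bullet> x) \<partial>lborel) / T ^ m)"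
    proof -
      have "\<bar>\<integral>x. d x * trunc T (?R s T) (x \<bullet> x) \<partial>lborel\<bar> \<le> (\<integral>x. \<bar>d x * trunc T (?R s T) (x \<bullet> x)\<bar> \<partial>lborel)"
        by (rule integral_abs_bound)
      also have "\<dots> \<le> (\<integral>x. (C1 / T ^ m) * (\<bar>d x\<bar> * trunc T (\<lambda>_. 1) (x \<bullet> x)) \<partial>lborel)"
      proof (rule integral_mono)
        show "integrable lborel (\<lambda>x. (C1 / T ^ m) * (\<bar>d x\<bar> * trunc T (\<lambda>_. 1) (x \<bullet> x)))"
          using cd by (intro integrable_mult_right integrable_trunc_radial continuous_intros) auto
        show "\<bar>d x * trunc T (?R s T) (x \<bullet> x)\<bar> \<le> (C1 / T ^ m) * (\<bar>d x\<bar> * trunc T (\<lambda>_. 1) (x \<bullet> x))" for x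
          using mult_left_mono[OF C1(2)[OF s T, of "x \<bullet> x"], of "\<bar>d x\<bar>"]
          by (auto simp: trunc_def abs_mult mult.commute)
      qed (use I2 in auto)
      finally show ?thesis by simp
    qed
    moreover have "\<bar>\<integral>x. f x * ((x \<bullet> e) * trunc T (?P s T) (x \<bullet> x)) \<partial>lborel\<bar> \<le> C2 * ((\<integral>x. \<bar>f x\<bar> \<partial>lborel) / sqrt T)"
    proof -
      have "\<bar>\<integral>x. f x * ((x \<bullet> e) * trunc T (?P s T) (x \<bullet> x)) \<partial>lborel\<bar>
          \<le> (\<integral>x. \<bar>f x * ((x \<bullet> e) * trunc T (?P s T) (x \<bullet> x))\<bar> \<partial>lborel)"
        by (rule integral_abs_bound)
      also have "\<dots> \<le> (\<integral>x. (C2 / sqrt T) * \<bar>f x\<bar> \<partial>lborel)"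
      proof (rule integral_mono)
        show "integrable lborel (\<lambda>x. (C2 / sqrt T) * \<bar>f x\<bar>)"
          using int by (simp add: f_def)
        show "\<bar>f x * ((x \<bullet> e) * trunc T (?P s T) (x \<bullet> x))\<bar> \<le> (C2 / sqrt T) * \<bar>f x\<bar>" for x
        proof (cases "x \<bullet> x < T")
          case True
          have "\<bar>x \<bullet> e\<bar> \<le> sqrt T"
            using Basis_le_norm[OF e, of x] real_sqrt_less_mono[OF True] unfolding norm_eq_sqrt_inner by linarith
          then have "\<bar>x \<bullet> e\<bar> * \<bar>?P s T (x \<bullet> x)\<bar> \<le> sqrt T * (C2 / T)"
            using C2(2)[OF s T, of "x \<bullet> x"] True T by (intro mult_mono) auto
          also have "\<dots> = C2 / sqrt T"
            using T by (simp add: field_simps)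
          finally show ?thesis
            using True mult_left_mono[of "\<bar>x \<bullet> e\<bar> * \<bar>?P s T (x \<bullet> x)\<bar>" "C2 / sqrt T" "\<bar>f x\<bar>"]
            by (simp add: trunc_def abs_mult mult.commute)
        qed (use C2(1) T in \<open>simp add: trunc_def\<close>)
      qed (use I4 in auto)
      finally show ?thesis by simp
    qed
    moreover have "0 \<le> (\<integral>x. \<bar>f x\<bar> \<partial>lborel) / sqrt T" "0 \<le> (\<integral>x. \<bar>d x\<bar> * trunc T (\<lambda>_. 1) (x \<bullet> x) \<partial>lborel) / T ^ m"
      using T by (auto intro!: integral_nonneg_AE divide_nonneg_nonneg simp: trunc_def)
    moreover have "C1 * X + 2 * (C2 * Y) \<le> C * (Y + X)" if "0 \<le> X" "0 \<le> Y" for X Y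
      using that C1(1) C2(1) by (simp add: C_def algebra_simps)
    ultimately show ?thesis
      unfolding f_def[symmetric] d_def[symmetric] by (smt (verit, best))
  qed
  moreover have "0 \<le> C" using C1(1) C2(1) by (simp add: C_def)
  ultimately show ?thesis by blast
qed

section \<open>Radial integrals\<close>

text \<open>Layer-cake formula replacing polar coordinates: a superposition of balls is integrated
  layer by layer. In dimension 2 m the ball of radius sqrt (R p) has volume proportional to (R p)^m;
  the maximum with 0 accounts for empty layers.\<close>

lemma nn_integral_radial_layers:
  fixes w R :: "real \<Rightarrow> real" and m :: nat
  assumes m: "DIM('a::euclidean_space) = 2 * m" "0 < m"
    and [measurable]: "w \<in> borel_measurable borel" "R \<in> borel_measurable borel" and w: "\<And>p. 0 \<le> w p"
  shows "(\<integral>\<^sup>+(x::'a). (\<integral>\<^sup>+p. ennreal (w p) * indicator {..R p} (x \<bullet> x) \<partial>lborel) \<partial>lborel)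
    = (\<integral>\<^sup>+p. ennreal (w p * (unit_ball_vol (2 * m) * max 0 (R p) ^ m)) \<partial>lborel)"
proof -
  have "(\<integral>\<^sup>+(x::'a). (\<integral>\<^sup>+p. ennreal (w p) * indicator {..R p} (x \<bullet> x) \<partial>lborel) \<partial>lborel)
    = (\<integral>\<^sup>+p. (\<integral>\<^sup>+(x::'a). ennreal (w p) * indicator {..R p} (x \<bullet> x) \<partial>lborel) \<partial>lborel)"
    by (rule lborel_pair.Fubini') (unfold indicator_def atMost_iff, measurable)
  also have "\<dots> = (\<integral>\<^sup>+p. ennreal (w p * (unit_ball_vol (2 * m) * max 0 (R p) ^ m)) \<partial>lborel)"
  proof (rule nn_integral_cong)
    fix p
    have "(\<integral>\<^sup>+(x::'a). ennreal (w p) * indicator {..R p} (x \<bullet> x) \<partial>lborel)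
        = ennreal (w p) * emeasure lborel {x::'a. x \<bullet> x \<le> R p}"
      by (subst nn_integral_cmult[symmetric] nn_integral_indicator[symmetric])+
        (auto intro!: nn_integral_cong simp: indicator_def nn_integral_cmult[symmetric] simp flip: nn_integral_indicator)
    also have "emeasure lborel {x::'a. x \<bullet> x \<le> R p} = ennreal (unit_ball_vol (2 * m) * max 0 (R p) ^ m)"
    proof (cases "0 \<le> R p")
      case True
      then have "{x::'a. x \<bullet> x \<le> R p} = cball 0 (sqrt (R p))"
        by (auto simp: norm_eq_sqrt_inner)
      then show ?thesis
        using True by (simp add: emeasure_cball m power_mult)
    next
      case False
      then have "{x::'a. x \<bullet> x \<le> R p} = {}"
        using inner_ge_zero by (auto simp: not_le) (meson inner_ge_zero le_less_trans not_less order_trans)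
      then show ?thesis
        using False m by simp
    qed
    finally show "(\<integral>\<^sup>+(x::'a). ennreal (w p) * indicator {..R p} (x \<bullet> x) \<partial>lborel)
        = ennreal (w p * (unit_ball_vol (2 * m) * max 0 (R p) ^ m))"
      by (simp add: ennreal_mult' w)
  qed
  finally show ?thesis .
qed

text \<open>In the unit ball 1/|x|^2 = 1 + integral of dp over [1, 1/|x|^2], and the layer |x|^2 <=
  1/p has volume of order p^(-m), which is integrable on [1, \<infinity>) as m >= 2. This is the
  local square integrability of the kernel x/|x|^2, where dimension at least 4 enters.\<close>

lemma integrable_inverse_norm_square:
  fixes m :: nat
  assumes m: "DIM('a::euclidean_space) = 2 * m" "2 \<le> m"
  shows "integrable lborel (\<lambda>x::'a. indicator (cball 0 1) x / (x \<bullet> x))"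
proof (rule integrableI_nonneg)
  let ?w = "indicator {1..} :: real \<Rightarrow> real"
  have le: "ennreal (indicator (cball 0 1) x / (x \<bullet> x))
      \<le> indicator (cball 0 1) x + (\<integral>\<^sup>+p. ennreal (?w p) * indicator {..1 / p} (x \<bullet> x) \<partial>lborel)" for x :: 'a
  proof (cases "x \<in> cball 0 1 \<and> x \<noteq> 0")
    case True
    then have x: "0 < x \<bullet> x" "x \<bullet> x \<le> 1"
      by (auto simp: norm_eq_sqrt_inner)
    have "(\<integral>\<^sup>+p. ennreal (?w p) * indicator {..1 / p} (x \<bullet> x) \<partial>lborel) = (\<integral>\<^sup>+p. indicator {1..1 / (x \<bullet> x)} p \<partial>lborel)"
      using x by (intro nn_integral_cong) (auto simp: indicator_def field_simps)
    also have "\<dots> = ennreal (1 / (x \<bullet> x) - 1)"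
      using x by simp
    finally show ?thesis
      using True x by (simp add: ennreal_1[symmetric] del: ennreal_1 flip: ennreal_plus)
  qed (auto simp: indicator_def)
  have "(\<integral>\<^sup>+(x::'a). ennreal (indicator (cball 0 1) x / (x \<bullet> x)) \<partial>lborel)
      \<le> (\<integral>\<^sup>+(x::'a). indicator (cball 0 1) x + (\<integral>\<^sup>+p. ennreal (?w p) * indicator {..1 / p} (x \<bullet> x) \<partial>lborel) \<partial>lborel)"
    by (rule nn_integral_mono) (rule le)
  also have "\<dots> = emeasure lborel (cball 0 1 :: 'a set)
      + (\<integral>\<^sup>+(x::'a). (\<integral>\<^sup>+p. ennreal (?w p) * indicator {..1 / p} (x \<bullet> x) \<partial>lborel) \<partial>lborel)"
    by (subst nn_integral_add) (auto simp: indicator_def[of "{.._}"] intro!: borel_measurable_indicator)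
  also have "(\<integral>\<^sup>+(x::'a). (\<integral>\<^sup>+p. ennreal (?w p) * indicator {..1 / p} (x \<bullet> x) \<partial>lborel) \<partial>lborel)
      = (\<integral>\<^sup>+p. ennreal (?w p * (unit_ball_vol (2 * m) * max 0 (1 / p) ^ m)) \<partial>lborel)"
    using m by (intro nn_integral_radial_layers) auto
  also have "\<dots> \<le> (\<integral>\<^sup>+p. ennreal (unit_ball_vol (2 * m) / p\<^sup>2) * indicator {1..} p \<partial>lborel)"
  proof (intro nn_integral_mono)
    fix p :: real
    show "ennreal (?w p * (unit_ball_vol (2 * m) * max 0 (1 / p) ^ m)) \<le> ennreal (unit_ball_vol (2 * m) / p\<^sup>2) * indicator {1..} p"
    proof (cases "1 \<le> p")
      case True
      then have "(1 / p) ^ m \<le> (1 / p) ^ 2"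
        using m by (intro power_decreasing) auto
      then have "unit_ball_vol (2 * m) * max 0 (1 / p) ^ m \<le> unit_ball_vol (2 * m) * (1 / p)\<^sup>2"
        using True by (intro mult_left_mono) auto
      then show ?thesis using True by (simp add: ennreal_leI power_divide)
    qed simp
  qed
  also have "\<dots> = ennreal (0 - (- unit_ball_vol (2 * m) / 1))"
  proof (rule nn_integral_FTC_atLeast[where F = "\<lambda>p. - unit_ball_vol (2 * m) / p"])
    show "((\<lambda>p. - unit_ball_vol (2 * m) / p) \<longlongrightarrow> 0) at_top"
      by (rule tendsto_divide_0[OF tendsto_const]) (simp add: filterlim_at_top_imp_at_infinity filterlim_ident)
  qed (auto intro!: derivative_eq_intros simp: power2_eq_square)
  finally have "(\<integral>\<^sup>+(x::'a). ennreal (indicator (cball 0 1) x / (x \<bullet> x)) \<partial>lborel)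
      \<le> emeasure lborel (cball 0 1 :: 'a set) + ennreal (0 - (- unit_ball_vol (2 * m) / 1))"
    by (simp only: add_left_mono)
  also have "\<dots> < \<infinity>"
    using emeasure_bounded_finite[of "cball (0::'a) 1"] by (simp add: less_top)
  finally show "(\<integral>\<^sup>+(x::'a). ennreal (indicator (cball 0 1) x / (x \<bullet> x)) \<partial>lborel) < \<infinity>" .
qed (auto intro!: borel_measurable_divide borel_measurable_indicator)

text \<open>With q = 1/(1 + |x|^2), the integrand q^(2m) is the integral of 2m p^(2m-1) over [0, q],
  and p <= q means |x|^2 <= 1/p - 1. The layers then give p^(2m-1) (1/p - 1)^m = p^(m-1) (1 - p)^m,
  a Beta integrand.\<close>

lemma nn_integral_bubble_aux:
  fixes m :: nat
  assumes m: "DIM('a::euclidean_space) = 2 * m" "2 \<le> m"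
  shows "(\<integral>\<^sup>+(x::'a). ennreal (1 / (1 + x \<bullet> x) ^ (2 * m)) \<partial>lborel)
    = ennreal (2 * m * unit_ball_vol (2 * m) * Beta m (m + 1))"
proof -
  define w where "w p = indicator {0..1} p * (real (2 * m) * p ^ (2 * m - 1))" for p :: real
  have layer: "ennreal (1 / (1 + x \<bullet> x) ^ (2 * m)) = (\<integral>\<^sup>+p. ennreal (w p) * indicator {..1 / p - 1} (x \<bullet> x) \<partial>lborel)" for x :: 'a
  proof -
    define q where "q = 1 / (1 + x \<bullet> x)"
    have q: "0 < q" "q \<le> 1" by (auto simp: q_def divide_le_eq_1 intro!: divide_pos_pos add_pos_nonneg)
    have "ennreal (w p) * indicator {..1 / p - 1} (x \<bullet> x) = ennreal (real (2 * m) * p ^ (2 * m - 1)) * indicator {0..q} p" for p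
    proof (cases "0 < p \<and> p \<le> 1")
      case True
      have "x \<bullet> x \<le> 1 / p - 1 \<longleftrightarrow> p \<le> q"
        using True add_pos_nonneg[OF zero_less_one inner_ge_zero[of x]] by (simp add: q_def field_simps)
      then show ?thesis using True by (simp add: w_def indicator_def)
    next
      case False
      then show ?thesis using q m by (auto simp: w_def indicator_def)
    qed
    then have "(\<integral>\<^sup>+p. ennreal (w p) * indicator {..1 / p - 1} (x \<bullet> x) \<partial>lborel)
      = (\<integral>\<^sup>+p. ennreal (real (2 * m) * p ^ (2 * m - 1)) * indicator {0..q} p \<partial>lborel)"
      by simp
    also have "\<dots> = ennreal (q ^ (2 * m) - 0 ^ (2 * m))"
      using q by (intro nn_integral_FTC_Icc) (auto intro!: derivative_eq_intros)
    finally show ?thesis using m by (simp add: q_def power_divide zero_power)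
  qed
  have "(\<integral>\<^sup>+(x::'a). ennreal (1 / (1 + x \<bullet> x) ^ (2 * m)) \<partial>lborel)
      = (\<integral>\<^sup>+p. ennreal (w p * (unit_ball_vol (2 * m) * max 0 (1 / p - 1) ^ m)) \<partial>lborel)"
    unfolding layer using m by (intro nn_integral_radial_layers) (auto simp: w_def[abs_def] indicator_def)
  also have "\<dots> = (\<integral>\<^sup>+p. ennreal (2 * m * unit_ball_vol (2 * m) * (p powr (real m - 1) * (1 - p) powr (real (m + 1) - 1))) * indicator {0..1} p \<partial>lborel)"
  proof (intro nn_integral_cong)
    fix p :: real
    consider "0 < p" "p < 1" | "p = 0" | "p = 1" | "p \<notin> {0..1}" by fastforce
    then show "ennreal (w p * (unit_ball_vol (2 * m) * max 0 (1 / p - 1) ^ m))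
        = ennreal (2 * m * unit_ball_vol (2 * m) * (p powr (real m - 1) * (1 - p) powr (real (m + 1) - 1))) * indicator {0..1} p"
    proof cases
      case 1
      have "p powr (real m - 1) = p ^ (m - 1)" "(1 - p) powr real m = (1 - p) ^ m"
        using 1 m by (simp_all flip: powr_realpow add: of_nat_diff)
      moreover have "p ^ (2 * m - 1) = p ^ (m - 1) * p ^ m"
        using m by (subst power_add[symmetric]) (simp add: mult_2)
      moreover have "(1 / p - 1) ^ m * p ^ m = (1 - p) ^ m"
        using 1 by (simp add: field_simps flip: power_mult_distrib)
      moreover have "0 \<le> 1 / p - 1" using 1 by simp
      ultimately show ?thesis
        using 1 by (simp add: w_def max_def mult.commute mult.left_commute)
    qed (use m in \<open>auto simp: w_def\<close>)
  qed
  also have "\<dots> = ennreal (2 * m * unit_ball_vol (2 * m) * Beta m (m + 1))"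
    using m by (intro nn_integral_has_integral_lebesgue' has_integral_mult_right has_integral_Beta_real) auto
  finally show ?thesis .
qed

lemma Gamma_nat_plus_half: "Gamma (real m + 1 / 2) = fact (2 * m) / (4 ^ m * fact m) * sqrt pi"
proof (induction m)
  case 0
  then show ?case by (simp add: Gamma_one_half_real)
next
  case (Suc m)
  have "Gamma (real m + 1 / 2 + 1) = (real m + 1 / 2) * Gamma (real m + 1 / 2)"
    by (rule Gamma_plus1) (auto dest: nonpos_Ints_nonpos)
  also have "\<dots> = fact (2 * Suc m) / (4 ^ Suc m * fact (Suc m)) * sqrt pi"
  proof -
    have f: "fact (2 * Suc m) = (real m + 1) * (4 * (real m + 1 / 2) * fact (2 * m))"
      "fact (Suc m) = (real m + 1) * (fact m :: real)"
      by (simp_all add: algebra_simps)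
    have "(real m + 1) * (4 * (real m + 1 / 2) * fact (2 * m)) / (4 ^ Suc m * ((real m + 1) * fact m))
        = (real m + 1 / 2) * (fact (2 * m) / (4 ^ m * fact m))"
      by simp (simp add: divide_simps)
    then show ?thesis unfolding Suc.IH f by (simp only: mult.assoc)
  qed
  finally show ?case by (simp add: add_ac)
qed

text \<open>The value is dictated by stereographic projection onto S^n, realised here as the unit
  sphere of \<open>'a \<times> real\<close>. It is verified by comparing closed forms: the Beta
  integral \<open>J\<close> and the half-integer Gamma value give area 4^m J.\<close>

lemma bubble_mass:
  fixes m :: nat
  assumes m: "DIM('a::euclidean_space) = 2 * m" "2 \<le> m"
  defines "c \<equiv> fact (2 * m - 1) * unit_sphere_measure (sphere (0 :: 'a \<times> real) 1)"
  shows "integrable lborel (\<lambda>x::'a. bubble m 1 (x \<bullet> x))" "(\<integral>(x::'a). bubble m 1 (x \<bullet> x) \<partial>lborel) = c" "0 < c"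
proof -
  define J where "J = 2 * m * unit_ball_vol (2 * m) * Beta m (m + 1)"
  obtain l where l: "m = Suc l" using m(2) by (cases m) auto
  have Gm: "Gamma (real m) = fact l" "Gamma (real m + 1) = fact m" "Gamma (2 * real m) = fact (2 * m - 1)"
    "Gamma (2 * real m + 1) = fact (2 * m)"
    using Gamma_fact[of l, where 'a=real] Gamma_fact[of m, where 'a=real] Gamma_fact[of "2*m-1", where 'a=real]
      Gamma_fact[of "2*m", where 'a=real] m(2)
    by (simp_all add: l add_ac)
  have J: "J = pi ^ m * fact l / fact (2 * m - 1)"
  proof -
    have f: "fact (2 * m) = real (2 * m) * fact (2 * m - 1)"
      using m(2) by (simp add: fact_reduce)
    have "J = 2 * m * (pi ^ m / fact m) * (fact l * fact m / fact (2 * m))"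
      unfolding J_def unit_ball_vol_even Beta_def using Gm by (simp add: add.assoc[symmetric] add.commute[of 1])
    then show ?thesis
      unfolding f using m(2) by simp
  qed
  have "fact (2 * m) = 2 * real m * fact (2 * m - 1)" "fact m = real m * fact l"
    using m(2) l by (simp_all add: fact_reduce)
  then have half: "Gamma (real m + 1 / 2) = 2 / 4 ^ m * sqrt pi * fact (2 * m - 1) / fact l"
    using m(2) by (simp add: Gamma_nat_plus_half)
  have "unit_sphere_measure (sphere (0 :: 'a \<times> real) 1) = 2 * pi powr (real m + 1 / 2) / Gamma (real m + 1 / 2)"
    unfolding unit_sphere_measure_sphere using m by (simp add: add_divide_distrib add.commute)
  also have "pi powr (real m + 1 / 2) = pi ^ m * sqrt pi"
    by (simp add: powr_add powr_realpow powr_half_sqrt)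
  finally have "unit_sphere_measure (sphere (0 :: 'a \<times> real) 1) = 4 ^ m * J"
    unfolding half J by simp
  then have c: "c = 4 ^ m * fact (2 * m - 1) * J"
    by (simp add: c_def)
  have "J > 0" unfolding J by simp
  then show "0 < c" unfolding c by simp
  have "(\<integral>\<^sup>+(x::'a). ennreal (1 / (1 + x \<bullet> x) ^ (2 * m)) \<partial>lborel) = ennreal J"
    unfolding J_def by (rule nn_integral_bubble_aux[OF m])
  then have "has_bochner_integral lborel (\<lambda>x::'a. 1 / (1 + x \<bullet> x) ^ (2 * m)) J"
    using \<open>J > 0\<close> by (intro has_bochner_integral_nn_integral) auto
  then have "has_bochner_integral lborel (\<lambda>x::'a. 4 ^ m * fact (2 * m - 1) * (1 / (1 + x \<bullet> x) ^ (2 * m))) c"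
    unfolding c by (rule has_bochner_integral_mult_right)
  then have "has_bochner_integral lborel (\<lambda>x::'a. bubble m 1 (x \<bullet> x)) c"
    by (simp add: bubble_def)
  then show "integrable lborel (\<lambda>x::'a. bubble m 1 (x \<bullet> x))" "(\<integral>(x::'a). bubble m 1 (x \<bullet> x) \<partial>lborel) = c"
    by (auto simp: has_bochner_integral_iff)
qed

section \<open>Integral representation of the gradient\<close>

lemma lborel_integral_scale:
  fixes f :: "'a::euclidean_space \<Rightarrow> real"
  assumes [measurable]: "f \<in> borel_measurable borel" and a: "0 < a"
  shows "(\<integral>x. f x \<partial>lborel) = a ^ DIM('a) * (\<integral>x. f (a *\<^sub>R x) \<partial>lborel)"
proof -
  have "(\<integral>x. f x \<partial>lborel) = (\<integral>x. f x \<partial>density (distr lborel borel (\<lambda>x::'a. 0 + a *\<^sub>R x)) (\<lambda>_. ennreal (\<bar>a\<bar> ^ DIM('a))))"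
    using lborel_affine[of a "0::'a"] a by simp
  also have "\<dots> = (\<integral>x. a ^ DIM('a) * f x \<partial>distr lborel borel (\<lambda>x::'a. 0 + a *\<^sub>R x))"
    using a by (subst integral_density) auto
  also have "\<dots> = (\<integral>x. a ^ DIM('a) * f (a *\<^sub>R x) \<partial>lborel)"
    by (subst integral_distr) auto
  finally show ?thesis by simp
qed

lemma continuous_bounded_cball:
  fixes h :: "'a::euclidean_space \<Rightarrow> real"
  assumes "continuous_on UNIV h"
  obtains B where "\<And>x. norm x \<le> R \<Longrightarrow> \<bar>h x\<bar> \<le> B"
proof -
  have "bounded (h ` cball 0 R)"
    using assms by (intro compact_imp_bounded compact_continuous_image) (auto intro: continuous_on_subset)
  then obtain B where "\<forall>y\<in>h ` cball 0 R. norm y \<le> B"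
    unfolding bounded_iff by blast
  then show thesis by (intro that) auto
qed

text \<open>Substituting a x for x with s = a^2 turns the bubble into the fixed integrable profile
  with s = 1, hence the squares 1/(k+1)^2. The truncation keeps the argument of \<open>h\<close> in
  a fixed ball, so \<open>h\<close> is bounded there whatever its growth.\<close>

lemma bubble_approximates_delta:
  fixes h :: "'a::euclidean_space \<Rightarrow> real" and m :: nat
  assumes m: "DIM('a) = 2 * m" "2 \<le> m" and h: "continuous_on UNIV h" and T: "0 < T"
  shows "(\<lambda>k. \<integral>x. h x * trunc T (bubble m ((1 / Suc k)\<^sup>2)) (x \<bullet> x) \<partial>lborel)
    \<longlonglongrightarrow> (\<integral>(x::'a). bubble m 1 (x \<bullet> x) \<partial>lborel) * h 0"
proof -
  define a where "a k = 1 / real (Suc k)" for k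
  have a: "0 < a k" for k by (simp add: a_def)
  have a0: "a \<longlonglongrightarrow> 0"
    using LIMSEQ_inverse_real_of_nat by (simp add: a_def[abs_def] inverse_eq_divide)
  have [measurable]: "h \<in> borel_measurable borel"
    using h by (rule borel_measurable_continuous_onI)
  have [measurable]: "bubble m s \<in> borel_measurable borel" for s
    unfolding bubble_def[abs_def] by measurable
  have [measurable]: "trunc T (bubble m s) \<in> borel_measurable borel" for s
    unfolding trunc_def[abs_def] by measurable
  obtain B where B: "\<And>x. norm x \<le> sqrt T \<Longrightarrow> \<bar>h x\<bar> \<le> B"
    using continuous_bounded_cball[OF h] by blast
  define q where "q k x = h (a k *\<^sub>R x) * (if (a k)\<^sup>2 * (x \<bullet> x) < T then bubble m 1 (x \<bullet> x) else 0)" for k x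
  have bpos: "0 \<le> bubble m 1 (x \<bullet> x)" for x :: 'a
    by (auto simp: bubble_def intro!: divide_nonneg_nonneg zero_le_power add_nonneg_nonneg)
  have "(\<integral>x. h x * trunc T (bubble m ((a k)\<^sup>2)) (x \<bullet> x) \<partial>lborel) = (\<integral>x. q k x \<partial>lborel)" for k
  proof -
    have "(\<integral>x. h x * trunc T (bubble m ((a k)\<^sup>2)) (x \<bullet> x) \<partial>lborel)
      = (\<integral>x. a k ^ (2 * m) * (h (a k *\<^sub>R x) * trunc T (bubble m ((a k)\<^sup>2)) ((a k *\<^sub>R x) \<bullet> (a k *\<^sub>R x))) \<partial>lborel)"
      using m by (subst lborel_integral_scale[OF _ a[of k]]) auto
    also have "(\<lambda>x. a k ^ (2 * m) * (h (a k *\<^sub>R x) * trunc T (bubble m ((a k)\<^sup>2)) ((a k *\<^sub>R x) \<bullet> (a k *\<^sub>R x)))) = q k"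
    proof
      fix x :: 'a
      have "((a k)\<^sup>2 + (a k)\<^sup>2 * (x \<bullet> x)) ^ (2 * m) = a k ^ (2 * m) * a k ^ (2 * m) * (1 + x \<bullet> x) ^ (2 * m)"
      proof -
        have "(a k)\<^sup>2 + (a k)\<^sup>2 * (x \<bullet> x) = (a k)\<^sup>2 * (1 + x \<bullet> x)" by (simp add: algebra_simps)
        moreover have "((a k)\<^sup>2) ^ (2 * m) = a k ^ (2 * m) * a k ^ (2 * m)"
          by (simp add: power_mult[symmetric] power_add[symmetric])
        ultimately show ?thesis by (simp only: power_mult_distrib)
      qed
      then have "a k ^ (2 * m) * bubble m ((a k)\<^sup>2) ((a k)\<^sup>2 * (x \<bullet> x)) = bubble m 1 (x \<bullet> x)"
        using a[of k] by (simp add: bubble_def power_mult[symmetric])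
      then show "a k ^ (2 * m) * (h (a k *\<^sub>R x) * trunc T (bubble m ((a k)\<^sup>2)) ((a k *\<^sub>R x) \<bullet> (a k *\<^sub>R x))) = q k x"
        by (simp add: q_def trunc_def power2_eq_square mult.assoc mult.left_commute[of _ "h _"])
    qed
    finally show ?thesis .
  qed
  moreover have "(\<lambda>k. \<integral>x. q k x \<partial>lborel) \<longlonglongrightarrow> (\<integral>(x::'a). h 0 * bubble m 1 (x \<bullet> x) \<partial>lborel)"
  proof (rule integral_dominated_convergence)
    show "integrable lborel (\<lambda>x::'a. B * bubble m 1 (x \<bullet> x))"
      using bubble_mass(1)[OF m] by simp
    show "AE x in lborel. norm (q k x) \<le> B * bubble m 1 (x \<bullet> x)" for k
    proof (rule AE_I2)
      fix x :: 'a
      have B0: "0 \<le> B" using B[of 0] T by fastforce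
      show "norm (q k x) \<le> B * bubble m 1 (x \<bullet> x)"
      proof (cases "(a k)\<^sup>2 * (x \<bullet> x) < T")
        case True
        then have "norm (a k *\<^sub>R x) \<le> sqrt T"
          using a[of k] by (simp add: norm_eq_sqrt_inner real_sqrt_mult flip: real_sqrt_mult power2_eq_square mult.assoc)
        then show ?thesis
          using True B[of "a k *\<^sub>R x"] bpos[of x] by (simp add: q_def abs_mult mult_right_mono)
      qed (use B0 bpos[of x] in \<open>simp add: q_def\<close>)
    qed
    show "AE x::'a in lborel. (\<lambda>k. q k x) \<longlonglongrightarrow> h 0 * bubble m 1 (x \<bullet> x)"
    proof (rule AE_I2)
      fix x :: 'a
      have "(\<lambda>k. (a k)\<^sup>2 * (x \<bullet> x)) \<longlonglongrightarrow> 0\<^sup>2 * (x \<bullet> x)"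
        by (intro tendsto_intros a0)
      then have "eventually (\<lambda>k. (a k)\<^sup>2 * (x \<bullet> x) < T) sequentially"
        using T by (intro order_tendstoD(2)) simp_all
      then have ev: "eventually (\<lambda>k. h (a k *\<^sub>R x) * bubble m 1 (x \<bullet> x) = q k x) sequentially"
        by eventually_elim (simp add: q_def)
      have "(\<lambda>k. a k *\<^sub>R x) \<longlonglongrightarrow> 0 *\<^sub>R x"
        by (intro tendsto_intros a0)
      moreover have "isCont h 0" using h by (simp add: continuous_on_eq_continuous_at)
      ultimately have "(\<lambda>k. h (a k *\<^sub>R x)) \<longlonglongrightarrow> h 0"
        by (intro isCont_tendsto_compose[where g = h]) simp_all
      from tendsto_mult_right[OF this] show "(\<lambda>k. q k x) \<longlonglongrightarrow> h 0 * bubble m 1 (x \<bullet> x)"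
        using ev by (rule Lim_transform_eventually)
    qed
  qed (simp_all add: q_def[abs_def])
  ultimately show ?thesis by (simp add: a_def mult.commute)
qed

lemma integrable_bounded_div_norm_square:
  fixes f :: "'a::euclidean_space \<Rightarrow> real" and m :: nat
  assumes m: "DIM('a) = 2 * m" "2 \<le> m" and int: "integrable lborel f"
  shows "integrable lborel (\<lambda>x. B * (indicator (cball 0 1) x / (x \<bullet> x)) + \<bar>f x\<bar>)"
  by (intro Bochner_Integration.integrable_add integrable_mult_right integrable_abs integrable_inverse_norm_square[OF m] int)

text \<open>A majorant independent of \<open>s\<close>: the kernel is at most 1/|x|, hence at most
  1/|x|^2 inside the unit ball and at most 1 outside. It serves both limits s to 0 and T to
  infinity.\<close>

lemma norm_div_norm_square_bound:
  fixes x e :: "'a::euclidean_space"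
  assumes "norm e = 1" "0 \<le> s" and B: "norm x \<le> 1 \<Longrightarrow> \<bar>y\<bar> \<le> B"
  shows "\<bar>y * ((x \<bullet> e) * (1 / (s + x \<bullet> x)))\<bar> \<le> B * (indicator (cball 0 1) x / (x \<bullet> x)) + \<bar>y\<bar>"
proof (cases "x = 0")
  case False
  then have pos: "0 < norm x" "x \<bullet> x = norm x * norm x"
    by (auto simp: power2_norm_eq_inner[symmetric] power2_eq_square)
  have "\<bar>x \<bullet> e\<bar> \<le> norm x" using Cauchy_Schwarz_ineq2[of x e] assms(1) by simp
  then have le: "\<bar>(x \<bullet> e) * (1 / (s + x \<bullet> x))\<bar> \<le> 1 / norm x"
  proof -
    have "\<bar>(x \<bullet> e) * (1 / (s + x \<bullet> x))\<bar> = \<bar>x \<bullet> e\<bar> / (s + x \<bullet> x)"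
      using assms(2) by (simp add: abs_mult)
    also have "\<dots> \<le> norm x / (norm x * norm x)"
      using pos assms(2) \<open>\<bar>x \<bullet> e\<bar> \<le> norm x\<close> by (intro frac_le) auto
    finally show ?thesis using pos by simp
  qed
  show ?thesis
  proof (cases "norm x \<le> 1")
    case True
    then have "1 / norm x \<le> 1 / (x \<bullet> x)"
      using pos by (simp add: field_simps)
    then have "\<bar>y\<bar> * \<bar>(x \<bullet> e) * (1 / (s + x \<bullet> x))\<bar> \<le> B * (1 / (x \<bullet> x))"
      using le B[OF True] by (intro mult_mono) auto
    then show ?thesis using True by (simp add: abs_mult)
  next
    case outside: False
    then have "1 / norm x \<le> 1" by (simp add: divide_le_eq_1)
    then have "\<bar>y\<bar> * \<bar>(x \<bullet> e) * (1 / (s + x \<bullet> x))\<bar> \<le> \<bar>y\<bar> * 1"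
      using le by (intro mult_left_mono) auto
    then show ?thesis using outside by (simp add: abs_mult)
  qed
qed simp

text \<open>First s tends to 0 at fixed T, where the bubble becomes c times the point mass at 0;
  then T runs through the integers, the L^1 norm of f over sqrt T vanishes, and \<open>decay\<close>
  disposes of the remaining error.\<close>

lemma gradient_representation_origin:
  fixes g :: "'a::euclidean_space \<Rightarrow> real" and m :: nat
  defines "f \<equiv> (neg_laplacian ^^ m) g"
  assumes m: "DIM('a) = 2 * m" "2 \<le> m" and g: "smooth g" and int: "integrable lborel f" and e: "e \<in> Basis"
    and decay: "(\<lambda>k. (\<integral>x. \<bar>pderiv_dir e g x\<bar> * trunc (real k) (\<lambda>_. 1) (x \<bullet> x) \<partial>lborel) / real k ^ m) \<longlonglongrightarrow> 0"
  shows "(\<integral>(x::'a). bubble m 1 (x \<bullet> x) \<partial>lborel) * pderiv_dir e g 0 = 2 * (\<integral>x. f x * ((x \<bullet> e) / (x \<bullet> x)) \<partial>lborel)"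
proof -
  define c where "c = (\<integral>(x::'a). bubble m 1 (x \<bullet> x) \<partial>lborel)"
  define d where "d = pderiv_dir e g"
  define F where "F s T x = f x * ((x \<bullet> e) * trunc T (\<lambda>\<rho>. 1 / (s + \<rho>)) (x \<bullet> x))" for s T x
  define I where "I s T = (\<integral>x. F s T x \<partial>lborel)" for s T
  have cd: "continuous_on UNIV d" unfolding d_def by (intro smooth_continuous_on smooth_pderiv_dir g e)
  have cf: "continuous_on UNIV f" unfolding f_def by (intro smooth_continuous_on smooth_neg_laplacian_funpow g)
  have [measurable]: "f \<in> borel_measurable borel" using cf by (rule borel_measurable_continuous_onI)
  have [measurable]: "trunc T (\<lambda>\<rho>. 1 / (s + \<rho>)) \<in> borel_measurable borel" for s T :: real
    unfolding trunc_def[abs_def] by measurable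
  obtain B where B: "\<And>x. norm x \<le> 1 \<Longrightarrow> \<bar>f x\<bar> \<le> B"
    using continuous_bounded_cball[OF cf] by blast
  let ?W = "\<lambda>x. B * (indicator (cball 0 1) x / (x \<bullet> x)) + \<bar>f x\<bar>"
  have W: "integrable lborel ?W" by (rule integrable_bounded_div_norm_square[OF m int])
  have bound: "\<bar>f x * ((x \<bullet> e) * (1 / (s + x \<bullet> x)))\<bar> \<le> ?W x" if "0 \<le> s" for s x
    using that e B by (intro norm_div_norm_square_bound) auto
  have W0: "0 \<le> ?W x" for x
    using order_trans[OF abs_ge_zero bound[of 0 x]] by simp
  have boundT: "AE x in lborel. norm (F s T x) \<le> ?W x" if "0 \<le> s" for s T
    using bound[OF that] W0 by (intro AE_I2) (simp add: trunc_def F_def)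
  have meas: "F s T \<in> borel_measurable lborel" for s T
    unfolding F_def[abs_def] by measurable
  obtain C where C: "0 \<le> C" "\<And>s T. 0 < s \<Longrightarrow> 0 < T \<Longrightarrow>
    \<bar>(\<integral>x. d x * trunc T (bubble m s) (x \<bullet> x) \<partial>lborel) - 2 * I s T\<bar>
    \<le> C * ((\<integral>x. \<bar>f x\<bar> \<partial>lborel) / sqrt T + (\<integral>x. \<bar>d x\<bar> * trunc T (\<lambda>_. 1) (x \<bullet> x) \<partial>lborel) / T ^ m)"
    using gradient_approximate_representation[OF m(1)] g int e unfolding d_def f_def I_def F_def by blast
  define E where "E T = C * ((\<integral>x. \<bar>f x\<bar> \<partial>lborel) / sqrt T + (\<integral>x. \<bar>d x\<bar> * trunc T (\<lambda>_. 1) (x \<bullet> x) \<partial>lborel) / T ^ m)" for T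
  have step: "\<bar>c * d 0 - 2 * I 0 T\<bar> \<le> E T" if T: "0 < T" for T
  proof -
    have "(\<lambda>k. I ((1 / Suc k)\<^sup>2) T) \<longlonglongrightarrow> I 0 T"
      unfolding I_def
    proof (rule integral_dominated_convergence[OF meas meas W])
      show "AE x in lborel. (\<lambda>k. F ((1 / Suc k)\<^sup>2) T x) \<longlonglongrightarrow> F 0 T x"
      proof (rule AE_I2)
        fix x :: 'a
        have s0: "(\<lambda>k. (1 / real (Suc k))\<^sup>2) \<longlonglongrightarrow> 0\<^sup>2"
          using LIMSEQ_inverse_real_of_nat by (intro tendsto_power) (simp add: inverse_eq_divide)
        show "(\<lambda>k. F ((1 / Suc k)\<^sup>2) T x) \<longlonglongrightarrow> F 0 T x"
        proof (cases "x = 0 \<or> \<not> x \<bullet> x < T")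
          case False
          have "(\<lambda>k. f x * ((x \<bullet> e) * (1 / ((1 / real (Suc k))\<^sup>2 + x \<bullet> x)))) \<longlonglongrightarrow> f x * ((x \<bullet> e) * (1 / (0\<^sup>2 + x \<bullet> x)))"
            using False by (intro tendsto_intros s0) auto
          then show ?thesis using False by (simp add: F_def trunc_def)
        qed (auto simp: F_def trunc_def)
      qed
    qed (rule boundT, simp)
    then have "(\<lambda>k. \<bar>(\<integral>x. d x * trunc T (bubble m ((1 / Suc k)\<^sup>2)) (x \<bullet> x) \<partial>lborel) - 2 * I ((1 / Suc k)\<^sup>2) T\<bar>)
      \<longlonglongrightarrow> \<bar>c * d 0 - 2 * I 0 T\<bar>"
      unfolding c_def using bubble_approximates_delta[OF m cd T] by (intro tendsto_intros)
    then show ?thesis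
    proof (rule LIMSEQ_le_const2)
      show "\<exists>N. \<forall>k\<ge>N. \<bar>(\<integral>x. d x * trunc T (bubble m ((1 / Suc k)\<^sup>2)) (x \<bullet> x) \<partial>lborel) - 2 * I ((1 / Suc k)\<^sup>2) T\<bar> \<le> E T"
        using C(2)[OF _ T] by (simp add: E_def)
    qed
  qed
  have "(\<lambda>k. I 0 (real k)) \<longlonglongrightarrow> (\<integral>x. f x * ((x \<bullet> e) * (1 / (0 + x \<bullet> x))) \<partial>lborel)"
    unfolding I_def
  proof (rule integral_dominated_convergence[OF _ meas W])
    show "AE x in lborel. (\<lambda>k. F 0 (real k) x)
      \<longlonglongrightarrow> f x * ((x \<bullet> e) * (1 / (0 + x \<bullet> x)))"
    proof (rule AE_I2)
      fix x :: 'a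
      have "eventually (\<lambda>k. x \<bullet> x < real k) sequentially"
        using filterlim_real_sequentially unfolding filterlim_at_top_dense by blast
      then have "eventually (\<lambda>k. f x * ((x \<bullet> e) * (1 / (0 + x \<bullet> x))) = F 0 (real k) x) sequentially"
        by eventually_elim (simp add: trunc_def F_def)
      then show "(\<lambda>k. F 0 (real k) x) \<longlonglongrightarrow> f x * ((x \<bullet> e) * (1 / (0 + x \<bullet> x)))"
        by (rule Lim_transform_eventually[OF tendsto_const])
    qed
    show "(\<lambda>x. f x * ((x \<bullet> e) * (1 / (0 + x \<bullet> x)))) \<in> borel_measurable lborel" by measurable
  qed (rule boundT, simp)
  then have "(\<lambda>k. \<bar>c * d 0 - 2 * I 0 (real k)\<bar>) \<longlonglongrightarrow> \<bar>c * d 0 - 2 * (\<integral>x. f x * ((x \<bullet> e) * (1 / (0 + x \<bullet> x))) \<partial>lborel)\<bar>"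
    by (intro tendsto_intros)
  moreover have "(\<lambda>k. \<bar>c * d 0 - 2 * I 0 (real k)\<bar>) \<longlonglongrightarrow> 0"
  proof (rule Lim_null_comparison)
    show "eventually (\<lambda>k. norm \<bar>c * d 0 - 2 * I 0 (real k)\<bar> \<le> E (real k)) sequentially"
      using eventually_gt_at_top[of 0] by eventually_elim (simp add: step)
    have "(\<lambda>k. (\<integral>x. \<bar>f x\<bar> \<partial>lborel) / sqrt (real k)) \<longlonglongrightarrow> 0"
      by (intro tendsto_divide_0[OF tendsto_const] filterlim_at_top_imp_at_infinity
          filterlim_compose[OF sqrt_at_top] filterlim_real_sequentially)
    from tendsto_mult_left[OF tendsto_add[OF this decay], of C] show "(\<lambda>k. E (real k)) \<longlonglongrightarrow> 0"
      by (simp add: E_def d_def)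
  qed
  ultimately have "\<bar>c * d 0 - 2 * (\<integral>x. f x * ((x \<bullet> e) * (1 / (0 + x \<bullet> x))) \<partial>lborel)\<bar> = 0"
    by (rule LIMSEQ_unique)
  then show ?thesis by (simp add: c_def d_def)
qed

lemma gradient_representation:
  fixes u :: "'a::euclidean_space \<Rightarrow> real" and m :: nat
  defines "f \<equiv> (neg_laplacian ^^ m) u"
  assumes m: "DIM('a) = 2 * m" "2 \<le> m" and u: "smooth u" and int: "integrable lborel f" and e: "e \<in> Basis"
    and decay: "(\<lambda>k. (\<integral>x. \<bar>pderiv_dir e u (a + x)\<bar> * trunc (real k) (\<lambda>_. 1) (x \<bullet> x) \<partial>lborel) / real k ^ m) \<longlonglongrightarrow> 0"
  shows "(\<integral>(x::'a). bubble m 1 (x \<bullet> x) \<partial>lborel) * pderiv_dir e u a = 2 * (\<integral>x. f (a + x) * ((x \<bullet> e) / (x \<bullet> x)) \<partial>lborel)"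
  using gradient_representation_origin[OF m smooth_shift[OF u, of a] _ e] decay lborel_integrable_shift[OF int, of a]
  by (simp add: neg_laplacian_funpow_shift[OF u] pderiv_dir_shift[OF smooth_differentiable[OF u] e] f_def)

section \<open>The energy estimate\<close>

lemma trunc_one_eq_indicator:
  "0 \<le> T \<Longrightarrow> trunc T (\<lambda>_. 1) (x \<bullet> x) = indicator (ball 0 (sqrt T)) (x::'a::euclidean_space)"
  by (auto simp: trunc_def indicator_def norm_eq_sqrt_inner)

lemma integral_trunc_one:
  fixes m :: nat
  assumes m: "DIM('a::euclidean_space) = 2 * m" and T: "0 \<le> T"
  shows "integrable lborel (\<lambda>x::'a. trunc T (\<lambda>_. 1) (x \<bullet> x))"
    "(\<integral>(x::'a). trunc T (\<lambda>_. 1) (x \<bullet> x) \<partial>lborel) = unit_ball_vol (2 * m) * T ^ m"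
  using T emeasure_bounded_finite[of "ball (0::'a) (sqrt T)"]
  by (simp_all add: trunc_one_eq_indicator content_ball m power_mult)

text \<open>The inequality (m - 1) |grad u|^2 <= -Laplace u is tested with the square of T - |x|^2
  on the ball |x|^2 < T. After integration by parts, Young's inequality absorbs half of the energy,
  which is possible because m - 1 >= 1.\<close>

lemma energy_estimate:
  fixes u :: "'a::euclidean_space \<Rightarrow> real" and m :: nat
  assumes m: "DIM('a) = 2 * m" "2 \<le> m" and u: "smooth u"
    and pos: "\<And>x. R < norm x \<Longrightarrow> 0 \<le> neg_laplacian u x - (real m - 1) * (norm (gradient u x))\<^sup>2"
  obtains C where "0 \<le> C" "\<And>T. 1 \<le> T \<Longrightarrow>
    (\<integral>x. (norm (gradient u x))\<^sup>2 * trunc T (\<lambda>_. 1) (x \<bullet> x) \<partial>lborel) \<le> C * T ^ (m - 1)"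
proof -
  define \<kappa> where "\<kappa> = real m - 1"
  have \<kappa>: "1 \<le> \<kappa>" using m(2) by (simp add: \<kappa>_def)
  define P where "P x = (norm (gradient u x))\<^sup>2" for x
  define g where "g x = neg_laplacian u x - \<kappa> * P x" for x
  have cG: "continuous_on UNIV (gradient u)" by (rule smooth_continuous_on_gradient[OF u])
  have cL: "continuous_on UNIV (neg_laplacian u)" by (intro smooth_continuous_on smooth_neg_laplacian u)
  have cP: "continuous_on UNIV P" unfolding P_def by (intro continuous_intros cG)
  have cg: "continuous_on UNIV g" unfolding g_def by (intro continuous_intros cL cP)
  obtain B where B: "\<And>x. norm x \<le> R \<Longrightarrow> \<bar>g x\<bar> \<le> B" using continuous_bounded_cball[OF cg] by blast
  define C0 where "C0 = max 0 B"
  define \<omega> where "\<omega> = unit_ball_vol (2 * m)"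
  define M where "M = measure lborel (cball (0::'a) R)"
  \<comment> \<open>Inside the ball of radius \<open>R\<close> the sign of \<open>g\<close> is
    unknown; compactness bounds the loss there, which contributes only the lower order T^2.\<close>
  have g_ge: "- C0 * indicator (cball 0 R) x \<le> g x" for x
    using pos[of x] B[of x] by (auto simp: g_def P_def \<kappa>_def C0_def indicator_def)
  \<comment> \<open>Doubling after absorption of one half turns the terms 8 \<omega> T^(m+1) and C0
    M T^2 into these constants.\<close>
  define K where "K = 16 * \<omega> + 2 * C0 * M"
  have \<omega>: "0 \<le> \<omega>" by (simp add: \<omega>_def)
  have K: "0 \<le> K" by (simp add: K_def C0_def M_def \<omega>_def)
  have est: "(\<integral>x. P x * trunc T (\<lambda>\<rho>. (T - \<rho>)\<^sup>2) (x \<bullet> x) \<partial>lborel) \<le> K * T ^ (m + 1)" if T: "1 \<le> T" for T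
  proof -
    define \<Phi> where "\<Phi> x = trunc T (\<lambda>\<rho>. (T - \<rho>)\<^sup>2) (x \<bullet> x)" for x :: 'a
    define \<Phi>' where "\<Phi>' x = (2 * trunc T (\<lambda>\<rho>. - 2 * (T - \<rho>)) (x \<bullet> x)) *\<^sub>R x" for x :: 'a
    have G\<Phi>: "GDERIV \<Phi> x :> \<Phi>' x" for x
      unfolding \<Phi>_def[abs_def] \<Phi>'_def
      by (intro GDERIV_radial trunc_DERIV) (auto intro!: derivative_eq_intros simp: algebra_simps)
    have c\<Phi>: "continuous_on UNIV \<Phi>"
      using G\<Phi> GDERIV_isCont by (blast intro: continuous_at_imp_continuous_on)
    have "isCont (\<lambda>x::'a. trunc T (\<lambda>\<rho>. - 2 * (T - \<rho>)) (x \<bullet> x)) x" for x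
      by (rule isCont_o2[where g = "trunc T (\<lambda>\<rho>. - 2 * (T - \<rho>))"]) (auto intro!: continuous_intros trunc_isCont)
    then have c\<Phi>': "continuous_on UNIV \<Phi>'"
      unfolding \<Phi>'_def by (intro continuous_intros continuous_at_imp_continuous_on) auto
    have supp: "\<Phi> x = 0" if "x \<notin> cball 0 (sqrt T)" for x
      using trunc_outside_cball[OF that] T by (simp add: \<Phi>_def)
    have int: "integrable lborel (\<lambda>x. h x * \<Phi> x)" if "continuous_on UNIV h" for h
      by (rule integrable_continuous_compact_support[where R = "sqrt T"])
        (auto simp: supp intro!: continuous_intros that c\<Phi>)
    have \<Phi>0: "0 \<le> \<Phi> x" "\<Phi> x \<le> T\<^sup>2" for x
      using T by (auto simp: \<Phi>_def trunc_def intro!: power_mono)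
    have supp': "\<Phi>' x = 0" if "x \<notin> cball 0 (sqrt T)" for x
      using trunc_outside_cball[OF that] T by (simp add: \<Phi>'_def)
    have "\<kappa> * (\<integral>x. P x * \<Phi> x \<partial>lborel) = (\<integral>x. neg_laplacian u x * \<Phi> x - g x * \<Phi> x \<partial>lborel)"
      by (subst integral_mult_right_zero[symmetric]) (simp add: g_def algebra_simps)
    also have "\<dots> = (\<integral>x. gradient u x \<bullet> \<Phi>' x \<partial>lborel) - (\<integral>x. g x * \<Phi> x \<partial>lborel)"
      using integral_neg_laplacian_mult[OF u G\<Phi> c\<Phi>' supp] by (simp add: int cL cg)
    also have "(\<integral>x. gradient u x \<bullet> \<Phi>' x \<partial>lborel) \<le> (\<integral>x. 1 / 2 * (P x * \<Phi> x) + 8 * T * trunc T (\<lambda>_. 1) (x \<bullet> x) \<partial>lborel)"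
    proof (rule integral_mono)
      show "integrable lborel (\<lambda>x. gradient u x \<bullet> \<Phi>' x)"
        by (rule integrable_continuous_compact_support[where R = "sqrt T"])
          (auto simp: supp' intro!: continuous_intros cG c\<Phi>')
      show "integrable lborel (\<lambda>x. 1 / 2 * (P x * \<Phi> x) + 8 * T * trunc T (\<lambda>_. 1) (x \<bullet> x))"
        using T by (intro Bochner_Integration.integrable_add integrable_mult_right int cP integral_trunc_one(1)[OF m(1)]) auto
      show "gradient u x \<bullet> \<Phi>' x \<le> 1 / 2 * (P x * \<Phi> x) + 8 * T * trunc T (\<lambda>_. 1) (x \<bullet> x)" for x
      proof (cases "x \<bullet> x < T")
        case True
        define a where "a = (T - x \<bullet> x) * norm (gradient u x)"
        have a0: "0 \<le> a" using True by (simp add: a_def)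
        have "gradient u x \<bullet> \<Phi>' x = - (4 * (T - x \<bullet> x) * (gradient u x \<bullet> x))"
          using True by (simp add: \<Phi>'_def trunc_def) (simp add: algebra_simps)
        also have "\<dots> \<le> 4 * (T - x \<bullet> x) * (norm (gradient u x) * norm x)"
          using True Cauchy_Schwarz_ineq2[of "gradient u x" x]
          by (intro order_trans[OF abs_ge_minus_self]) (auto simp: abs_mult intro!: mult_left_mono)
        also have "\<dots> = 4 * a * norm x" by (simp add: a_def)
        \<comment> \<open>The split is chosen so that a^2 / 2 is exactly half of the energy density;
          it expands (a - 4 |x|)^2 >= 0.\<close>
        also have "\<dots> \<le> a\<^sup>2 / 2 + 8 * (norm x)\<^sup>2"
          using zero_le_power2[of "a - 4 * norm x"] by (simp add: power2_eq_square algebra_simps)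
        also have "\<dots> \<le> a\<^sup>2 / 2 + 8 * T"
          using True by (simp add: power2_norm_eq_inner)
        finally show ?thesis
          using True by (simp add: a_def \<Phi>_def P_def trunc_def power_mult_distrib mult.commute)
      qed (use \<Phi>0 in \<open>simp add: \<Phi>'_def \<Phi>_def trunc_def\<close>)
    qed
    also have "\<dots> = 1 / 2 * (\<integral>x. P x * \<Phi> x \<partial>lborel) + 8 * T * (\<omega> * T ^ m)"
      using T by (subst Bochner_Integration.integral_add)
        (simp_all add: int cP integral_trunc_one m \<omega>_def)
    finally have 1: "\<kappa> * (\<integral>x. P x * \<Phi> x \<partial>lborel)
        \<le> 1 / 2 * (\<integral>x. P x * \<Phi> x \<partial>lborel) + 8 * T * (\<omega> * T ^ m) - (\<integral>x. g x * \<Phi> x \<partial>lborel)"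
      by simp
    have "(\<integral>(x::'a). (- C0 * T\<^sup>2) * indicator (cball 0 R) x \<partial>lborel) \<le> (\<integral>x. g x * \<Phi> x \<partial>lborel)"
    proof (rule integral_mono)
      show "integrable lborel (\<lambda>x::'a. (- C0 * T\<^sup>2) * indicator (cball 0 R) x)"
        using emeasure_bounded_finite[of "cball (0::'a) R"] by simp
      show "(- C0 * T\<^sup>2) * indicator (cball 0 R) x \<le> g x * \<Phi> x" for x
      proof -
        have "- C0 * indicator (cball 0 R) x * T\<^sup>2 \<le> - C0 * indicator (cball 0 R) x * \<Phi> x"
          using \<Phi>0[of x] by (intro mult_left_mono_neg) (auto simp: C0_def)
        also have "\<dots> \<le> g x * \<Phi> x"
          using g_ge[of x] \<Phi>0(1)[of x] by (rule mult_right_mono)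
        finally show ?thesis by (simp add: mult.commute mult.left_commute)
      qed
    qed (simp add: int cg)
    then have 2: "- (C0 * T\<^sup>2 * M) \<le> (\<integral>x. g x * \<Phi> x \<partial>lborel)"
      by (simp add: M_def)
    have "0 \<le> (\<integral>x. P x * \<Phi> x \<partial>lborel)"
      by (intro integral_nonneg_AE AE_I2 mult_nonneg_nonneg \<Phi>0) (simp add: P_def)
    then have "1 * (\<integral>x. P x * \<Phi> x \<partial>lborel) \<le> \<kappa> * (\<integral>x. P x * \<Phi> x \<partial>lborel)"
      using \<kappa> by (intro mult_right_mono) auto
    with 1 2 have "(\<integral>x. P x * \<Phi> x \<partial>lborel) \<le> 16 * \<omega> * T ^ (m + 1) + 2 * C0 * M * T\<^sup>2"
      by (simp add: algebra_simps)
    also have "2 * C0 * M * T\<^sup>2 \<le> 2 * C0 * M * T ^ (m + 1)"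
      using T m by (intro mult_left_mono power_increasing) (auto simp: C0_def M_def)
    finally show ?thesis by (simp add: K_def \<Phi>_def algebra_simps)
  qed
  have "(\<integral>x. P x * trunc T (\<lambda>_. 1) (x \<bullet> x) \<partial>lborel) \<le> K * 2 ^ (m + 1) * T ^ (m - 1)" if T: "1 \<le> T" for T
  proof -
    \<comment> \<open>The test function for \<open>2 * T\<close> is at least T^2 where |x|^2 < T,
      which removes the weight at the cost of a factor T^(-2).\<close>
    have "(\<integral>x. P x * trunc T (\<lambda>_. 1) (x \<bullet> x) \<partial>lborel)
      \<le> (\<integral>x. 1 / T\<^sup>2 * (P x * trunc (2 * T) (\<lambda>\<rho>. (2 * T - \<rho>)\<^sup>2) (x \<bullet> x)) \<partial>lborel)"
    proof (rule integral_mono)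
      show "integrable lborel (\<lambda>x. P x * trunc T (\<lambda>_. 1) (x \<bullet> x))"
        by (intro integrable_trunc_radial cP) auto
      show "integrable lborel (\<lambda>x. 1 / T\<^sup>2 * (P x * trunc (2 * T) (\<lambda>\<rho>. (2 * T - \<rho>)\<^sup>2) (x \<bullet> x)))"
        by (intro integrable_mult_right integrable_trunc_radial cP) (auto intro!: continuous_intros)
      show "P x * trunc T (\<lambda>_. 1) (x \<bullet> x) \<le> 1 / T\<^sup>2 * (P x * trunc (2 * T) (\<lambda>\<rho>. (2 * T - \<rho>)\<^sup>2) (x \<bullet> x))" for x
      proof (cases "x \<bullet> x < T")
        case True
        then have "T\<^sup>2 \<le> (2 * T - x \<bullet> x)\<^sup>2" using T by (intro power_mono) auto
        then have "P x * T\<^sup>2 \<le> P x * (2 * T - x \<bullet> x)\<^sup>2" by (intro mult_left_mono) (auto simp: P_def)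
        then show ?thesis using True T by (simp add: trunc_def field_simps)
      qed (auto simp: trunc_def P_def)
    qed
    also have "\<dots> \<le> 1 / T\<^sup>2 * (K * (2 * T) ^ (m + 1))"
      using est[of "2 * T"] T by (simp add: divide_right_mono)
    also have "\<dots> = K * 2 ^ (m + 1) * T ^ (m - 1)"
    proof -
      obtain l where "m = Suc l" using m by (cases m) auto
      then show ?thesis using T by (simp add: power_mult_distrib power2_eq_square)
    qed
    finally show ?thesis .
  qed
  then show thesis
    using K by (intro that[of "K * 2 ^ (m + 1)"]) (auto simp: P_def)
qed

text \<open>By Young, |grad u| <= 1/sqrt T + sqrt T |grad u|^2. The weights balance the volume T^m
  against the energy T^(m-1), and both parts become O(T^(m - 1/2)).\<close>

lemma gradient_decay:
  fixes u :: "'a::euclidean_space \<Rightarrow> real" and m :: nat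
  assumes m: "DIM('a) = 2 * m" "2 \<le> m" and u: "smooth u" and e: "e \<in> Basis"
    and pos: "\<And>x. R < norm x \<Longrightarrow> 0 \<le> neg_laplacian u x - (real m - 1) * (norm (gradient u x))\<^sup>2"
  shows "(\<lambda>k. (\<integral>x. \<bar>pderiv_dir e u (a + x)\<bar> * trunc (real k) (\<lambda>_. 1) (x \<bullet> x) \<partial>lborel) / real k ^ m) \<longlonglongrightarrow> 0"
proof -
  obtain C where C: "0 \<le> C" "\<And>T. 1 \<le> T \<Longrightarrow>
    (\<integral>x. (norm (gradient u x))\<^sup>2 * trunc T (\<lambda>_. 1) (x \<bullet> x) \<partial>lborel) \<le> C * T ^ (m - 1)"
    using energy_estimate[OF m u pos] by blast
  define \<omega> where "\<omega> = unit_ball_vol (2 * m)"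
  define P where "P x = (norm (gradient u x))\<^sup>2" for x
  have cG: "continuous_on UNIV (gradient u)" by (rule smooth_continuous_on_gradient[OF u])
  have cP: "continuous_on UNIV P" unfolding P_def by (intro continuous_intros cG)
  have cd: "continuous_on UNIV (\<lambda>x. pderiv_dir e u (a + x))"
    by (intro continuous_on_compose2[OF smooth_continuous_on[OF smooth_pderiv_dir[OF u e], of UNIV]] continuous_intros) auto
  have [measurable]: "P \<in> borel_measurable borel" using cP by (rule borel_measurable_continuous_onI)
  have [measurable]: "trunc T (\<lambda>_. 1) \<in> borel_measurable borel" for T unfolding trunc_def[abs_def] by measurable
  have main: "(\<integral>x. \<bar>pderiv_dir e u (a + x)\<bar> * trunc T (\<lambda>_. 1) (x \<bullet> x) \<partial>lborel) / T ^ m \<le> (4 ^ m * \<omega> + 4 ^ (m - 1) * C) / sqrt T"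
    if T: "1 \<le> T" "(norm a)\<^sup>2 \<le> T" for T
  proof -
    define h where "h x = (1 / sqrt T + sqrt T * P x) * trunc (4 * T) (\<lambda>_. 1) (x \<bullet> x)" for x
    have hh: "h x = 1 / sqrt T * trunc (4 * T) (\<lambda>_. 1) (x \<bullet> x) + sqrt T * (P x * trunc (4 * T) (\<lambda>_. 1) (x \<bullet> x))" for x
      by (simp add: h_def distrib_right)
    have ih1: "integrable lborel (\<lambda>x::'a. trunc (4 * T) (\<lambda>_. 1) (x \<bullet> x))" using T by (intro integral_trunc_one(1)[OF m(1)]) auto
    have ih2: "integrable lborel (\<lambda>x. P x * trunc (4 * T) (\<lambda>_. 1) (x \<bullet> x))" by (intro integrable_trunc_radial cP) auto
    have ih: "integrable lborel h" unfolding hh[abs_def] by (intro Bochner_Integration.integrable_add integrable_mult_right ih1 ih2)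
    have h_meas: "h \<in> borel_measurable borel" using borel_measurable_integrable[OF ih] by simp
    have "(\<integral>x. \<bar>pderiv_dir e u (a + x)\<bar> * trunc T (\<lambda>_. 1) (x \<bullet> x) \<partial>lborel) \<le> (\<integral>x. h (a + x) \<partial>lborel)"
    proof (rule integral_mono)
      show "integrable lborel (\<lambda>x. \<bar>pderiv_dir e u (a + x)\<bar> * trunc T (\<lambda>_. 1) (x \<bullet> x))"
        by (intro integrable_trunc_radial continuous_intros cd)
      show "integrable lborel (\<lambda>x. h (a + x))" by (rule lborel_integrable_shift[OF ih])
      show "\<bar>pderiv_dir e u (a + x)\<bar> * trunc T (\<lambda>_. 1) (x \<bullet> x) \<le> h (a + x)" for x
      proof (cases "x \<bullet> x < T")
        case True
        define p where "p = norm (gradient u (a + x))"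
        have "\<bar>pderiv_dir e u (a + x)\<bar> \<le> p"
          using Basis_le_norm[OF e, of "gradient u (a + x)"] e by (simp add: p_def gradient_inner_Basis)
        also have "p \<le> 1 / sqrt T + sqrt T * p\<^sup>2"
        proof -
          have "0 \<le> (1 - sqrt T * p)\<^sup>2" "0 \<le> sqrt T * p"
            using T by (simp_all add: p_def)
          moreover have "(1 - sqrt T * p)\<^sup>2 = 1 + T * p\<^sup>2 - 2 * (sqrt T * p)"
            using T by (simp add: power2_diff power_mult_distrib)
          ultimately have "sqrt T * p \<le> 1 + T * p\<^sup>2" by linarith
          then have "sqrt T * p \<le> sqrt T * (1 / sqrt T + sqrt T * p\<^sup>2)"
            using T by (simp add: distrib_left mult.assoc[symmetric])
          then show ?thesis using T by simp
        qed
        finally have 1: "\<bar>pderiv_dir e u (a + x)\<bar> \<le> 1 / sqrt T + sqrt T * P (a + x)" by (simp add: P_def p_def)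
        \<comment> \<open>The ball of radius sqrt T about \<open>a\<close> lies in the ball of
          radius 2 sqrt T about the origin once |a|^2 <= T, so the energy estimate applies with
          \<open>4 * T\<close>.\<close>
        have "norm x < sqrt T" using True by (simp add: norm_eq_sqrt_inner)
        moreover have "norm a \<le> sqrt T" using T by (intro real_le_rsqrt) auto
        ultimately have "norm (a + x) < 2 * sqrt T" using norm_triangle_ineq[of a x] by linarith
        then have "(norm (a + x))\<^sup>2 < (2 * sqrt T)\<^sup>2" by (intro power_strict_mono) auto
        then have "(a + x) \<bullet> (a + x) < 4 * T" using T by (simp add: power2_norm_eq_inner power_mult_distrib)
        then show ?thesis using True 1 by (simp add: h_def trunc_def)
      next
        case False
        have "0 \<le> h (a + x)" using T by (auto simp: h_def trunc_def P_def)
        then show ?thesis using False by (simp add: trunc_def)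
      qed
    qed
    also have "\<dots> = (\<integral>x. h x \<partial>lborel)"
      by (rule lborel_integral_shift[OF h_meas])
    also have "\<dots> = 1 / sqrt T * (\<omega> * (4 * T) ^ m) + sqrt T * (\<integral>x. P x * trunc (4 * T) (\<lambda>_. 1) (x \<bullet> x) \<partial>lborel)"
      unfolding hh \<omega>_def using T ih1 ih2 integral_trunc_one(2)[OF m(1), of "4 * T"] by (simp del: power_mult_distrib)
    also have "\<dots> \<le> 1 / sqrt T * (\<omega> * (4 * T) ^ m) + sqrt T * (C * (4 * T) ^ (m - 1))"
      using C(2)[of "4 * T"] T by (intro add_left_mono mult_left_mono) (auto simp: P_def)
    also have "\<dots> = (4 ^ m * \<omega> + 4 ^ (m - 1) * C) / sqrt T * T ^ m"
    proof -
      obtain l where l: "m = Suc l" using m by (cases m) auto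
      have "sqrt T * (C * (4 * T) ^ (m - 1)) = 4 ^ (m - 1) * C * (T / sqrt T) * T ^ (m - 1)"
        using T by (simp add: power_mult_distrib real_div_sqrt)
      then show ?thesis using T by (simp add: l power_mult_distrib add_divide_distrib algebra_simps)
    qed
    finally show ?thesis using T by (simp add: pos_divide_le_eq)
  qed
  show ?thesis
  proof (rule Lim_null_comparison)
    have "eventually (\<lambda>k. max 1 ((norm a)\<^sup>2) \<le> real k) sequentially"
      using filterlim_real_sequentially unfolding filterlim_at_top by blast
    then show "eventually (\<lambda>k. norm ((\<integral>x. \<bar>pderiv_dir e u (a + x)\<bar> * trunc (real k) (\<lambda>_. 1) (x \<bullet> x) \<partial>lborel) / real k ^ m)
      \<le> (4 ^ m * \<omega> + 4 ^ (m - 1) * C) / sqrt (real k)) sequentially"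
    proof eventually_elim
      case (elim k)
      have "0 \<le> (\<integral>x. \<bar>pderiv_dir e u (a + x)\<bar> * trunc (real k) (\<lambda>_. 1) (x \<bullet> x) \<partial>lborel)"
        by (intro integral_nonneg_AE AE_I2) (simp add: trunc_def)
      then show ?case using main[of "real k"] elim by simp
    qed
    show "(\<lambda>k. (4 ^ m * \<omega> + 4 ^ (m - 1) * C) / sqrt (real k)) \<longlonglongrightarrow> 0"
      by (intro tendsto_divide_0[OF tendsto_const] filterlim_at_top_imp_at_infinity
          filterlim_compose[OF sqrt_at_top] filterlim_real_sequentially)
  qed
qed

section \<open>Asymptotics at infinity\<close>

text \<open>The value at the origin is \<open>0\<close>.\<close>

definition kelvin :: "'a::euclidean_space \<Rightarrow> 'a" where
  "kelvin z = inverse (z \<bullet> z) *\<^sub>R z"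

definition annulus :: "'a::euclidean_space set" where
  "annulus = {x. 1 \<le> norm x \<and> norm x \<le> 2}"

lemma kelvin_measurable [measurable]: "kelvin \<in> borel_measurable borel"
  unfolding kelvin_def[abs_def] by measurable

lemma norm_kelvin_squared: "(norm (kelvin z))\<^sup>2 = 1 / (z \<bullet> z)"
proof (cases "z = 0")
  case False
  have "(norm (kelvin z))\<^sup>2 = inverse (z \<bullet> z) * (inverse (z \<bullet> z) * (z \<bullet> z))"
    unfolding power2_norm_eq_inner by (simp add: kelvin_def)
  then show ?thesis using False by (simp add: divide_inverse)
qed (simp add: kelvin_def)

text \<open>The distortion formula of the inversion x/|x|^2. It exhibits the cancellation between
  the kernel and its leading term at infinity.\<close>

lemma norm_kelvin_diff_squared:
  assumes "p \<noteq> 0" "q \<noteq> 0"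
  shows "(norm (kelvin p - kelvin q))\<^sup>2 = (norm (p - q))\<^sup>2 / ((norm p)\<^sup>2 * (norm q)\<^sup>2)"
proof -
  have "(norm (kelvin p - kelvin q))\<^sup>2 = (norm (kelvin p))\<^sup>2 + (norm (kelvin q))\<^sup>2 - 2 * (kelvin p \<bullet> kelvin q)"
    by (simp add: power2_norm_eq_inner inner_diff_left inner_diff_right inner_commute)
  also have "\<dots> = 1 / (p \<bullet> p) + 1 / (q \<bullet> q) - 2 * (p \<bullet> q) / ((p \<bullet> p) * (q \<bullet> q))"
    unfolding norm_kelvin_squared by (simp add: kelvin_def divide_inverse)
  also have "\<dots> = ((p \<bullet> p) + (q \<bullet> q) - 2 * (p \<bullet> q)) / ((p \<bullet> p) * (q \<bullet> q))"
    using assms by (simp add: field_simps)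
  finally show ?thesis
    by (simp add: power2_norm_eq_inner inner_diff_left inner_diff_right inner_commute)
qed

lemma kelvin_scale: "kelvin (r *\<^sub>R z) = inverse r *\<^sub>R kelvin z"
  by (cases "r = 0") (simp_all add: kelvin_def)

lemma kelvin_minus: "kelvin (- z) = - kelvin z"
  by (simp add: kelvin_def)

lemma inner_kelvin_self: "z \<noteq> 0 \<Longrightarrow> kelvin z \<bullet> z = 1"
  by (simp add: kelvin_def)

lemma compact_annulus: "compact (annulus :: 'a::euclidean_space set)"
proof -
  have "(annulus :: 'a set) = cball 0 2 - ball 0 1"
    by (auto simp: annulus_def)
  then show ?thesis by (metis compact_cball compact_diff open_ball)
qed

lemma annulus_measurable [measurable]: "annulus \<in> sets borel"
  using compact_annulus compact_imp_closed borel_closed by blast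

lemma emeasure_annulus: "emeasure lborel annulus < \<infinity>"
  by (intro emeasure_bounded_finite compact_imp_bounded compact_annulus)

lemma integrable_annulus:
  fixes h :: "'a::euclidean_space \<Rightarrow> real"
  assumes "continuous_on annulus h"
  shows "integrable lborel (\<lambda>x. indicator annulus x * h x)"
  using borel_integrable_compact[OF compact_annulus assms] by simp

text \<open>Since kelvin (- x) = - kelvin x, the sum is the kernel at \<open>a\<close> minus its
  value at 0. The first bound, uniform in \<open>a\<close>, rests on local square integrability and
  will dominate; the second, from the inversion formula with |x - a| >= 1/2, gives decay as
  \<open>a\<close> tends to 0.\<close>

lemma nn_integral_kelvin_difference:
  fixes a :: "'a::euclidean_space" and m :: nat
  assumes m: "DIM('a) = 2 * m" "2 \<le> m"
  defines "D \<equiv> \<lambda>a. (\<integral>\<^sup>+x. indicator annulus x * ennreal ((norm (kelvin (a - x) + kelvin x))\<^sup>2) \<partial>lborel)"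
  shows "D a \<le> 2 * (\<integral>\<^sup>+(x::'a). ennreal (indicator (cball 0 1) x / (x \<bullet> x)) \<partial>lborel) + 4 * emeasure lborel (annulus :: 'a set)"
    and "norm a \<le> 1 / 2 \<Longrightarrow> D a \<le> ennreal (4 * (norm a)\<^sup>2) * emeasure lborel (annulus :: 'a set)"
proof -
  let ?h = "\<lambda>x::'a. indicator (cball 0 1) x / (x \<bullet> x)"
  have [measurable]: "?h \<in> borel_measurable borel"
    by (intro borel_measurable_divide borel_measurable_indicator) auto
  have h0: "0 \<le> ?h x" for x by simp
  have bound: "(norm (kelvin (a - x) + kelvin x))\<^sup>2 \<le> 2 * ?h ((- a) + x) + 4" if "x \<in> annulus" for x
  proof -
    have "(norm (kelvin (a - x) + kelvin x))\<^sup>2 \<le> (norm (kelvin (a - x)) + norm (kelvin x))\<^sup>2"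
      by (intro power_mono norm_triangle_ineq) simp
    also have "\<dots> \<le> 2 * (norm (kelvin (a - x)))\<^sup>2 + 2 * (norm (kelvin x))\<^sup>2"
      using zero_le_power2[of "norm (kelvin (a - x)) - norm (kelvin x)"] by (simp add: power2_eq_square algebra_simps)
    also have "(norm (kelvin x))\<^sup>2 \<le> 1"
    proof -
      have "1 \<le> x \<bullet> x" using that by (simp add: annulus_def norm_eq_sqrt_inner)
      then show ?thesis unfolding norm_kelvin_squared by (simp add: divide_le_eq_1)
    qed
    also have "(norm (kelvin (a - x)))\<^sup>2 \<le> ?h ((- a) + x) + 1"
    proof (cases "norm (a - x) \<le> 1")
      case True
      then have 1: "(indicator (cball 0 1) ((- a) + x) :: real) = 1" by (simp add: norm_minus_commute)
      have 2: "((- a) + x) \<bullet> ((- a) + x) = (a - x) \<bullet> (a - x)"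
        by (simp add: inner_diff_left inner_diff_right inner_commute)
      show ?thesis unfolding norm_kelvin_squared 1 2 by simp
    next
      case False
      then have "1 \<le> (a - x) \<bullet> (a - x)" by (simp add: norm_eq_sqrt_inner)
      then have "1 / ((a - x) \<bullet> (a - x)) \<le> 1" by (simp add: divide_le_eq_1)
      then show ?thesis using h0[of "(- a) + x"] unfolding norm_kelvin_squared by linarith
    qed
    finally show ?thesis by simp
  qed
  have "D a \<le> (\<integral>\<^sup>+x. 2 * ennreal (?h ((- a) + x)) + 4 * indicator annulus x \<partial>lborel)"
    unfolding D_def
  proof (rule nn_integral_mono)
    fix x :: 'a
    show "indicator annulus x * ennreal ((norm (kelvin (a - x) + kelvin x))\<^sup>2) \<le> 2 * ennreal (?h ((- a) + x)) + 4 * indicator annulus x"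
    proof (cases "x \<in> annulus")
      case True
      have "ennreal ((norm (kelvin (a - x) + kelvin x))\<^sup>2) \<le> ennreal (2 * ?h ((- a) + x) + 4)"
        using bound[OF True] by (rule ennreal_leI)
      also have "\<dots> = 2 * ennreal (?h ((- a) + x)) + 4"
        using h0[of "(- a) + x"] by (simp only: ennreal_plus ennreal_mult ennreal_numeral zero_le_numeral mult_nonneg_nonneg)
      finally show ?thesis using True by simp
    qed simp
  qed
  also have "\<dots> = 2 * (\<integral>\<^sup>+x. ennreal (?h ((- a) + x)) \<partial>lborel) + 4 * emeasure lborel (annulus :: 'a set)"
    by (subst nn_integral_add) (simp_all add: nn_integral_cmult)
  also have "(\<integral>\<^sup>+x. ennreal (?h ((- a) + x)) \<partial>lborel) = (\<integral>\<^sup>+x. ennreal (?h x) \<partial>distr lborel borel ((+) (- a)))"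
    by (subst nn_integral_distr) simp_all
  finally show "D a \<le> 2 * (\<integral>\<^sup>+x. ennreal (?h x) \<partial>lborel) + 4 * emeasure lborel (annulus :: 'a set)"
    by (simp only: lborel_distr_plus)
  assume a: "norm a \<le> 1 / 2"
  have "D a \<le> (\<integral>\<^sup>+(x::'a). ennreal (4 * (norm a)\<^sup>2) * indicator annulus x \<partial>lborel)"
    unfolding D_def
  proof (rule nn_integral_mono)
    fix x :: 'a
    show "indicator annulus x * ennreal ((norm (kelvin (a - x) + kelvin x))\<^sup>2) \<le> ennreal (4 * (norm a)\<^sup>2) * indicator annulus x"
    proof (cases "x \<in> annulus")
      case True
      then have x: "1 \<le> norm x" by (simp add: annulus_def)
      have xa: "1 / 2 \<le> norm (x - a)"
        using norm_triangle_ineq2[of x a] x a by linarith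
      have "kelvin (a - x) + kelvin x = kelvin x - kelvin (x - a)"
        using kelvin_minus[of "x - a"] by simp
      then have "(norm (kelvin (a - x) + kelvin x))\<^sup>2 = (norm a)\<^sup>2 / ((norm x)\<^sup>2 * (norm (x - a))\<^sup>2)"
        using norm_kelvin_diff_squared[of x "x - a"] x xa by fastforce
      also have "\<dots> \<le> (norm a)\<^sup>2 / (1\<^sup>2 * (1 / 2)\<^sup>2)"
        using x xa by (intro divide_left_mono mult_mono power_mono mult_pos_pos zero_less_power) auto
      finally show ?thesis using True by (simp add: ennreal_leI power_divide mult.commute)
    qed simp
  qed
  also have "\<dots> = ennreal (4 * (norm a)\<^sup>2) * emeasure lborel (annulus :: 'a set)"
    by (simp add: nn_integral_cmult)
  finally show "D a \<le> ennreal (4 * (norm a)\<^sup>2) * emeasure lborel (annulus :: 'a set)" .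
qed

text \<open>Splitting |f| into two square roots makes |f| the weight, so that an f which is merely
  in L^1 suffices. The extended nonnegative form spares separate integrability checks.\<close>

lemma Cauchy_Schwarz_weighted:
  fixes f g :: "'a \<Rightarrow> real"
  assumes [measurable]: "f \<in> borel_measurable M" "g \<in> borel_measurable M"
  shows "ennreal ((\<integral>x. f x * g x \<partial>M)\<^sup>2) \<le> (\<integral>\<^sup>+x. ennreal \<bar>f x\<bar> \<partial>M) * (\<integral>\<^sup>+x. ennreal (\<bar>f x\<bar> * (g x)\<^sup>2) \<partial>M)"
proof -
  have "ennreal \<bar>\<integral>x. f x * g x \<partial>M\<bar> \<le> (\<integral>\<^sup>+x. ennreal \<bar>f x * g x\<bar> \<partial>M)"
  \<comment> \<open>If the product is not integrable, its Bochner integral is 0 by convention and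
    the bound is trivial.\<close>
  proof (cases "integrable M (\<lambda>x. f x * g x)")
    case True
    then show ?thesis
      using integral_norm_bound_ennreal[OF True] by simp
  qed (simp add: not_integrable_integral_eq)
  also have "\<dots> = (\<integral>\<^sup>+x. ennreal (sqrt \<bar>f x\<bar>) * ennreal (sqrt \<bar>f x\<bar> * \<bar>g x\<bar>) \<partial>M)"
    by (intro nn_integral_cong) (simp add: abs_mult flip: ennreal_mult'' mult.assoc)
  finally have "(ennreal \<bar>\<integral>x. f x * g x \<partial>M\<bar>)\<^sup>2 \<le> (\<integral>\<^sup>+x. ennreal (sqrt \<bar>f x\<bar>) * ennreal (sqrt \<bar>f x\<bar> * \<bar>g x\<bar>) \<partial>M)\<^sup>2"
    by (rule power_mono) simp
  also have "\<dots> \<le> (\<integral>\<^sup>+x. (ennreal (sqrt \<bar>f x\<bar>))\<^sup>2 \<partial>M) * (\<integral>\<^sup>+x. (ennreal (sqrt \<bar>f x\<bar> * \<bar>g x\<bar>))\<^sup>2 \<partial>M)"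
    by (rule Cauchy_Schwarz_nn_integral) measurable
  also have "(\<integral>\<^sup>+x. (ennreal (sqrt \<bar>f x\<bar>))\<^sup>2 \<partial>M) = (\<integral>\<^sup>+x. ennreal \<bar>f x\<bar> \<partial>M)"
    by (intro nn_integral_cong) (simp add: ennreal_power)
  also have "(\<integral>\<^sup>+x. (ennreal (sqrt \<bar>f x\<bar> * \<bar>g x\<bar>))\<^sup>2 \<partial>M) = (\<integral>\<^sup>+x. ennreal (\<bar>f x\<bar> * (g x)\<^sup>2) \<partial>M)"
    by (intro nn_integral_cong) (simp add: ennreal_power power_mult_distrib)
  finally show ?thesis by (simp add: ennreal_power)
qed

text \<open>\<open>curvature\<close> is R_g >= 0 after division by the positive factor 2 (n-1) exp
  (- 2 u), with (n-2)/2 = m - 1.\<close>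

locale nonneg_curvature_at_infinity =
  fixes u :: "'a::euclidean_space \<Rightarrow> real" and m :: nat and R :: real
  assumes dim: "DIM('a) = 2 * m" and m2: "2 \<le> m" and smooth_u: "smooth u"
    and int_f: "integrable lborel ((neg_laplacian ^^ m) u)"
    and curvature: "\<And>x. R < norm x \<Longrightarrow> 0 \<le> neg_laplacian u x - (real m - 1) * (norm (gradient u x))\<^sup>2"
begin

definition f :: "'a \<Rightarrow> real" where "f = (neg_laplacian ^^ m) u"

definition c :: real where "c = fact (2 * m - 1) * unit_sphere_measure (sphere (0 :: 'a \<times> real) 1)"

text \<open>Normalised so that u behaves like -\<alpha> log|x|; the bubble metric, whose total
  Q-curvature is c, has \<alpha> = 2.\<close>

definition \<alpha> :: real where "\<alpha> = 2 * (\<integral>x. f x \<partial>lborel) / c"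

text \<open>The deviation of the rescaled gradient from that of \<open>-\<alpha> ln \<bar>x\<bar>\<close>.\<close>

definition \<xi> :: "real \<Rightarrow> 'a \<Rightarrow> 'a" where
  "\<xi> r x = r *\<^sub>R gradient u (r *\<^sub>R x) + \<alpha> *\<^sub>R kelvin x"

lemma c_pos: "0 < c"
  unfolding c_def by (rule bubble_mass(3)[OF dim m2])

lemma continuous_f: "continuous_on UNIV f"
  unfolding f_def by (intro smooth_continuous_on smooth_neg_laplacian_funpow smooth_u)

lemma f_measurable [measurable]: "f \<in> borel_measurable borel"
  using continuous_f by (rule borel_measurable_continuous_onI)

lemma gradient_measurable [measurable]: "gradient u \<in> borel_measurable borel"
  using smooth_continuous_on_gradient[OF smooth_u] by (rule borel_measurable_continuous_onI)

lemma \<xi>_measurable [measurable]: "\<xi> r \<in> borel_measurable borel"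
  unfolding \<xi>_def[abs_def] by measurable

lemma continuous_\<xi>: "continuous_on annulus (\<xi> r)"
proof -
  have "continuous_on annulus (kelvin :: 'a \<Rightarrow> 'a)"
    unfolding kelvin_def[abs_def] by (intro continuous_intros) (auto simp: annulus_def)
  then show ?thesis
    unfolding \<xi>_def[abs_def]
    by (intro continuous_intros continuous_on_compose2[OF smooth_continuous_on_gradient[OF smooth_u, of UNIV]]) auto
qed

lemma gradient_eq:
  assumes "e \<in> Basis"
  shows "c * (gradient u a \<bullet> e) = 2 * (\<integral>x. f x * (kelvin (x - a) \<bullet> e) \<partial>lborel)"
proof -
  have "c * pderiv_dir e u a = 2 * (\<integral>x. f (a + x) * ((x \<bullet> e) / (x \<bullet> x)) \<partial>lborel)"
    unfolding c_def f_def bubble_mass(2)[OF dim m2, symmetric]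
    by (intro gradient_representation[OF dim m2 smooth_u int_f assms] gradient_decay[OF dim m2 smooth_u assms curvature])
  also have "(\<integral>x. f (a + x) * ((x \<bullet> e) / (x \<bullet> x)) \<partial>lborel) = (\<integral>x. f (a + x) * (kelvin ((a + x) - a) \<bullet> e) \<partial>lborel)"
    by (simp add: kelvin_def divide_inverse mult.commute)
  also have "\<dots> = (\<integral>x. f x * (kelvin (x - a) \<bullet> e) \<partial>lborel)"
    by (rule lborel_integral_shift) measurable
  finally show ?thesis using assms by (simp add: gradient_inner_Basis)
qed

lemma integrable_f_kelvin:
  assumes "e \<in> Basis"
  shows "integrable lborel (\<lambda>x. f x * (kelvin (x - a) \<bullet> e))"
proof -
  have cfa: "continuous_on UNIV (\<lambda>x. f (a + x))"
    by (intro continuous_on_compose2[OF continuous_f] continuous_intros) auto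
  obtain B where B: "\<And>x. norm x \<le> 1 \<Longrightarrow> \<bar>f (a + x)\<bar> \<le> B"
    using continuous_bounded_cball[OF cfa] by blast
  have "integrable lborel (\<lambda>x. f (a + x) * ((x \<bullet> e) * (1 / (0 + x \<bullet> x))))"
  proof (rule Bochner_Integration.integrable_bound)
    show "integrable lborel (\<lambda>x. B * (indicator (cball 0 1) x / (x \<bullet> x)) + \<bar>f (a + x)\<bar>)"
      using int_f by (intro integrable_bounded_div_norm_square[OF dim m2] lborel_integrable_shift) (simp add: f_def)
    show "AE x in lborel. norm (f (a + x) * ((x \<bullet> e) * (1 / (0 + x \<bullet> x))))
        \<le> norm (B * (indicator (cball 0 1) x / (x \<bullet> x)) + \<bar>f (a + x)\<bar>)"
      using norm_div_norm_square_bound[of e 0 _ "f (a + _)" B] assms B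
      by (intro AE_I2) (auto intro: order_trans[OF _ abs_ge_self])
  qed measurable
  from lborel_integrable_shift[OF this, of "- a"] show ?thesis
    by (simp add: kelvin_def divide_inverse mult.commute)
qed

text \<open>The leading term \<alpha> kelvin x is the integral representation with y/r replaced by
  0, and the kernel is homogeneous of degree -1. So \<xi> integrates f against a difference of
  kernels that is small when |y| is small compared with r.\<close>

lemma \<xi>_eq:
  assumes r: "0 < r" and e: "e \<in> Basis"
  shows "\<xi> r x \<bullet> e = (2 / c) * (\<integral>y. f y * ((kelvin (inverse r *\<^sub>R y - x) + kelvin x) \<bullet> e) \<partial>lborel)"
proof -
  have "inverse r *\<^sub>R y - x = inverse r *\<^sub>R (y - r *\<^sub>R x)" for y
    using r by (simp add: algebra_simps)
  then have k: "kelvin (inverse r *\<^sub>R y - x) = r *\<^sub>R kelvin (y - r *\<^sub>R x)" for y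
    by (simp add: kelvin_scale)
  have "(\<integral>y. f y * ((kelvin (inverse r *\<^sub>R y - x) + kelvin x) \<bullet> e) \<partial>lborel)
      = (\<integral>y. r * (f y * (kelvin (y - r *\<^sub>R x) \<bullet> e)) + (kelvin x \<bullet> e) * f y \<partial>lborel)"
    unfolding k by (intro Bochner_Integration.integral_cong) (simp_all add: inner_add_left algebra_simps)
  also have "\<dots> = r * (\<integral>y. f y * (kelvin (y - r *\<^sub>R x) \<bullet> e) \<partial>lborel) + (kelvin x \<bullet> e) * (\<integral>y. f y \<partial>lborel)"
    using integrable_f_kelvin[OF e] int_f by (subst Bochner_Integration.integral_add) (simp_all add: f_def)
  also have "(2 / c) * \<dots> = r * (gradient u (r *\<^sub>R x) \<bullet> e) + \<alpha> * (kelvin x \<bullet> e)"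
    using gradient_eq[OF e, of "r *\<^sub>R x"] c_pos by (simp add: \<alpha>_def field_simps)
  finally show ?thesis by (simp add: \<xi>_def inner_add_left)
qed

lemma norm_\<xi>_bound:
  assumes "0 < r"
  shows "ennreal ((norm (\<xi> r x))\<^sup>2)
    \<le> ennreal (4 / c\<^sup>2) * (\<integral>\<^sup>+y. ennreal \<bar>f y\<bar> \<partial>lborel)
      * (\<integral>\<^sup>+y. ennreal (\<bar>f y\<bar> * (norm (kelvin (inverse r *\<^sub>R y - x) + kelvin x))\<^sup>2) \<partial>lborel)"
proof -
  let ?D = "\<lambda>y. kelvin (inverse r *\<^sub>R y - x) + kelvin x"
  let ?F = "\<integral>\<^sup>+y. ennreal \<bar>f y\<bar> \<partial>lborel"
  have norm2: "(norm z)\<^sup>2 = (\<Sum>e\<in>Basis. (z \<bullet> e)\<^sup>2)" for z :: 'a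
    unfolding power2_norm_eq_inner euclidean_inner[of z z] by (simp add: power2_eq_square)
  have "ennreal ((norm (\<xi> r x))\<^sup>2) = (\<Sum>e\<in>Basis. ennreal ((\<xi> r x \<bullet> e)\<^sup>2))"
    unfolding norm2 by (rule sum_ennreal[symmetric]) simp
  also have "\<dots> \<le> (\<Sum>e\<in>Basis. ennreal (4 / c\<^sup>2) * (?F * (\<integral>\<^sup>+y. ennreal (\<bar>f y\<bar> * (?D y \<bullet> e)\<^sup>2) \<partial>lborel)))"
  proof (rule sum_mono)
    fix e :: 'a assume e: "e \<in> Basis"
    have "ennreal ((\<xi> r x \<bullet> e)\<^sup>2) = ennreal (4 / c\<^sup>2) * ennreal ((\<integral>y. f y * (?D y \<bullet> e) \<partial>lborel)\<^sup>2)"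
    proof -
      have "(\<xi> r x \<bullet> e)\<^sup>2 = 4 / c\<^sup>2 * (\<integral>y. f y * (?D y \<bullet> e) \<partial>lborel)\<^sup>2"
        unfolding \<xi>_eq[OF assms e] by (simp add: power_mult_distrib power_divide)
      then show ?thesis by (simp only: ennreal_mult' zero_le_power2 zero_le_divide_iff zero_le_numeral simp_thms)
    qed
    also have "\<dots> \<le> ennreal (4 / c\<^sup>2) * (?F * (\<integral>\<^sup>+y. ennreal (\<bar>f y\<bar> * (?D y \<bullet> e)\<^sup>2) \<partial>lborel))"
      by (intro mult_left_mono Cauchy_Schwarz_weighted) measurable
    finally show "ennreal ((\<xi> r x \<bullet> e)\<^sup>2) \<le> ennreal (4 / c\<^sup>2) * (?F * (\<integral>\<^sup>+y. ennreal (\<bar>f y\<bar> * (?D y \<bullet> e)\<^sup>2) \<partial>lborel))" .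
  qed
  also have "\<dots> = ennreal (4 / c\<^sup>2) * ?F * (\<Sum>e\<in>Basis. \<integral>\<^sup>+y. ennreal (\<bar>f y\<bar> * (?D y \<bullet> e)\<^sup>2) \<partial>lborel)"
    by (simp add: sum_distrib_left mult.assoc)
  also have "(\<Sum>e\<in>Basis. \<integral>\<^sup>+y. ennreal (\<bar>f y\<bar> * (?D y \<bullet> e)\<^sup>2) \<partial>lborel)
      = (\<integral>\<^sup>+y. (\<Sum>e\<in>Basis. ennreal (\<bar>f y\<bar> * (?D y \<bullet> e)\<^sup>2)) \<partial>lborel)"
    by (rule nn_integral_sum[symmetric]) measurable
  also have "\<dots> = (\<integral>\<^sup>+y. ennreal (\<bar>f y\<bar> * (norm (?D y))\<^sup>2) \<partial>lborel)"
    unfolding norm2 sum_distrib_left by (intro nn_integral_cong sum_ennreal) simp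
  finally show ?thesis .
qed

lemma integrable_norm_\<xi>:
  "integrable lborel (\<lambda>x. indicator annulus x * (norm (\<xi> r x))\<^sup>2)"
  "integrable lborel (\<lambda>x. indicator annulus x * norm (\<xi> r x))"
  by (intro integrable_annulus continuous_intros continuous_\<xi>)+

definition \<epsilon>2 :: "real \<Rightarrow> real" where
  "\<epsilon>2 r = (\<integral>x. indicator annulus x * (norm (\<xi> r x))\<^sup>2 \<partial>lborel)"

definition \<epsilon>1 :: "real \<Rightarrow> real" where
  "\<epsilon>1 r = (\<integral>x. indicator annulus x * norm (\<xi> r x) \<partial>lborel)"

lemma \<epsilon>_nonneg: "0 \<le> \<epsilon>2 r" "0 \<le> \<epsilon>1 r"
  unfolding \<epsilon>2_def \<epsilon>1_def by (intro integral_nonneg_AE AE_I2; simp)+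

text \<open>Fubini isolates the integral over the annulus, which depends on y and r through y/r
  alone and is controlled by \<open>nn_integral_kelvin_difference\<close>.\<close>

lemma \<epsilon>2_bound:
  assumes "0 < r"
  shows "ennreal (\<epsilon>2 r) \<le> ennreal (4 / c\<^sup>2) * (\<integral>\<^sup>+y. ennreal \<bar>f y\<bar> \<partial>lborel)
    * (\<integral>\<^sup>+y. ennreal \<bar>f y\<bar> * (\<integral>\<^sup>+x. indicator annulus x * ennreal ((norm (kelvin (inverse r *\<^sub>R y - x) + kelvin x))\<^sup>2) \<partial>lborel) \<partial>lborel)"
proof -
  let ?D = "\<lambda>x y. kelvin (inverse r *\<^sub>R y - x) + kelvin x"
  let ?K = "ennreal (4 / c\<^sup>2) * (\<integral>\<^sup>+y. ennreal \<bar>f y\<bar> \<partial>lborel)"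
  have "ennreal (\<epsilon>2 r) = (\<integral>\<^sup>+x. ennreal (indicator annulus x * (norm (\<xi> r x))\<^sup>2) \<partial>lborel)"
    unfolding \<epsilon>2_def by (rule nn_integral_eq_integral[symmetric]) (auto intro: integrable_norm_\<xi>)
  also have "\<dots> \<le> (\<integral>\<^sup>+x. indicator annulus x * (?K * (\<integral>\<^sup>+y. ennreal (\<bar>f y\<bar> * (norm (?D x y))\<^sup>2) \<partial>lborel)) \<partial>lborel)"
    using norm_\<xi>_bound[OF assms] by (intro nn_integral_mono) (simp split: split_indicator)
  also have "\<dots> = (\<integral>\<^sup>+x. ?K * (\<integral>\<^sup>+y. indicator annulus x * ennreal (\<bar>f y\<bar> * (norm (?D x y))\<^sup>2) \<partial>lborel) \<partial>lborel)"
    by (intro nn_integral_cong) (simp split: split_indicator)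
  also have "\<dots> = ?K * (\<integral>\<^sup>+x. (\<integral>\<^sup>+y. indicator annulus x * ennreal (\<bar>f y\<bar> * (norm (?D x y))\<^sup>2) \<partial>lborel) \<partial>lborel)"
    by (rule nn_integral_cmult) measurable
  also have "(\<integral>\<^sup>+x. (\<integral>\<^sup>+y. indicator annulus x * ennreal (\<bar>f y\<bar> * (norm (?D x y))\<^sup>2) \<partial>lborel) \<partial>lborel)
      = (\<integral>\<^sup>+y. (\<integral>\<^sup>+x. indicator annulus x * ennreal (\<bar>f y\<bar> * (norm (?D x y))\<^sup>2) \<partial>lborel) \<partial>lborel)"
    by (rule lborel_pair.Fubini') measurable
  also have "\<dots> = (\<integral>\<^sup>+y. ennreal \<bar>f y\<bar> * (\<integral>\<^sup>+x. indicator annulus x * ennreal ((norm (?D x y))\<^sup>2) \<partial>lborel) \<partial>lborel)"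
    by (intro nn_integral_cong, subst nn_integral_cmult[symmetric]) (simp_all add: ennreal_mult mult.left_commute)
  finally show ?thesis .
qed

lemma \<epsilon>2_bounded: obtains M where "0 \<le> M" "\<And>r. 0 < r \<Longrightarrow> \<epsilon>2 r \<le> M"
proof -
  let ?F = "\<integral>\<^sup>+y. ennreal \<bar>f y\<bar> \<partial>lborel"
  let ?M1 = "2 * (\<integral>\<^sup>+(x::'a). ennreal (indicator (cball 0 1) x / (x \<bullet> x)) \<partial>lborel) + 4 * emeasure lborel (annulus :: 'a set)"
  let ?M = "ennreal (4 / c\<^sup>2) * ?F * (?F * ?M1)"
  have F: "?F < \<infinity>" using int_f unfolding integrable_iff_bounded f_def by simp
  have "(\<integral>\<^sup>+(x::'a). ennreal (indicator (cball 0 1) x / (x \<bullet> x)) \<partial>lborel) < \<infinity>"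
    using integrable_inverse_norm_square[OF dim m2] unfolding integrable_iff_bounded by simp
  then have "?M1 < \<infinity>" using emeasure_annulus[where 'a='a] by (simp add: ennreal_mult_less_top)
  then have M: "?M < \<infinity>" using F by (simp add: ennreal_mult_less_top)
  have "ennreal (\<epsilon>2 r) \<le> ?M" if "0 < r" for r
  proof -
    have "(\<integral>\<^sup>+y. ennreal \<bar>f y\<bar> * (\<integral>\<^sup>+x. indicator annulus x * ennreal ((norm (kelvin (inverse r *\<^sub>R y - x) + kelvin x))\<^sup>2) \<partial>lborel) \<partial>lborel)
      \<le> (\<integral>\<^sup>+y. ennreal \<bar>f y\<bar> * ?M1 \<partial>lborel)"
      by (intro nn_integral_mono mult_left_mono nn_integral_kelvin_difference(1)[OF dim m2]) simp
    also have "\<dots> = ?F * ?M1" by (rule nn_integral_multc) measurable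
    finally show ?thesis
      by (intro order_trans[OF \<epsilon>2_bound[OF that]] mult_left_mono) simp_all
  qed
  note le = this
  define M where "M = enn2real ?M"
  have "\<epsilon>2 r \<le> M" if "0 < r" for r
  proof -
    have "enn2real (ennreal (\<epsilon>2 r)) \<le> M"
      unfolding M_def using M by (intro enn2real_mono le that) (simp only: infinity_ennreal_def)
    then show ?thesis using \<epsilon>_nonneg(1)[of r] by simp
  qed
  moreover have "0 \<le> M" by (simp add: M_def)
  ultimately show thesis by (rule that[rotated])
qed

text \<open>Dominated convergence with respect to |f(y)| dy: for each fixed y the inner integral is
  O(|y/r|^2), and its bound uniform in y/r provides the majorant. No rate results, as f is only in
  L^1.\<close>

lemma \<epsilon>2_tendsto_0: "(\<epsilon>2 \<longlongrightarrow> 0) at_top"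
proof (rule tendsto_at_topI_sequentially)
  fix X :: "nat \<Rightarrow> real" assume X: "filterlim X at_top sequentially"
  let ?F = "\<integral>\<^sup>+y. ennreal \<bar>f y\<bar> \<partial>lborel"
  let ?M1 = "2 * (\<integral>\<^sup>+(x::'a). ennreal (indicator (cball 0 1) x / (x \<bullet> x)) \<partial>lborel) + 4 * emeasure lborel (annulus :: 'a set)"
  define D where "D a = (\<integral>\<^sup>+x. indicator annulus x * ennreal ((norm (kelvin (a - x) + kelvin x))\<^sup>2) \<partial>lborel)" for a :: 'a
  have F: "?F < \<infinity>" using int_f unfolding integrable_iff_bounded f_def by simp
  have "(\<integral>\<^sup>+(x::'a). ennreal (indicator (cball 0 1) x / (x \<bullet> x)) \<partial>lborel) < \<infinity>"
    using integrable_inverse_norm_square[OF dim m2] unfolding integrable_iff_bounded by simp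
  then have M1: "?M1 < \<infinity>" using emeasure_annulus[where 'a='a] by (simp add: ennreal_mult_less_top)
  have [measurable]: "D \<in> borel_measurable borel" unfolding D_def[abs_def] by measurable
  have "(\<lambda>k. \<integral>\<^sup>+y. ennreal \<bar>f y\<bar> * D (inverse (X k) *\<^sub>R y) \<partial>lborel) \<longlonglongrightarrow> (\<integral>\<^sup>+(y::'a). 0 \<partial>lborel)"
  proof (rule nn_integral_dominated_convergence)
    show "AE y in lborel. ennreal \<bar>f y\<bar> * D (inverse (X k) *\<^sub>R y) \<le> ennreal \<bar>f y\<bar> * ?M1" for k
      unfolding D_def by (intro AE_I2 mult_left_mono nn_integral_kelvin_difference(1)[OF dim m2]) simp
    have "(\<integral>\<^sup>+y. ennreal \<bar>f y\<bar> * ?M1 \<partial>lborel) = ?F * ?M1" by (rule nn_integral_multc) measurable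
    also have "\<dots> < \<infinity>" using F M1 by (simp add: ennreal_mult_less_top)
    finally show "(\<integral>\<^sup>+y. ennreal \<bar>f y\<bar> * ?M1 \<partial>lborel) < \<infinity>" .
    show "AE y in lborel. (\<lambda>k. ennreal \<bar>f y\<bar> * D (inverse (X k) *\<^sub>R y)) \<longlonglongrightarrow> 0"
    proof (rule AE_I2)
      fix y :: 'a
      let ?b = "\<lambda>k. ennreal (\<bar>f y\<bar> * (4 * (norm (inverse (X k) *\<^sub>R y))\<^sup>2 * measure lborel (annulus :: 'a set)))"
      have "(\<lambda>k. inverse (X k)) \<longlonglongrightarrow> 0"
        by (rule filterlim_compose[OF tendsto_inverse_0 filterlim_at_top_imp_at_infinity[OF X]])
      then have y0: "(\<lambda>k. inverse (X k) *\<^sub>R y) \<longlonglongrightarrow> 0"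
        using tendsto_scaleR[of "\<lambda>k. inverse (X k)" 0 sequentially "\<lambda>_. y" y] by simp
      have "(\<lambda>k. \<bar>f y\<bar> * (4 * (norm (inverse (X k) *\<^sub>R y))\<^sup>2 * measure lborel (annulus :: 'a set)))
          \<longlonglongrightarrow> \<bar>f y\<bar> * (4 * (norm (0::'a))\<^sup>2 * measure lborel (annulus :: 'a set))"
        by (intro tendsto_intros y0)
      then have "?b \<longlonglongrightarrow> ennreal (\<bar>f y\<bar> * (4 * (norm (0::'a))\<^sup>2 * measure lborel (annulus :: 'a set)))"
        by (rule tendsto_ennrealI)
      then have b0: "?b \<longlonglongrightarrow> 0" by simp
      have "eventually (\<lambda>k. norm (inverse (X k) *\<^sub>R y) < 1 / 2) sequentially"
        using tendsto_norm_zero[OF y0] by (rule order_tendstoD) simp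
      then have "eventually (\<lambda>k. ennreal \<bar>f y\<bar> * D (inverse (X k) *\<^sub>R y) \<le> ?b k) sequentially"
      proof eventually_elim
        case (elim k)
        have "D (inverse (X k) *\<^sub>R y) \<le> ennreal (4 * (norm (inverse (X k) *\<^sub>R y))\<^sup>2) * emeasure lborel (annulus :: 'a set)"
          unfolding D_def using elim by (intro nn_integral_kelvin_difference(2)[OF dim m2]) simp
        also have "\<dots> = ennreal (4 * (norm (inverse (X k) *\<^sub>R y))\<^sup>2 * measure lborel (annulus :: 'a set))"
          using emeasure_annulus[where 'a='a] by (simp add: emeasure_eq_ennreal_measure ennreal_mult'' less_top)
        finally have "ennreal \<bar>f y\<bar> * D (inverse (X k) *\<^sub>R y)
          \<le> ennreal \<bar>f y\<bar> * ennreal (4 * (norm (inverse (X k) *\<^sub>R y))\<^sup>2 * measure lborel (annulus :: 'a set))"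
          by (rule mult_left_mono) simp
        then show ?case by (simp add: ennreal_mult'')
      qed
      then show "(\<lambda>k. ennreal \<bar>f y\<bar> * D (inverse (X k) *\<^sub>R y)) \<longlonglongrightarrow> 0"
        by (intro tendsto_sandwich[OF _ _ tendsto_const b0]) auto
    qed
  qed measurable
  then have "(\<lambda>k. ennreal (4 / c\<^sup>2) * ?F * (\<integral>\<^sup>+y. ennreal \<bar>f y\<bar> * D (inverse (X k) *\<^sub>R y) \<partial>lborel))
      \<longlonglongrightarrow> ennreal (4 / c\<^sup>2) * ?F * (\<integral>\<^sup>+(y::'a). 0 \<partial>lborel)"
    using F by (intro ennreal_tendsto_cmult) (simp_all add: ennreal_mult_less_top)
  then have lim: "(\<lambda>k. ennreal (4 / c\<^sup>2) * ?F * (\<integral>\<^sup>+y. ennreal \<bar>f y\<bar> * D (inverse (X k) *\<^sub>R y) \<partial>lborel)) \<longlonglongrightarrow> 0"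
    by simp
  have "eventually (\<lambda>k. 0 < X k) sequentially" using X unfolding filterlim_at_top_dense by blast
  then have "eventually (\<lambda>k. ennreal (\<epsilon>2 (X k)) \<le> ennreal (4 / c\<^sup>2) * ?F * (\<integral>\<^sup>+y. ennreal \<bar>f y\<bar> * D (inverse (X k) *\<^sub>R y) \<partial>lborel)) sequentially"
    by eventually_elim (auto simp: D_def intro: \<epsilon>2_bound)
  then have "(\<lambda>k. ennreal (\<epsilon>2 (X k))) \<longlonglongrightarrow> 0"
    by (intro tendsto_sandwich[OF _ _ tendsto_const lim]) auto
  then have "(\<lambda>k. ennreal (\<epsilon>2 (X k))) \<longlonglongrightarrow> ennreal 0" by simp
  then show "(\<lambda>k. \<epsilon>2 (X k)) \<longlonglongrightarrow> 0"
    using \<epsilon>_nonneg(1) by (subst (asm) tendsto_ennreal_iff) auto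
qed

text \<open>Young's inequality trades the square for a first power; \<delta> is chosen small before
  r is taken large.\<close>

lemma \<epsilon>1_le:
  assumes "0 < \<delta>"
  shows "\<epsilon>1 r \<le> \<delta> * measure lborel (annulus :: 'a set) + \<epsilon>2 r / \<delta>"
proof -
  have "\<epsilon>1 r \<le> (\<integral>x. \<delta> * indicator annulus x + (1 / \<delta>) * (indicator annulus x * (norm (\<xi> r x))\<^sup>2) \<partial>lborel)"
    unfolding \<epsilon>1_def
  proof (rule integral_mono)
    show "integrable lborel (\<lambda>x::'a. \<delta> * indicator annulus x + (1 / \<delta>) * (indicator annulus x * (norm (\<xi> r x))\<^sup>2))"
      using emeasure_annulus[where 'a='a]
      by (intro Bochner_Integration.integrable_add integrable_mult_right integrable_norm_\<xi>) auto
    show "indicator annulus x * norm (\<xi> r x) \<le> \<delta> * indicator annulus x + (1 / \<delta>) * (indicator annulus x * (norm (\<xi> r x))\<^sup>2)" for x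
    proof (cases "x \<in> annulus")
      case True
      have "0 \<le> (\<delta> - norm (\<xi> r x))\<^sup>2" "0 \<le> \<delta> * norm (\<xi> r x)" using assms by simp_all
      then have "norm (\<xi> r x) * \<delta> \<le> \<delta> * \<delta> + (norm (\<xi> r x))\<^sup>2"
        unfolding power2_diff by (simp add: power2_eq_square mult.commute)
      then show ?thesis using True assms by (simp add: field_simps)
    qed simp
  qed (rule integrable_norm_\<xi>)
  also have "\<dots> = \<delta> * measure lborel (annulus :: 'a set) + \<epsilon>2 r / \<delta>"
    using emeasure_annulus[where 'a='a] integrable_norm_\<xi>(1)[of r] by (subst Bochner_Integration.integral_add) (auto simp: \<epsilon>2_def)
  finally show ?thesis .
qed

lemma \<epsilon>1_tendsto_0: "(\<epsilon>1 \<longlongrightarrow> 0) at_top"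
proof (rule tendstoI)
  fix e :: real assume e: "0 < e"
  define M where "M = measure lborel (annulus :: 'a set)"
  \<comment> \<open>The summand 1 avoids dividing by a possibly zero \<open>M\<close> and makes
    \<open>\<delta> * M < e / 2\<close> strict.\<close>
  define \<delta> where "\<delta> = e / (2 * (M + 1))"
  have M: "0 \<le> M" by (simp add: M_def)
  then have \<delta>: "0 < \<delta>" "\<delta> * M < e / 2" using e by (auto simp: \<delta>_def field_simps)
  have "eventually (\<lambda>r. \<epsilon>2 r < \<delta> * (e / 2)) at_top"
    using \<epsilon>2_tendsto_0 by (rule order_tendstoD) (use \<delta> e in simp)
  then show "eventually (\<lambda>r. dist (\<epsilon>1 r) 0 < e) at_top"
  proof eventually_elim
    case (elim r)
    then have "\<epsilon>2 r / \<delta> < e / 2" using \<delta> by (simp add: field_simps)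
    then have "\<epsilon>1 r < e" using \<epsilon>1_le[OF \<delta>(1), of r] \<delta>(2) unfolding M_def by linarith
    then show ?case using \<epsilon>_nonneg(2)[of r] by simp
  qed
qed

end

section \<open>Dilations\<close>

lemma GDERIV_scale:
  assumes "GDERIV f (r *\<^sub>R x) :> D"
  shows "GDERIV (\<lambda>x. s * f (r *\<^sub>R x)) x :> (s * r) *\<^sub>R D"
proof -
  have "((\<lambda>x. r *\<^sub>R x) has_derivative (\<lambda>h. r *\<^sub>R h)) (at x)"
    by (auto intro!: derivative_eq_intros)
  from has_derivative_mult_right[OF has_derivative_compose[OF this assms[unfolded gderiv_def]], of s] show ?thesis
    by (simp add: gderiv_def mult.assoc)
qed

lemma pderiv_dir_scale:
  assumes "\<And>x. f differentiable (at x)" "b \<in> Basis"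
  shows "pderiv_dir b (\<lambda>x. s * f (r *\<^sub>R x)) = (\<lambda>x. (s * r) * pderiv_dir b f (r *\<^sub>R x))"
  by (simp add: pderiv_dir_eqI[OF GDERIV_scale[OF gderiv_gradient[OF assms(1)]]] gradient_inner_Basis assms(2))

text \<open>The factor \<open>s\<close> is there for the induction: every derivative brings out a
  factor \<open>r\<close>.\<close>

lemma C_k_scale: "C_k k f \<Longrightarrow> C_k k (\<lambda>x. s * f (r *\<^sub>R x))"
proof (induction k arbitrary: f s)
  case 0
  then have "continuous_on UNIV (\<lambda>x. f (r *\<^sub>R x))"
    by (auto intro!: continuous_on_compose2[of UNIV f] continuous_intros)
  then show ?case by (auto intro!: continuous_intros)
next
  case (Suc k)
  have "GDERIV (\<lambda>x. s * f (r *\<^sub>R x)) x :> (s * r) *\<^sub>R gradient f (r *\<^sub>R x)" for x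
    using Suc.prems by (intro GDERIV_scale C_k_differentiable)
  then have "(\<lambda>x. s * f (r *\<^sub>R x)) differentiable (at x)" for x
    using GDERIV_imp_differentiable by blast
  then show ?case
    using Suc by (simp add: pderiv_dir_scale)
qed

lemma smooth_scale: "smooth f \<Longrightarrow> smooth (\<lambda>x. f (r *\<^sub>R x))"
  using C_k_scale[of _ f 1 r] by (simp add: smooth_def)

lemma gradient_scale: "smooth f \<Longrightarrow> gradient (\<lambda>x. f (r *\<^sub>R x)) x = r *\<^sub>R gradient f (r *\<^sub>R x)"
  using GDERIV_scale[OF smooth_GDERIV[of f "r *\<^sub>R x"], where s = 1] by (intro GDERIV_imp_gradient) simp

lemma neg_laplacian_scale:
  assumes "smooth f"
  shows "neg_laplacian (\<lambda>x. f (r *\<^sub>R x)) x = r\<^sup>2 * neg_laplacian f (r *\<^sub>R x)"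
proof -
  have "pderiv_dir b (pderiv_dir b (\<lambda>x. f (r *\<^sub>R x))) x = r\<^sup>2 * pderiv_dir b (pderiv_dir b f) (r *\<^sub>R x)"
    if b: "b \<in> Basis" for b
    using pderiv_dir_scale[OF smooth_differentiable[OF assms] b, of 1]
      pderiv_dir_scale[OF smooth_differentiable[OF smooth_pderiv_dir[OF assms b]] b, of r]
    by (simp add: power2_eq_square)
  then show ?thesis
    by (simp add: neg_laplacian_def laplacian_def sum_distrib_left)
qed

section \<open>Logarithmic growth of u in the mean\<close>

context nonneg_curvature_at_infinity
begin

definition L :: "real \<Rightarrow> real" where
  "L r = (\<integral>x. indicator annulus x * \<bar>u (r *\<^sub>R x) + \<alpha> * ln r\<bar> \<partial>lborel)"

lemma continuous_scaled: "continuous_on S (\<lambda>x. u (r *\<^sub>R x))"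
  using smooth_continuous_on[OF smooth_scale[OF smooth_u]] .

lemma integrable_L: "integrable lborel (\<lambda>x. indicator annulus x * \<bar>u (r *\<^sub>R x) + \<alpha> * ln r\<bar>)"
  by (intro integrable_annulus continuous_intros continuous_scaled)

lemma L_nonneg: "0 \<le> L r"
  unfolding L_def by (intro integral_nonneg_AE AE_I2) simp

lemma \<epsilon>1_bounded: obtains M where "0 \<le> M" "\<And>r. 0 < r \<Longrightarrow> \<epsilon>1 r \<le> M"
proof -
  obtain M where M: "0 \<le> M" "\<And>r. 0 < r \<Longrightarrow> \<epsilon>2 r \<le> M" using \<epsilon>2_bounded by blast
  have "\<epsilon>1 r \<le> measure lborel (annulus :: 'a set) + M" if "0 < r" for r
    using \<epsilon>1_le[of 1 r] M(2)[OF that] by simp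
  then show thesis using M(1) by (intro that[of "measure lborel (annulus :: 'a set) + M"]) auto
qed

text \<open>Along the ray through x, the derivative of u (s x) + \<alpha> ln s is (\<xi> s x . x)/s
  because kelvin x . x = 1. The factor 2 is the bound on |x| in the annulus.\<close>

lemma radial_increment:
  assumes x: "x \<in> annulus" and r: "1 \<le> r"
  shows "ennreal \<bar>u (r *\<^sub>R x) + \<alpha> * ln r\<bar>
    \<le> ennreal \<bar>u x\<bar> + (\<integral>\<^sup>+s. indicator {1..r} s * ennreal (2 / s * norm (\<xi> s x)) \<partial>lborel)"
proof -
  define F where "F s = u (s *\<^sub>R x) + \<alpha> * ln s" for s
  define F' where "F' s = gradient u (s *\<^sub>R x) \<bullet> x + \<alpha> / s" for s
  have F: "(F has_real_derivative F' s) (at s)" if "1 \<le> s" for s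
  proof -
    have "((\<lambda>s. s *\<^sub>R x) has_derivative (\<lambda>h. h *\<^sub>R x)) (at s)"
      by (auto intro!: derivative_eq_intros)
    from has_derivative_compose[OF this smooth_GDERIV[OF smooth_u, unfolded gderiv_def]]
    have "((\<lambda>s. u (s *\<^sub>R x)) has_real_derivative gradient u (s *\<^sub>R x) \<bullet> x) (at s)"
      by (simp add: has_field_derivative_def inner_commute mult_commute_abs)
    then show ?thesis
      unfolding F_def[abs_def] F'_def using that by (auto intro!: derivative_eq_intros)
  qed
  have "continuous_on UNIV (\<lambda>s. gradient u (s *\<^sub>R x))"
    by (intro continuous_on_compose2[OF smooth_continuous_on_gradient[OF smooth_u, of UNIV]] continuous_intros) auto
  then have F'_cont: "isCont F' s" if "1 \<le> s" for s
    unfolding F'_def[abs_def] using that by (auto intro!: continuous_intros simp: continuous_on_eq_continuous_at)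
  have x0: "x \<noteq> 0" "norm x \<le> 2" using x by (auto simp: annulus_def)
  have F'_le: "\<bar>F' s\<bar> \<le> 2 / s * norm (\<xi> s x)" if "1 \<le> s" for s
  proof -
    have "\<xi> s x \<bullet> x = s * F' s"
      using x0 that by (simp add: \<xi>_def F'_def inner_add_left inner_kelvin_self distrib_left)
    then have "\<bar>F' s\<bar> = \<bar>\<xi> s x \<bullet> x\<bar> / s" using that by (simp add: abs_mult)
    also have "\<dots> \<le> (norm (\<xi> s x) * 2) / s"
      using x0 that by (intro divide_right_mono order_trans[OF Cauchy_Schwarz_ineq2] mult_left_mono) auto
    finally show ?thesis by (simp add: mult.commute)
  qed
  have "(\<integral>s. F' s * indicator {1..r} s \<partial>lborel) = F r - F 1"
    using r F F'_cont by (intro integral_FTC_Icc_real) auto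
  moreover have "integrable lborel (\<lambda>s. F' s * indicator {1..r} s)"
    using F'_cont by (intro borel_integrable_atLeastAtMost) auto
  ultimately have "ennreal \<bar>F r - F 1\<bar> \<le> (\<integral>\<^sup>+s. ennreal \<bar>F' s * indicator {1..r} s\<bar> \<partial>lborel)"
    using integral_norm_bound_ennreal[of lborel "\<lambda>s. F' s * indicator {1..r} s"] by simp
  also have "\<dots> \<le> (\<integral>\<^sup>+s. indicator {1..r} s * ennreal (2 / s * norm (\<xi> s x)) \<partial>lborel)"
    using F'_le by (intro nn_integral_mono) (auto simp: indicator_def intro!: ennreal_leI)
  finally have le: "ennreal \<bar>F r - F 1\<bar> \<le> (\<integral>\<^sup>+s. indicator {1..r} s * ennreal (2 / s * norm (\<xi> s x)) \<partial>lborel)" .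
  have "ennreal \<bar>u (r *\<^sub>R x) + \<alpha> * ln r\<bar> \<le> ennreal (\<bar>u x\<bar> + \<bar>F r - F 1\<bar>)"
    by (intro ennreal_leI) (simp add: F_def)
  also have "\<dots> = ennreal \<bar>u x\<bar> + ennreal \<bar>F r - F 1\<bar>" by (rule ennreal_plus) simp_all
  finally show ?thesis using le by (meson add_left_mono order_trans)
qed

text \<open>Integrating the increments along rays over the annulus and exchanging the order leaves
  the mean deviation \<open>\<epsilon>1\<close> against ds/s.\<close>

lemma L_increment:
  assumes r: "1 \<le> r"
  shows "ennreal (L r) \<le> ennreal (L 1) + (\<integral>\<^sup>+s. indicator {1..r} s * ennreal (2 / s * \<epsilon>1 s) \<partial>lborel)"
proof -
  let ?I = "\<lambda>s x. indicator {1..r} s * ennreal (2 / s * norm (\<xi> s x))"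
  have [measurable]: "u \<in> borel_measurable borel"
    using smooth_continuous_on[OF smooth_u] by (rule borel_measurable_continuous_onI)
  have meas: "(\<lambda>(x, s). indicator annulus x * ?I s x) \<in> borel_measurable (borel \<Otimes>\<^sub>M borel)"
    unfolding \<xi>_def by measurable
  have "ennreal (L r) = (\<integral>\<^sup>+x. ennreal (indicator annulus x * \<bar>u (r *\<^sub>R x) + \<alpha> * ln r\<bar>) \<partial>lborel)"
    unfolding L_def by (rule nn_integral_eq_integral[symmetric]) (auto intro: integrable_L)
  also have "\<dots> \<le> (\<integral>\<^sup>+x. ennreal (indicator annulus x * \<bar>u (1 *\<^sub>R x) + \<alpha> * ln 1\<bar>) + (\<integral>\<^sup>+s. indicator annulus x * ?I s x \<partial>lborel) \<partial>lborel)"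
  proof (rule nn_integral_mono)
    fix x
    show "ennreal (indicator annulus x * \<bar>u (r *\<^sub>R x) + \<alpha> * ln r\<bar>)
      \<le> ennreal (indicator annulus x * \<bar>u (1 *\<^sub>R x) + \<alpha> * ln 1\<bar>) + (\<integral>\<^sup>+s. indicator annulus x * ?I s x \<partial>lborel)"
      using radial_increment[OF _ r, of x] by (cases "x \<in> annulus") simp_all
  qed
  also have "\<dots> = (\<integral>\<^sup>+x. ennreal (indicator annulus x * \<bar>u (1 *\<^sub>R x) + \<alpha> * ln 1\<bar>) \<partial>lborel)
      + (\<integral>\<^sup>+x. (\<integral>\<^sup>+s. indicator annulus x * ?I s x \<partial>lborel) \<partial>lborel)"
  proof (rule nn_integral_add)
    show "(\<lambda>x. \<integral>\<^sup>+s. indicator annulus x * ?I s x \<partial>lborel) \<in> borel_measurable lborel"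
      using lborel.borel_measurable_nn_integral[of "\<lambda>x s. indicator annulus x * ?I s x" borel] meas by simp
  qed measurable
  also have "(\<integral>\<^sup>+x. ennreal (indicator annulus x * \<bar>u (1 *\<^sub>R x) + \<alpha> * ln 1\<bar>) \<partial>lborel) = ennreal (L 1)"
    unfolding L_def by (rule nn_integral_eq_integral) (use integrable_L[of 1] in auto)
  also have "(\<integral>\<^sup>+x. (\<integral>\<^sup>+s. indicator annulus x * ?I s x \<partial>lborel) \<partial>lborel)
      = (\<integral>\<^sup>+s. (\<integral>\<^sup>+x. indicator annulus x * ?I s x \<partial>lborel) \<partial>lborel)"
    by (rule lborel_pair.Fubini') (unfold \<xi>_def, measurable)
  also have "\<dots> = (\<integral>\<^sup>+s. indicator {1..r} s * ennreal (2 / s * \<epsilon>1 s) \<partial>lborel)"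
  proof (rule nn_integral_cong)
    fix s :: real
    have "(\<integral>\<^sup>+x. indicator annulus x * ?I s x \<partial>lborel)
        = indicator {1..r} s * (\<integral>\<^sup>+x. ennreal (2 / s * (indicator annulus x * norm (\<xi> s x))) \<partial>lborel)"
      by (subst nn_integral_cmult[symmetric]) (auto intro!: nn_integral_cong simp: indicator_def)
    also have "\<dots> = indicator {1..r} s * ennreal (2 / s * \<epsilon>1 s)"
    proof (cases "s \<in> {1..r}")
      case True
      then have "(\<integral>\<^sup>+x. ennreal (2 / s * (indicator annulus x * norm (\<xi> s x))) \<partial>lborel)
          = ennreal (\<integral>x. 2 / s * (indicator annulus x * norm (\<xi> s x)) \<partial>lborel)"
        by (intro nn_integral_eq_integral integrable_mult_right integrable_norm_\<xi>) auto
      then show ?thesis by (simp add: \<epsilon>1_def)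
    qed simp
    finally show "(\<integral>\<^sup>+x. indicator annulus x * ?I s x \<partial>lborel) = indicator {1..r} s * ennreal (2 / s * \<epsilon>1 s)" .
  qed
  finally show ?thesis .
qed

text \<open>A Cesaro argument for ds/s: \<open>\<epsilon>1\<close> tends to 0, so its logarithmic
  mean does too. Scales below \<open>s0\<close> contribute a constant by boundedness of
  \<open>\<epsilon>1\<close>.\<close>

lemma L_over_ln_tendsto_0: "((\<lambda>r. L r / ln r) \<longlongrightarrow> 0) at_top"
proof (rule tendstoI)
  fix e :: real assume e: "0 < e"
  \<comment> \<open>The tail contributes 2 d ln r and the constants less than d ln r for large r; 3
    d stays below e.\<close>
  define d where "d = e / 4"
  have d: "0 < d" using e by (simp add: d_def)
  obtain M where M: "0 \<le> M" "\<And>r. 0 < r \<Longrightarrow> \<epsilon>1 r \<le> M" using \<epsilon>1_bounded by blast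
  have "eventually (\<lambda>r. \<epsilon>1 r < d) at_top"
    using \<epsilon>1_tendsto_0 d by (rule order_tendstoD)
  then obtain s1 where "\<And>s. s1 \<le> s \<Longrightarrow> \<epsilon>1 s < d"
    unfolding eventually_at_top_linorder by blast
  then obtain s0 where s0: "1 \<le> s0" "\<And>s. s0 \<le> s \<Longrightarrow> \<epsilon>1 s < d"
    by (meson max.cobounded1 max.bounded_iff)
  have est: "L r \<le> L 1 + 2 * M * s0 + 2 * d * ln r" if r: "1 \<le> r" for r
  proof -
    have "(\<integral>\<^sup>+s. indicator {1..r} s * ennreal (2 / s * \<epsilon>1 s) \<partial>lborel)
      \<le> (\<integral>\<^sup>+s. ennreal (2 * M) * indicator {0..s0} s + ennreal (2 * d / s) * indicator {1..r} s \<partial>lborel)"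
    proof (rule nn_integral_mono)
      fix s :: real
      show "indicator {1..r} s * ennreal (2 / s * \<epsilon>1 s) \<le> ennreal (2 * M) * indicator {0..s0} s + ennreal (2 * d / s) * indicator {1..r} s"
      proof (cases "s \<in> {1..r}")
        case True
        show ?thesis
        proof (cases "s \<le> s0")
          case le: True
          have "2 / s * \<epsilon>1 s \<le> 2 * M"
            using True M mult_mono[of "2 / s" 2 "\<epsilon>1 s" M] \<epsilon>_nonneg(2)[of s] by (simp add: divide_le_eq)
          then have "ennreal (2 / s * \<epsilon>1 s) \<le> ennreal (2 * M)" by (rule ennreal_leI)
          then show ?thesis using True le by (simp add: add_increasing2)
        next
          case False
          then have "2 / s * \<epsilon>1 s \<le> 2 / s * d"
            using True s0(2)[of s] by (intro mult_left_mono) auto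
          then have "ennreal (2 / s * \<epsilon>1 s) \<le> ennreal (2 * d / s)" by (intro ennreal_leI) simp
          then show ?thesis using True False by simp
        qed
      qed simp
    qed
    also have "\<dots> = ennreal (2 * M) * ennreal s0 + (\<integral>\<^sup>+s. ennreal (2 * d / s) * indicator {1..r} s \<partial>lborel)"
      using s0 by (subst nn_integral_add) (simp_all add: nn_integral_cmult)
    also have "(\<integral>\<^sup>+s. ennreal (2 * d / s) * indicator {1..r} s \<partial>lborel) = ennreal (2 * d * ln r - 2 * d * ln 1)"
      using r d by (intro nn_integral_FTC_Icc) (auto intro!: derivative_eq_intros)
    also have "ennreal (2 * M) * ennreal s0 + ennreal (2 * d * ln r - 2 * d * ln 1) = ennreal (2 * M * s0 + 2 * d * ln r)"
      using M s0 r d by (simp add: ennreal_plus ennreal_mult)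
    finally have "ennreal (L r) \<le> ennreal (L 1) + ennreal (2 * M * s0 + 2 * d * ln r)"
      using L_increment[OF r] by (meson add_left_mono order_trans)
    also have "\<dots> = ennreal (L 1 + (2 * M * s0 + 2 * d * ln r))"
      using L_nonneg M s0 r d by (intro ennreal_plus[symmetric]) auto
    finally show ?thesis
      using L_nonneg[of 1] M s0 r d by (subst (asm) ennreal_le_iff) auto
  qed
  have "eventually (\<lambda>r. (L 1 + 2 * M * s0) / d < ln r) at_top"
    using ln_at_top unfolding filterlim_at_top_dense by blast
  then show "eventually (\<lambda>r. dist (L r / ln r) 0 < e) at_top"
    using eventually_gt_at_top[of 1]
  proof eventually_elim
    case (elim r)
    then have ln: "0 < ln r" by simp
    have "L 1 + 2 * M * s0 < d * ln r" using elim d by (simp add: pos_divide_less_eq mult.commute)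
    then have "L r < 3 * d * ln r" using est[of r] elim by simp
    also have "\<dots> \<le> e * ln r" using ln d e by (simp add: d_def)
    finally show ?case using ln L_nonneg[of r] by (simp add: pos_divide_less_eq)
  qed
qed

end

section \<open>Testing the curvature inequalities on large annuli\<close>

text \<open>The weight \<open>max 0 ((\<rho> - 1) (4 - \<rho>))\<^sup>2\<close> and its derivative; as functions of
  \<open>\<rho> = \<bar>x\<bar>\<^sup>2\<close> they are supported in the annulus.\<close>

definition weight :: "real \<Rightarrow> real" where
  "weight \<rho> = trunc 0 (\<lambda>t. t\<^sup>2) ((\<rho> - 1) * (\<rho> - 4))"

definition weight' :: "real \<Rightarrow> real" where
  "weight' \<rho> = trunc 0 (\<lambda>t. 2 * t) ((\<rho> - 1) * (\<rho> - 4)) * (2 * \<rho> - 5)"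

lemma DERIV_weight: "(weight has_real_derivative weight' \<rho>) (at \<rho>)"
proof -
  have 1: "((\<lambda>\<rho>. (\<rho> - 1) * (\<rho> - 4)) has_real_derivative 2 * \<rho> - 5) (at \<rho>)"
    by (auto intro!: derivative_eq_intros)
  have 2: "(trunc 0 (\<lambda>t. t\<^sup>2) has_real_derivative trunc 0 (\<lambda>t. 2 * t) t) (at t)" for t
    by (rule trunc_DERIV) (auto intro!: derivative_eq_intros)
  show ?thesis
    unfolding weight_def[abs_def] weight'_def by (rule DERIV_chain2[OF 2 1])
qed

lemma isCont_weight: "isCont weight \<rho>" "isCont weight' \<rho>"
proof -
  show "isCont weight \<rho>" using DERIV_weight by (rule DERIV_isCont)
  have "isCont (\<lambda>\<rho>. trunc 0 (\<lambda>t. 2 * t) ((\<rho> - 1) * (\<rho> - 4))) \<rho>"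
  proof (rule isCont_o2[where g = "trunc 0 (\<lambda>t. 2 * t)"])
    show "isCont (trunc 0 (\<lambda>t. 2 * t)) ((\<rho> - 1) * (\<rho> - 4))"
      by (rule trunc_isCont) (auto intro!: continuous_intros)
  qed (intro continuous_intros)
  then show "isCont weight' \<rho>"
    unfolding weight'_def[abs_def] by (intro continuous_intros)
qed

lemma weight_nonneg: "0 \<le> weight \<rho>"
  by (simp add: weight_def trunc_def)

lemma weight_eq_0:
  assumes "x \<notin> annulus"
  shows "weight (x \<bullet> x) = 0" "weight' (x \<bullet> x) = 0"
proof -
  have "norm x < 1 \<or> 2 < norm x" using assms by (auto simp: annulus_def)
  then have "x \<bullet> x < 1 \<or> 4 < x \<bullet> x"
  proof
    assume "norm x < 1"
    then show ?thesis by (simp add: norm_eq_sqrt_inner)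
  next
    assume "2 < norm x"
    then have "2\<^sup>2 < (norm x)\<^sup>2" by (intro power_strict_mono) auto
    then show ?thesis by (simp add: power2_norm_eq_inner)
  qed
  then have "0 \<le> (x \<bullet> x - 1) * (x \<bullet> x - 4)" by (auto intro: mult_nonneg_nonneg mult_nonpos_nonpos)
  then show "weight (x \<bullet> x) = 0" "weight' (x \<bullet> x) = 0"
    by (simp_all add: weight_def weight'_def trunc_def)
qed

lemma continuous_weight:
  "continuous_on UNIV (\<lambda>x::'a::euclidean_space. weight (x \<bullet> x))"
  "continuous_on UNIV (\<lambda>x::'a::euclidean_space. weight' (x \<bullet> x))"
proof -
  have "isCont (\<lambda>x::'a. x \<bullet> x) x" for x by (intro continuous_intros)
  from isCont_o2[OF this isCont_weight(1)] isCont_o2[OF this isCont_weight(2)]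
  show "continuous_on UNIV (\<lambda>x::'a. weight (x \<bullet> x))" "continuous_on UNIV (\<lambda>x::'a. weight' (x \<bullet> x))"
    by (auto intro: continuous_at_imp_continuous_on)
qed

lemma integrable_continuous_annulus_support:
  fixes h :: "'a::euclidean_space \<Rightarrow> real"
  assumes "continuous_on UNIV h" "\<And>x. x \<notin> annulus \<Longrightarrow> h x = 0"
  shows "integrable lborel h"
  using assms by (intro integrable_continuous_compact_support[where R = 2]) (auto simp: annulus_def)

lemma integrable_weight:
  fixes h :: "'a::euclidean_space \<Rightarrow> real"
  assumes "continuous_on UNIV h"
  shows "integrable lborel (\<lambda>x. h x * weight (x \<bullet> x))" "integrable lborel (\<lambda>x. h x * weight' (x \<bullet> x))"
  by (auto intro!: integrable_continuous_annulus_support continuous_intros assms continuous_weight simp: weight_eq_0)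

text \<open>On the shell 2 <= |x|^2 < 3 one has (\<rho> - 1)(4 - \<rho>) = 2 + (\<rho> - 2)(3 -
  \<rho>) >= 2, so the weight is at least 4 there.\<close>

lemma integral_weight_pos:
  fixes m :: nat
  assumes m: "DIM('a::euclidean_space) = 2 * m"
  shows "0 < (\<integral>(x::'a). weight (x \<bullet> x) \<partial>lborel)"
proof -
  have m0: "0 < m" using m DIM_positive[where 'a='a] by simp
  have int: "integrable lborel (\<lambda>x::'a. 4 * (trunc 3 (\<lambda>_. 1) (x \<bullet> x) - trunc 2 (\<lambda>_. 1) (x \<bullet> x)))"
    by (intro integrable_mult_right Bochner_Integration.integrable_diff integral_trunc_one(1)[OF m]) auto
  have "0 < 4 * (unit_ball_vol (2 * m) * 3 ^ m - unit_ball_vol (2 * m) * 2 ^ m)"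
    using m0 by (simp add: power_strict_mono)
  also have "\<dots> = (\<integral>(x::'a). 4 * (trunc 3 (\<lambda>_. 1) (x \<bullet> x) - trunc 2 (\<lambda>_. 1) (x \<bullet> x)) \<partial>lborel)"
    by (simp add: integral_trunc_one[OF m])
  also have "\<dots> \<le> (\<integral>(x::'a). weight (x \<bullet> x) \<partial>lborel)"
  proof (rule integral_mono[OF int])
    show "integrable lborel (\<lambda>x::'a. weight (x \<bullet> x))"
      using integrable_weight(1)[of "\<lambda>_. 1"] by simp
    show "4 * (trunc 3 (\<lambda>_. 1) (x \<bullet> x) - trunc 2 (\<lambda>_. 1) (x \<bullet> x)) \<le> weight (x \<bullet> x)" for x :: 'a
    proof (cases "2 \<le> x \<bullet> x \<and> x \<bullet> x < 3")
      case True
      define t where "t = (x \<bullet> x - 1) * (4 - x \<bullet> x)"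
      have "0 \<le> (x \<bullet> x - 2) * (3 - x \<bullet> x)" using True by (intro mult_nonneg_nonneg) auto
      then have t: "2 \<le> t" by (simp add: t_def algebra_simps)
      then have "2\<^sup>2 \<le> t\<^sup>2" by (intro power_mono) auto
      moreover have "(x \<bullet> x - 1) * (x \<bullet> x - 4) = - t" by (simp add: t_def algebra_simps)
      ultimately show ?thesis using True t by (simp add: weight_def trunc_def)
    next
      case False
      then have "trunc 3 (\<lambda>_. 1) (x \<bullet> x) - trunc 2 (\<lambda>_. 1) (x \<bullet> x) = (0::real)"
        by (auto simp: trunc_def)
      then show ?thesis using weight_nonneg by simp
    qed
  qed
  finally show ?thesis .
qed

text \<open>The divergence theorem for weight (|x|^2) x: each of the 2 m coordinates contributes
  minus one half of the integral of the weight.\<close>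

lemma integral_weight':
  fixes m :: nat
  assumes m: "DIM('a::euclidean_space) = 2 * m"
  shows "(\<integral>(x::'a). (x \<bullet> x) * weight' (x \<bullet> x) \<partial>lborel) = - real m * (\<integral>(x::'a). weight (x \<bullet> x) \<partial>lborel)"
proof -
  let ?Q = "\<integral>(x::'a). weight (x \<bullet> x) \<partial>lborel"
  have 1: "(\<integral>(x::'a). (x \<bullet> b) * (x \<bullet> b) * weight' (x \<bullet> x) \<partial>lborel) = - ?Q / 2" if b: "b \<in> Basis" for b :: 'a
  proof -
    have "(\<integral>(x::'a). (x \<bullet> b) * (((2 * weight' (x \<bullet> x)) *\<^sub>R x) \<bullet> b) \<partial>lborel) = - (\<integral>(x::'a). (b \<bullet> b) * weight (x \<bullet> x) \<partial>lborel)"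
    proof (rule integral_by_parts_directional[where R = 2])
      show "GDERIV (\<lambda>x::'a. weight (x \<bullet> x)) x :> (2 * weight' (x \<bullet> x)) *\<^sub>R x" for x
        by (rule GDERIV_radial[where G' = weight']) (rule DERIV_weight)
      show "weight (x \<bullet> x) = 0" if "x \<notin> cball 0 2" for x :: 'a
        using that by (intro weight_eq_0) (auto simp: annulus_def)
    qed (use b in \<open>auto intro!: GDERIV_inner_left continuous_intros continuous_weight\<close>)
    moreover have "(\<integral>(x::'a). (x \<bullet> b) * (((2 * weight' (x \<bullet> x)) *\<^sub>R x) \<bullet> b) \<partial>lborel)
        = 2 * (\<integral>(x::'a). (x \<bullet> b) * (x \<bullet> b) * weight' (x \<bullet> x) \<partial>lborel)"
      by (subst integral_mult_right_zero[symmetric]) (simp add: ac_simps)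
    ultimately show ?thesis using b by simp
  qed
  have i: "integrable lborel (\<lambda>x::'a. (x \<bullet> b) * (x \<bullet> b) * weight' (x \<bullet> x))" for b
    by (intro integrable_weight continuous_intros)
  have "(\<integral>(x::'a). (x \<bullet> x) * weight' (x \<bullet> x) \<partial>lborel)
      = (\<integral>(x::'a). (\<Sum>b\<in>Basis. (x \<bullet> b) * (x \<bullet> b) * weight' (x \<bullet> x)) \<partial>lborel)"
    by (simp add: sum_Basis_inner_mult flip: sum_distrib_right)
  also have "\<dots> = (\<Sum>b\<in>(Basis::'a set). - ?Q / 2)"
    using i by (subst Bochner_Integration.integral_sum) (simp_all add: 1)
  also have "\<dots> = - real m * ?Q" by (simp add: m)
  finally show ?thesis .
qed

text \<open>Pointwise cost of replacing the rescaled gradient V by its model V0 and the cut-off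
  \<theta> by 1 in the tested curvature. Only first powers of 1 - \<theta> and at most second powers
  of \<xi> occur, which are the quantities known to vanish in the mean.\<close>

lemma perturbation_bound:
  fixes V \<xi> G V0 :: "'a::real_inner" and \<theta> \<psi> \<kappa> M a :: real
  assumes V: "V = V0 + \<xi>" and \<theta>: "0 \<le> \<theta>" "\<theta> \<le> 1" and \<psi>: "0 \<le> \<psi>" "\<psi> \<le> M" and G: "norm G \<le> M"
    and V0: "norm V0 \<le> a" and \<kappa>: "0 \<le> \<kappa>"
  shows "\<bar>(\<theta> * (G \<bullet> V) - (2 * (1 - \<theta>) + \<kappa>) * \<psi> * \<theta> * (norm V)\<^sup>2) - (G \<bullet> V0 - \<kappa> * \<psi> * (norm V0)\<^sup>2)\<bar>
    \<le> M * (1 + a + (2 + \<kappa>) * (1 + 2 * a + a\<^sup>2)) * (norm \<xi> + (norm \<xi>)\<^sup>2 + (1 - \<theta>))"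
proof -
  define x where "x = norm \<xi>"
  define t where "t = 1 - \<theta>"
  have x: "0 \<le> x" and t: "0 \<le> t" "t \<le> 1" and a: "0 \<le> a" and M: "0 \<le> M"
    using \<theta> order_trans[OF norm_ge_zero V0] order_trans[OF \<psi>] by (simp_all add: x_def t_def)
  define E where "E = 2 * (V0 \<bullet> \<xi>) + (norm \<xi>)\<^sup>2"
  have nV: "(norm V)\<^sup>2 = (norm V0)\<^sup>2 + E"
    by (simp add: V E_def power2_norm_eq_inner inner_add_left inner_add_right inner_commute)
  have "\<bar>V0 \<bullet> \<xi>\<bar> \<le> a * x"
    using V0 x by (intro order_trans[OF Cauchy_Schwarz_ineq2]) (auto simp: x_def intro!: mult_right_mono)
  moreover have "\<bar>E\<bar> \<le> 2 * \<bar>V0 \<bullet> \<xi>\<bar> + x\<^sup>2"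
    unfolding E_def x_def by (rule order_trans[OF abs_triangle_ineq]) simp
  ultimately have E: "\<bar>E\<bar> \<le> 2 * a * x + x\<^sup>2" by linarith
  have G1: "\<bar>G \<bullet> \<xi>\<bar> \<le> M * x"
    using G x by (intro order_trans[OF Cauchy_Schwarz_ineq2]) (auto simp: x_def intro!: mult_right_mono)
  have G2: "\<bar>G \<bullet> V0\<bar> \<le> M * a"
    using G V0 a M by (intro order_trans[OF Cauchy_Schwarz_ineq2] mult_mono) auto
  have v0: "(norm V0)\<^sup>2 \<le> a\<^sup>2" using V0 by (intro power_mono) auto
  \<comment> \<open>The last coefficient arises from (2 t + \<kappa>) \<theta> - \<kappa> = t (2
    \<theta> - \<kappa>) with t = 1 - \<theta>, so every term carries \<xi> or t.\<close>
  have eq: "(\<theta> * (G \<bullet> V) - (2 * (1 - \<theta>) + \<kappa>) * \<psi> * \<theta> * (norm V)\<^sup>2) - (G \<bullet> V0 - \<kappa> * \<psi> * (norm V0)\<^sup>2)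
    = \<theta> * (G \<bullet> \<xi>) - t * (G \<bullet> V0) - \<psi> * ((2 * t + \<kappa>) * \<theta> * E) - \<psi> * (t * (2 * \<theta> - \<kappa>) * (norm V0)\<^sup>2)"
    unfolding nV by (simp add: V t_def inner_add_right algebra_simps)
  have b1: "\<bar>\<theta> * (G \<bullet> \<xi>)\<bar> \<le> M * x"
    using \<theta> G1 mult_mono[OF \<theta>(2) G1] by (simp add: abs_mult)
  have b2: "\<bar>t * (G \<bullet> V0)\<bar> \<le> M * a * t"
    using t mult_left_mono[OF G2 t(1)] by (simp add: abs_mult mult.commute)
  have b3: "\<bar>\<psi> * ((2 * t + \<kappa>) * \<theta> * E)\<bar> \<le> M * ((2 + \<kappa>) * 1 * (2 * a * x + x\<^sup>2))"
    unfolding abs_mult using \<psi> t \<kappa> \<theta> E x a by (intro mult_mono) auto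
  have b4: "\<bar>\<psi> * (t * (2 * \<theta> - \<kappa>) * (norm V0)\<^sup>2)\<bar> \<le> M * (t * (2 + \<kappa>) * a\<^sup>2)"
    unfolding abs_mult using \<psi> t \<kappa> \<theta> v0 M by (intro mult_mono) auto
  have "\<bar>\<theta> * (G \<bullet> \<xi>) - t * (G \<bullet> V0) - \<psi> * ((2 * t + \<kappa>) * \<theta> * E) - \<psi> * (t * (2 * \<theta> - \<kappa>) * (norm V0)\<^sup>2)\<bar>
    \<le> M * x + M * a * t + M * ((2 + \<kappa>) * 1 * (2 * a * x + x\<^sup>2)) + M * (t * (2 + \<kappa>) * a\<^sup>2)"
    using b1 b2 b3 b4 by linarith
  also have "\<dots> = M * (x + a * t + (2 + \<kappa>) * (2 * a * x + x\<^sup>2 + a\<^sup>2 * t))"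
    by (simp add: algebra_simps)
  also have "\<dots> \<le> M * ((1 + a + (2 + \<kappa>) * (1 + 2 * a + a\<^sup>2)) * (x + x\<^sup>2 + t))"
  proof (rule mult_left_mono[OF _ M])
    have p: "0 \<le> a * x" "0 \<le> a * x\<^sup>2" "0 \<le> a * t" "0 \<le> a\<^sup>2 * x" "0 \<le> a\<^sup>2 * x\<^sup>2" "0 \<le> a\<^sup>2 * t" "0 \<le> x\<^sup>2"
      using x t a by simp_all
    have "2 * a * x + x\<^sup>2 + a\<^sup>2 * t \<le> (1 + 2 * a + a\<^sup>2) * (x + x\<^sup>2 + t)"
      using p x t by (simp add: algebra_simps)
    then have "(2 + \<kappa>) * (2 * a * x + x\<^sup>2 + a\<^sup>2 * t) \<le> (2 + \<kappa>) * ((1 + 2 * a + a\<^sup>2) * (x + x\<^sup>2 + t))"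
      using \<kappa> by (intro mult_left_mono) auto
    moreover have "x + a * t \<le> (1 + a) * (x + x\<^sup>2 + t)"
      using p x t by (simp add: algebra_simps)
    ultimately show "x + a * t + (2 + \<kappa>) * (2 * a * x + x\<^sup>2 + a\<^sup>2 * t) \<le> (1 + a + (2 + \<kappa>) * (1 + 2 * a + a\<^sup>2)) * (x + x\<^sup>2 + t)"
      by (simp add: distrib_right mult.assoc)
  qed
  finally show ?thesis unfolding eq by (simp add: x_def t_def mult.assoc)
qed

section \<open>The tested curvature and its limit\<close>

context nonneg_curvature_at_infinity
begin

definition \<kappa> :: real where "\<kappa> = real m - 1"

text \<open>This is exp (2 u) R_g / (2 (n-1)).\<close>

definition S :: "'a \<Rightarrow> real" where "S x = neg_laplacian u x - \<kappa> * (norm (gradient u x))\<^sup>2"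

text \<open>The cut-off in the size of \<open>u\<close>: multiplying by \<open>\<theta>\<close> keeps \<open>r\<^sup>2 exp (2 u)\<close> bounded without any
  exponential integrability of \<open>u\<close>. The choice \<open>b = 0\<close> is no cut-off at all.\<close>

definition \<theta> :: "real \<Rightarrow> real \<Rightarrow> 'a \<Rightarrow> real" where
  "\<theta> b r x = 1 / (1 + b * exp (2 * u (r *\<^sub>R x)))"

text \<open>Since 1 - \<theta> = y/(1 + y) with y = b exp (2 u), smallness of this integral
  expresses smallness of y in measure on the annulus.\<close>

definition \<Theta> :: "real \<Rightarrow> real \<Rightarrow> real" where
  "\<Theta> b r = (\<integral>x. indicator annulus x * (1 - \<theta> b r x) \<partial>lborel)"

text \<open>The factor \<open>x \<bullet> x\<close> offsets the homogeneity |x|^(-2) of the model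
  value of r^2 S (r x), which makes the expected limit a multiple of the integral of the
  weight.\<close>

definition N :: "real \<Rightarrow> real \<Rightarrow> real" where
  "N b r = (\<integral>x. (x \<bullet> x) * weight (x \<bullet> x) * \<theta> b r x * (r\<^sup>2 * S (r *\<^sub>R x)) \<partial>lborel)"

text \<open>The value of \<open>N\<close> for u = -\<alpha> log|x| without cut-off, where S =
  \<kappa> \<alpha> (2 - \<alpha>)/|x|^2.\<close>

definition J :: real where
  "J = \<kappa> * (\<alpha> * (2 - \<alpha>)) * (\<integral>(x::'a). weight (x \<bullet> x) \<partial>lborel)"

lemma \<kappa>_pos: "0 < \<kappa>"
  using m2 by (simp add: \<kappa>_def)

lemma \<theta>_denominator: "0 \<le> b \<Longrightarrow> 0 < 1 + b * exp (2 * t)" for b t :: real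
  by (simp add: add_pos_nonneg)

lemma \<theta>_bounds: "0 \<le> b \<Longrightarrow> 0 \<le> \<theta> b r x" "0 \<le> b \<Longrightarrow> \<theta> b r x \<le> 1"
  using \<theta>_denominator[of b "u (r *\<^sub>R x)"] by (simp_all add: \<theta>_def divide_le_eq_1)

lemma continuous_\<theta>:
  assumes "0 \<le> b"
  shows "continuous_on T (\<theta> b r)"
proof -
  have "1 + b * exp (2 * u (r *\<^sub>R x)) \<noteq> 0" for x
    using \<theta>_denominator[OF assms, of "u (r *\<^sub>R x)"] by simp
  then show ?thesis
    unfolding \<theta>_def[abs_def] by (intro continuous_intros continuous_scaled) auto
qed

text \<open>The logistic identity: \<theta> is a logistic function of u, so its derivative is
  bounded and small wherever 1 - \<theta> is small.\<close>

lemma GDERIV_\<theta>: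
  assumes "0 \<le> b"
  shows "GDERIV (\<theta> b r) x :> (- 2 * \<theta> b r x * (1 - \<theta> b r x)) *\<^sub>R (r *\<^sub>R gradient u (r *\<^sub>R x))"
proof -
  define y where "y = b * exp (2 * u (r *\<^sub>R x))"
  have pos: "0 < 1 + y" using \<theta>_denominator[OF assms] by (simp add: y_def)
  have 1: "GDERIV (\<lambda>x. u (r *\<^sub>R x)) x :> r *\<^sub>R gradient u (r *\<^sub>R x)"
    using GDERIV_scale[OF smooth_GDERIV[OF smooth_u, of "r *\<^sub>R x"], where s = 1] by simp
  have "((\<lambda>t. 1 / (1 + b * exp (2 * t))) has_real_derivative - (2 * y) / ((1 + y) * (1 + y))) (at (u (r *\<^sub>R x)))"
    using pos by (auto intro!: derivative_eq_intros simp: y_def)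
  also have "- (2 * y) / ((1 + y) * (1 + y)) = - 2 * \<theta> b r x * (1 - \<theta> b r x)"
    using pos by (simp add: \<theta>_def field_simps flip: y_def)
  finally have "GDERIV (\<lambda>x. 1 / (1 + b * exp (2 * u (r *\<^sub>R x)))) x :> (- 2 * \<theta> b r x * (1 - \<theta> b r x)) *\<^sub>R (r *\<^sub>R gradient u (r *\<^sub>R x))"
    by (rule GDERIV_DERIV_compose[OF 1])
  then show ?thesis unfolding \<theta>_def[abs_def] .
qed

lemma continuous_S: "continuous_on UNIV S"
  unfolding S_def[abs_def]
  by (intro continuous_intros smooth_continuous_on smooth_neg_laplacian smooth_continuous_on_gradient smooth_u)

lemma continuous_scaled_gradient: "continuous_on UNIV (\<lambda>x. r *\<^sub>R gradient u (r *\<^sub>R x))"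
  by (intro continuous_intros continuous_on_compose2[OF smooth_continuous_on_gradient[OF smooth_u, of UNIV]]) auto

text \<open>One integration by parts removes the second derivatives of u, for which no convergence
  is available. The derivative of \<theta> adds 2 (1 - \<theta>) to the coefficient \<kappa> of the
  quadratic term.\<close>

lemma N_eq:
  assumes b: "0 \<le> b"
  shows "N b r = (\<integral>x. \<theta> b r x * (((2 * (weight (x \<bullet> x) + (x \<bullet> x) * weight' (x \<bullet> x))) *\<^sub>R x) \<bullet> (r *\<^sub>R gradient u (r *\<^sub>R x)))
    - (2 * (1 - \<theta> b r x) + \<kappa>) * ((x \<bullet> x) * weight (x \<bullet> x)) * \<theta> b r x * (norm (r *\<^sub>R gradient u (r *\<^sub>R x)))\<^sup>2 \<partial>lborel)"
proof -
  define V where "V x = r *\<^sub>R gradient u (r *\<^sub>R x)" for x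
  define G where "G x = (2 * (weight (x \<bullet> x) + (x \<bullet> x) * weight' (x \<bullet> x))) *\<^sub>R x" for x :: 'a
  define \<psi> where "\<psi> x = (x \<bullet> x) * weight (x \<bullet> x)" for x :: 'a
  define \<Phi>' where "\<Phi>' x = \<psi> x *\<^sub>R ((- 2 * \<theta> b r x * (1 - \<theta> b r x)) *\<^sub>R V x) + \<theta> b r x *\<^sub>R G x" for x
  define g where "g x = u (r *\<^sub>R x)" for x
  have g: "smooth g" unfolding g_def by (rule smooth_scale[OF smooth_u])
  have gV: "gradient g x = V x" for x unfolding g_def V_def by (rule gradient_scale[OF smooth_u])
  have cV: "continuous_on UNIV V" unfolding V_def by (rule continuous_scaled_gradient)
  have c\<theta>: "continuous_on UNIV (\<theta> b r)" by (rule continuous_\<theta>[OF b])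
  have cG: "continuous_on UNIV G" unfolding G_def by (intro continuous_intros continuous_weight)
  have c\<psi>: "continuous_on UNIV \<psi>" unfolding \<psi>_def by (intro continuous_intros continuous_weight)
  have "((\<lambda>\<rho>. \<rho> * weight \<rho>) has_real_derivative (weight \<rho> + \<rho> * weight' \<rho>)) (at \<rho>)" for \<rho>
    by (auto intro!: derivative_eq_intros DERIV_weight)
  then have G\<psi>: "GDERIV \<psi> x :> G x" for x
    unfolding \<psi>_def[abs_def] G_def by (rule GDERIV_radial[where G = "\<lambda>\<rho>. \<rho> * weight \<rho>"])
  have \<psi>0: "\<psi> x = 0" if "x \<notin> annulus" for x using weight_eq_0[OF that] by (simp add: \<psi>_def)
  have G0: "G x = 0" if "x \<notin> annulus" for x using weight_eq_0[OF that] by (simp add: G_def)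
  have main: "(\<integral>x. neg_laplacian g x * (\<psi> x * \<theta> b r x) \<partial>lborel) = (\<integral>x. gradient g x \<bullet> \<Phi>' x \<partial>lborel)"
  proof (rule integral_neg_laplacian_mult[OF g, where R = 2])
    show "GDERIV (\<lambda>x. \<psi> x * \<theta> b r x) x :> \<Phi>' x" for x
      unfolding \<Phi>'_def V_def by (rule GDERIV_mult[OF G\<psi> GDERIV_\<theta>[OF b]])
    show "continuous_on UNIV \<Phi>'"
      unfolding \<Phi>'_def by (intro continuous_intros c\<psi> c\<theta> cV cG)
    show "\<psi> x * \<theta> b r x = 0" if "x \<notin> cball 0 2" for x
      using \<psi>0[of x] that by (auto simp: annulus_def)
  qed
  have i1: "integrable lborel (\<lambda>x. neg_laplacian g x * (\<psi> x * \<theta> b r x))"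
    by (rule integrable_continuous_annulus_support)
      (auto simp: \<psi>0 intro!: continuous_intros c\<psi> c\<theta> smooth_continuous_on[OF smooth_neg_laplacian[OF g]])
  have i2: "integrable lborel (\<lambda>x. \<kappa> * \<psi> x * \<theta> b r x * (norm (V x))\<^sup>2)"
    by (rule integrable_continuous_annulus_support) (auto simp: \<psi>0 intro!: continuous_intros c\<psi> c\<theta> cV)
  have i3: "integrable lborel (\<lambda>x. gradient g x \<bullet> \<Phi>' x)"
    unfolding gV by (rule integrable_continuous_annulus_support)
      (auto simp: \<psi>0 G0 \<Phi>'_def intro!: continuous_intros c\<psi> c\<theta> cV cG)
  have "N b r = (\<integral>x. neg_laplacian g x * (\<psi> x * \<theta> b r x) - \<kappa> * \<psi> x * \<theta> b r x * (norm (V x))\<^sup>2 \<partial>lborel)"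
    unfolding N_def g_def neg_laplacian_scale[OF smooth_u]
    by (intro Bochner_Integration.integral_cong) (simp_all add: S_def V_def \<psi>_def power_mult_distrib algebra_simps)
  also have "\<dots> = (\<integral>x. gradient g x \<bullet> \<Phi>' x - \<kappa> * \<psi> x * \<theta> b r x * (norm (V x))\<^sup>2 \<partial>lborel)"
    using main i1 i2 i3 by simp
  also have "\<dots> = (\<integral>x. \<theta> b r x * (G x \<bullet> V x) - (2 * (1 - \<theta> b r x) + \<kappa>) * \<psi> x * \<theta> b r x * (norm (V x))\<^sup>2 \<partial>lborel)"
    unfolding gV \<Phi>'_def power2_norm_eq_inner
    by (intro Bochner_Integration.integral_cong) (simp_all add: inner_add_right inner_commute algebra_simps)
  finally show ?thesis unfolding G_def V_def \<psi>_def .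
qed

text \<open>\<open>K\<close> depends on neither \<open>b\<close> nor \<open>r\<close>, so the
  cut-off parameter may vary with the radius.\<close>

lemma N_approx: "\<exists>K. \<forall>b r. 0 \<le> b \<longrightarrow> \<bar>N b r - J\<bar> \<le> K * (\<epsilon>1 r + \<epsilon>2 r + \<Theta> b r)"
proof -
  define G where "G x = (2 * (weight (x \<bullet> x) + (x \<bullet> x) * weight' (x \<bullet> x))) *\<^sub>R x" for x :: 'a
  define \<psi> where "\<psi> x = (x \<bullet> x) * weight (x \<bullet> x)" for x :: 'a
  define V0 where "V0 x = - \<alpha> *\<^sub>R kelvin x" for x :: 'a
  have cG: "continuous_on UNIV G" unfolding G_def by (intro continuous_intros continuous_weight)
  have c\<psi>: "continuous_on UNIV \<psi>" unfolding \<psi>_def by (intro continuous_intros continuous_weight)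
  have \<psi>0: "\<psi> x = 0" if "x \<notin> annulus" for x using weight_eq_0[OF that] by (simp add: \<psi>_def)
  have G0: "G x = 0" if "x \<notin> annulus" for x using weight_eq_0[OF that] by (simp add: G_def)
  have nG: "continuous_on UNIV (\<lambda>x. norm (G x))" by (intro continuous_intros cG)
  obtain M1 where M1: "\<And>x. norm x \<le> 2 \<Longrightarrow> \<bar>norm (G x)\<bar> \<le> M1" using continuous_bounded_cball[OF nG] by blast
  obtain M2 where M2: "\<And>x. norm x \<le> 2 \<Longrightarrow> \<bar>\<psi> x\<bar> \<le> M2" using continuous_bounded_cball[OF c\<psi>] by blast
  define M where "M = max M1 M2"
  define K where "K = M * (1 + \<bar>\<alpha>\<bar> + (2 + \<kappa>) * (1 + 2 * \<bar>\<alpha>\<bar> + \<bar>\<alpha>\<bar>\<^sup>2))"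
  have J: "J = (\<integral>x. G x \<bullet> V0 x - \<kappa> * \<psi> x * (norm (V0 x))\<^sup>2 \<partial>lborel)"
  proof -
    \<comment> \<open>Integrated with \<open>integral_weight'\<close>, the terms linear in \<alpha>
      combine to 2 \<alpha> (m - 1) = 2 \<kappa> \<alpha>, which produces \<kappa> \<alpha> (2 -
      \<alpha>).\<close>
    have "G x \<bullet> V0 x - \<kappa> * \<psi> x * (norm (V0 x))\<^sup>2
      = - (2 * \<alpha> + \<kappa> * \<alpha>\<^sup>2) * weight (x \<bullet> x) - 2 * \<alpha> * ((x \<bullet> x) * weight' (x \<bullet> x))" for x
    proof (cases "x \<in> annulus")
      case True
      then have x0: "x \<noteq> 0" by (auto simp: annulus_def)
      have "G x \<bullet> V0 x = - \<alpha> * (2 * (weight (x \<bullet> x) + (x \<bullet> x) * weight' (x \<bullet> x)))"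
        using inner_kelvin_self[OF x0] by (simp add: G_def V0_def inner_commute)
      moreover have "\<psi> x * (norm (V0 x))\<^sup>2 = \<alpha>\<^sup>2 * weight (x \<bullet> x)"
        using x0 by (simp add: \<psi>_def V0_def power_mult_distrib norm_kelvin_squared)
      ultimately show ?thesis by (simp add: mult.assoc) (simp add: algebra_simps)
    qed (simp add: \<psi>0 G0 weight_eq_0)
    then have "(\<integral>x. G x \<bullet> V0 x - \<kappa> * \<psi> x * (norm (V0 x))\<^sup>2 \<partial>lborel)
      = (\<integral>(x::'a). - (2 * \<alpha> + \<kappa> * \<alpha>\<^sup>2) * weight (x \<bullet> x) - 2 * \<alpha> * ((x \<bullet> x) * weight' (x \<bullet> x)) \<partial>lborel)"
      by simp
    also have "\<dots> = - (2 * \<alpha> + \<kappa> * \<alpha>\<^sup>2) * (\<integral>(x::'a). weight (x \<bullet> x) \<partial>lborel) - 2 * \<alpha> * (\<integral>(x::'a). (x \<bullet> x) * weight' (x \<bullet> x) \<partial>lborel)"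
    proof (subst Bochner_Integration.integral_diff)
      show "integrable lborel (\<lambda>x::'a. - (2 * \<alpha> + \<kappa> * \<alpha>\<^sup>2) * weight (x \<bullet> x))"
        by (intro integrable_weight continuous_intros)
      show "integrable lborel (\<lambda>x::'a. 2 * \<alpha> * ((x \<bullet> x) * weight' (x \<bullet> x)))"
        by (intro integrable_mult_right integrable_weight continuous_intros)
    qed simp
    also have "\<dots> = J"
      unfolding integral_weight'[OF dim] J_def \<kappa>_def by (simp add: algebra_simps power2_eq_square)
    finally show ?thesis by simp
  qed
  have "\<bar>N b r - J\<bar> \<le> K * (\<epsilon>1 r + \<epsilon>2 r + \<Theta> b r)" if b: "0 \<le> b" for b r
  proof -
    define V where "V x = r *\<^sub>R gradient u (r *\<^sub>R x)" for x
    have cV: "continuous_on UNIV V" unfolding V_def by (rule continuous_scaled_gradient)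
    have c\<theta>: "continuous_on UNIV (\<theta> b r)" by (rule continuous_\<theta>[OF b])
    define I1 where "I1 x = \<theta> b r x * (G x \<bullet> V x) - (2 * (1 - \<theta> b r x) + \<kappa>) * \<psi> x * \<theta> b r x * (norm (V x))\<^sup>2" for x
    define I0 where "I0 x = G x \<bullet> V0 x - \<kappa> * \<psi> x * (norm (V0 x))\<^sup>2" for x
    have i1: "integrable lborel I1"
      unfolding I1_def by (rule integrable_continuous_annulus_support) (auto simp: \<psi>0 G0 intro!: continuous_intros c\<psi> c\<theta> cV cG)
    have i0: "integrable lborel I0"
    proof -
      have "continuous_on annulus (V0 :: 'a \<Rightarrow> 'a)"
        unfolding V0_def kelvin_def[abs_def] by (intro continuous_intros) (auto simp: annulus_def)
      then have "integrable lborel (\<lambda>x. indicator annulus x * I0 x)"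
        unfolding I0_def
        by (intro integrable_annulus continuous_intros continuous_on_subset[OF cG] continuous_on_subset[OF c\<psi>]) auto
      moreover have "(\<lambda>x. indicator annulus x * I0 x) = I0"
        by (auto simp: fun_eq_iff indicator_def I0_def \<psi>0 G0)
      ultimately show ?thesis by simp
    qed
    have bound: "\<bar>I1 x - I0 x\<bar> \<le> K * (indicator annulus x * norm (\<xi> r x) + indicator annulus x * (norm (\<xi> r x))\<^sup>2 + indicator annulus x * (1 - \<theta> b r x))" for x
    proof (cases "x \<in> annulus")
      case True
      have "\<psi> x \<le> M" "norm (G x) \<le> M" "0 \<le> \<psi> x"
        using M1[of x] M2[of x] True by (auto simp: M_def annulus_def \<psi>_def weight_nonneg abs_le_iff)
      moreover have "norm (V0 x) \<le> \<bar>\<alpha>\<bar>"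
      proof -
        have "1 \<le> x \<bullet> x" using True by (simp add: annulus_def norm_eq_sqrt_inner)
        then have "(norm (kelvin x))\<^sup>2 \<le> 1\<^sup>2" unfolding norm_kelvin_squared by (simp add: divide_le_eq_1)
        then have "norm (kelvin x) \<le> 1" by (rule power2_le_imp_le) simp
        then show ?thesis by (simp add: V0_def mult_left_le)
      qed
      moreover have "V x = V0 x + \<xi> r x" by (simp add: V_def V0_def \<xi>_def)
      ultimately show ?thesis
        using perturbation_bound[of "V x" "V0 x" "\<xi> r x" "\<theta> b r x" "\<psi> x" M "G x" "\<bar>\<alpha>\<bar>" \<kappa>] \<theta>_bounds[OF b] \<kappa>_pos True
        by (simp add: I1_def I0_def K_def)
    qed (simp add: I1_def I0_def \<psi>0 G0)
    have i\<theta>: "integrable lborel (\<lambda>x. indicator annulus x * (1 - \<theta> b r x))"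
      by (intro integrable_annulus continuous_intros continuous_\<theta> b)
    have "N b r - J = (\<integral>x. I1 x - I0 x \<partial>lborel)"
      using N_eq[OF b, of r] J i1 i0 by (simp add: I1_def[abs_def] I0_def[abs_def] G_def V_def \<psi>_def)
    then have "\<bar>N b r - J\<bar> \<le> (\<integral>x. \<bar>I1 x - I0 x\<bar> \<partial>lborel)"
      using integral_abs_bound by metis
    also have "\<dots> \<le> (\<integral>x. K * (indicator annulus x * norm (\<xi> r x) + indicator annulus x * (norm (\<xi> r x))\<^sup>2 + indicator annulus x * (1 - \<theta> b r x)) \<partial>lborel)"
      by (intro integral_mono bound integrable_abs Bochner_Integration.integrable_diff i1 i0 integrable_mult_right
          Bochner_Integration.integrable_add integrable_norm_\<xi> i\<theta>)
    also have "\<dots> = K * (\<epsilon>1 r + \<epsilon>2 r + \<Theta> b r)"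
      by (simp add: \<epsilon>1_def \<epsilon>2_def \<Theta>_def integrable_norm_\<xi> i\<theta>)
    finally show ?thesis .
  qed
  then show ?thesis by blast
qed

lemma N_tendsto:
  assumes "\<And>r. 0 \<le> b r" and "((\<lambda>r. \<Theta> (b r) r) \<longlongrightarrow> 0) at_top"
  shows "((\<lambda>r. N (b r) r) \<longlongrightarrow> J) at_top"
proof -
  obtain K where K: "\<And>b r. 0 \<le> b \<Longrightarrow> \<bar>N b r - J\<bar> \<le> K * (\<epsilon>1 r + \<epsilon>2 r + \<Theta> b r)"
    using N_approx by metis
  have "((\<lambda>r. K * (\<epsilon>1 r + \<epsilon>2 r + \<Theta> (b r) r)) \<longlongrightarrow> K * (0 + 0 + 0)) at_top"
    by (intro tendsto_intros \<epsilon>1_tendsto_0 \<epsilon>2_tendsto_0 assms)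
  then have lim: "((\<lambda>r. K * (\<epsilon>1 r + \<epsilon>2 r + \<Theta> (b r) r)) \<longlongrightarrow> 0) at_top"
    by simp
  have "((\<lambda>r. N (b r) r - J) \<longlongrightarrow> 0) at_top"
  proof (rule Lim_null_comparison[OF _ lim])
    show "eventually (\<lambda>r. norm (N (b r) r - J) \<le> K * (\<epsilon>1 r + \<epsilon>2 r + \<Theta> (b r) r)) at_top"
      using K[OF assms(1)] by simp
  qed
  then show ?thesis by (rule LIM_zero_cancel)
qed

lemma norm_scaled_annulus:
  assumes "x \<in> annulus" "max R 0 < r"
  shows "R < norm (r *\<^sub>R x)"
proof -
  have "r * 1 \<le> r * norm x" using assms by (intro mult_left_mono) (auto simp: annulus_def)
  moreover have "norm (r *\<^sub>R x) = r * norm x" "R < r" using assms(2) by auto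
  ultimately show ?thesis by linarith
qed

lemma S_nonneg:
  assumes "x \<in> annulus" "max R 0 < r"
  shows "0 \<le> S (r *\<^sub>R x)"
  using curvature[OF norm_scaled_annulus[OF assms]] by (simp add: S_def \<kappa>_def)

text \<open>Without cut-off (\<open>b = 0\<close>) the tested curvature is nonnegative for large r,
  and its limit is \<open>J\<close>.\<close>

lemma \<alpha>_bounds: "0 \<le> \<alpha> * (2 - \<alpha>)"
proof -
  have "((\<lambda>r. N 0 r) \<longlongrightarrow> J) at_top"
    by (rule N_tendsto) (simp_all add: \<Theta>_def \<theta>_def)
  moreover have "eventually (\<lambda>r. 0 \<le> N 0 r) at_top"
    using eventually_gt_at_top[of "max R 0"]
  proof eventually_elim
    case (elim r)
    show ?case
      unfolding N_def
    proof (intro integral_nonneg_AE AE_I2)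
      fix x :: 'a
      show "0 \<le> (x \<bullet> x) * weight (x \<bullet> x) * \<theta> 0 r x * (r\<^sup>2 * S (r *\<^sub>R x))"
        using S_nonneg[OF _ elim, of x] \<theta>_bounds[of 0] weight_nonneg
        by (cases "x \<in> annulus") (auto intro!: mult_nonneg_nonneg simp: weight_eq_0)
    qed
  qed
  ultimately have "0 \<le> J"
    by (rule tendsto_lowerbound) simp
  then show ?thesis
    using \<kappa>_pos integral_weight_pos[OF dim] by (simp add: J_def zero_le_mult_iff not_le[symmetric])
qed

text \<open>With b = r^2/\<beta> the product \<theta> r^2 exp (2 u) is \<beta> y/(1 + y) <= \<beta>
  for y = b exp (2 u), so the tested curvature is at most C \<beta> P. If \<theta> tends to 1 in
  measure the limit is still \<open>J\<close>, and \<beta> is arbitrary.\<close>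

lemma \<alpha>_upper:
  assumes S: "\<And>x. R < norm x \<Longrightarrow> S x \<le> C * exp (2 * u x)" and C: "0 \<le> C"
    and \<Theta>: "\<And>\<beta>. 0 < \<beta> \<Longrightarrow> ((\<lambda>r. \<Theta> (r\<^sup>2 / \<beta>) r) \<longlongrightarrow> 0) at_top"
  shows "\<alpha> * (2 - \<alpha>) \<le> 0"
proof -
  define P where "P = (\<integral>(x::'a). (x \<bullet> x) * weight (x \<bullet> x) \<partial>lborel)"
  have P: "0 \<le> P" unfolding P_def by (intro integral_nonneg_AE AE_I2) (simp add: weight_nonneg)
  have J_le: "J \<le> C * \<beta> * P" if \<beta>: "0 < \<beta>" for \<beta>
  proof -
    have "((\<lambda>r. N (r\<^sup>2 / \<beta>) r) \<longlongrightarrow> J) at_top"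
      using \<beta> \<Theta>[OF \<beta>] by (intro N_tendsto) simp_all
    moreover have "eventually (\<lambda>r. N (r\<^sup>2 / \<beta>) r \<le> C * \<beta> * P) at_top"
      using eventually_gt_at_top[of "max R 0"]
    proof eventually_elim
      case (elim r)
      have b: "0 \<le> r\<^sup>2 / \<beta>" using \<beta> by simp
      have "N (r\<^sup>2 / \<beta>) r \<le> (\<integral>(x::'a). C * \<beta> * ((x \<bullet> x) * weight (x \<bullet> x)) \<partial>lborel)"
        unfolding N_def
      proof (rule integral_mono)
        show "integrable lborel (\<lambda>x. (x \<bullet> x) * weight (x \<bullet> x) * \<theta> (r\<^sup>2 / \<beta>) r x * (r\<^sup>2 * S (r *\<^sub>R x)))"
          by (rule integrable_continuous_annulus_support)
            (auto simp: weight_eq_0 intro!: continuous_intros continuous_weight continuous_\<theta> b continuous_on_compose2[OF continuous_S])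
        show "integrable lborel (\<lambda>x::'a. C * \<beta> * ((x \<bullet> x) * weight (x \<bullet> x)))"
          by (intro integrable_mult_right integrable_weight continuous_intros)
        show "(x \<bullet> x) * weight (x \<bullet> x) * \<theta> (r\<^sup>2 / \<beta>) r x * (r\<^sup>2 * S (r *\<^sub>R x)) \<le> C * \<beta> * ((x \<bullet> x) * weight (x \<bullet> x))" for x
        proof (cases "x \<in> annulus")
          case True
          define E where "E = exp (2 * u (r *\<^sub>R x))"
          have "R < norm (r *\<^sub>R x)" using True elim by (rule norm_scaled_annulus)
          then have "r\<^sup>2 * S (r *\<^sub>R x) \<le> r\<^sup>2 * (C * E)" unfolding E_def by (intro mult_left_mono S) auto
          then have "\<theta> (r\<^sup>2 / \<beta>) r x * (r\<^sup>2 * S (r *\<^sub>R x)) \<le> \<theta> (r\<^sup>2 / \<beta>) r x * (r\<^sup>2 * (C * E))"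
            by (rule mult_left_mono[OF _ \<theta>_bounds(1)[OF b]])
          also have "\<dots> = C * \<beta> * (r\<^sup>2 / \<beta> * E / (1 + r\<^sup>2 / \<beta> * E))"
            using \<beta> by (simp add: \<theta>_def E_def)
          also have "\<dots> \<le> C * \<beta> * 1"
          proof (intro mult_left_mono)
            have "0 \<le> r\<^sup>2 / \<beta> * E" using \<beta> by (simp add: E_def)
            moreover have "y / (1 + y) \<le> 1" if "0 \<le> y" for y :: real
              using that by (simp add: divide_le_eq_1)
            ultimately show "r\<^sup>2 / \<beta> * E / (1 + r\<^sup>2 / \<beta> * E) \<le> 1" by blast
          qed (use C \<beta> in simp)
          finally have "(x \<bullet> x) * weight (x \<bullet> x) * (\<theta> (r\<^sup>2 / \<beta>) r x * (r\<^sup>2 * S (r *\<^sub>R x))) \<le> (x \<bullet> x) * weight (x \<bullet> x) * (C * \<beta> * 1)"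
            by (intro mult_left_mono) (simp_all add: weight_nonneg)
          then show ?thesis by (simp add: ac_simps)
        qed (simp add: weight_eq_0)
      qed
      then show ?case by (simp add: P_def)
    qed
    ultimately show ?thesis
      by (rule tendsto_upperbound) simp
  qed
  have "J \<le> 0"
  proof (rule ccontr)
    assume "\<not> J \<le> 0"
    then have J: "0 < J" by simp
    \<comment> \<open>Chosen so that C \<beta> P is at most J / 2; the summand 1 covers the case C P
      = 0.\<close>
    define \<beta> where "\<beta> = J / (2 * (C * P + 1))"
    have CP: "0 \<le> C * P" using C P by simp
    then have "0 < \<beta>" using J by (simp add: \<beta>_def add_nonneg_pos)
    from J_le[OF this] have "J \<le> \<beta> * (C * P)" by (simp add: ac_simps)
    also have "\<dots> \<le> \<beta> * (C * P + 1)" using \<open>0 < \<beta>\<close> by simp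
    also have "\<dots> = J / 2" using CP by (simp add: \<beta>_def field_simps)
    finally show False using J by simp
  qed
  then show ?thesis
    using \<kappa>_pos integral_weight_pos[OF dim] by (simp add: J_def mult_le_0_iff)
qed

end

section \<open>Smallness of r^2 exp (2 u) in measure\<close>

context nonneg_curvature_at_infinity
begin

text \<open>The g-volume of the region r <= |y| <= 2 r, pulled back to the fixed annulus.\<close>

definition volume :: "real \<Rightarrow> real" where
  "volume r = (\<integral>x. indicator annulus x * (r ^ (2 * m) * exp (real (2 * m) * u (r *\<^sub>R x))) \<partial>lborel)"

lemma one_minus_\<theta>:
  assumes "0 \<le> b"
  shows "1 - \<theta> b r x = b * exp (2 * u (r *\<^sub>R x)) / (1 + b * exp (2 * u (r *\<^sub>R x)))"
  using \<theta>_denominator[OF assms, of "u (r *\<^sub>R x)"] by (simp add: \<theta>_def field_simps)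

lemma one_minus_\<theta>_le:
  assumes "0 \<le> b"
  shows "1 - \<theta> b r x \<le> b * exp (2 * u (r *\<^sub>R x))"
proof -
  have "y / (1 + y) \<le> y" if "0 \<le> y" for y :: real
    using that by (simp add: divide_le_eq mult_nonneg_nonneg distrib_left)
  then show ?thesis unfolding one_minus_\<theta>[OF assms] using assms by simp
qed

lemma integrable_one_minus_\<theta>:
  "0 \<le> b \<Longrightarrow> integrable lborel (\<lambda>x. indicator annulus x * (1 - \<theta> b r x))"
  by (intro integrable_annulus continuous_intros continuous_\<theta>)

lemma integrable_indicator_annulus: "integrable lborel (indicator annulus :: 'a \<Rightarrow> real)"
  using emeasure_annulus by (intro integrable_real_indicator) auto

lemma \<Theta>_nonneg: "0 \<le> b \<Longrightarrow> 0 \<le> \<Theta> b r"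
  unfolding \<Theta>_def using \<theta>_bounds(2) by (intro integral_nonneg_AE AE_I2 mult_nonneg_nonneg) auto

text \<open>Put w = u (r x) + \<alpha> ln r and k = (\<alpha> - 1) ln r. Where |w| <= k/2, r^2 exp
  (2 u) = exp (2 w - 2 k) <= exp (- k); elsewhere 1 - \<theta> <= 1 <= 2 |w|/k, as in Chebyshev's
  inequality. Both contributions vanish, the second because \<open>L r\<close> is o(ln r).\<close>

lemma \<Theta>_tendsto_0_of_decay:
  assumes \<alpha>: "1 < \<alpha>" and \<beta>: "0 < \<beta>"
  shows "((\<lambda>r. \<Theta> (r\<^sup>2 / \<beta>) r) \<longlongrightarrow> 0) at_top"
proof -
  let ?A = "measure lborel (annulus :: 'a set)"
  have b: "0 \<le> r\<^sup>2 / \<beta>" for r using \<beta> by simp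
  have est: "\<Theta> (r\<^sup>2 / \<beta>) r \<le> exp (- ((\<alpha> - 1) * ln r)) / \<beta> * ?A + 2 / (\<alpha> - 1) * (L r / ln r)" if r: "1 < r" for r
  proof -
    define k where "k = (\<alpha> - 1) * ln r"
    have k: "0 < k" using \<alpha> r by (simp add: k_def)
    define w where "w x = u (r *\<^sub>R x) + \<alpha> * ln r" for x
    have pt: "indicator annulus x * (1 - \<theta> (r\<^sup>2 / \<beta>) r x)
      \<le> exp (- k) / \<beta> * indicator annulus x + 2 / k * (indicator annulus x * \<bar>w x\<bar>)" for x
    proof (cases "x \<in> annulus")
      case True
      show ?thesis
      proof (cases "\<bar>w x\<bar> \<le> k / 2")
        case small: True
        have "r\<^sup>2 = exp (2 * ln r)" using r by (simp add: exp_double)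
        then have "r\<^sup>2 / \<beta> * exp (2 * u (r *\<^sub>R x)) = exp (2 * w x - 2 * k) / \<beta>"
          by (simp add: w_def k_def algebra_simps flip: exp_add)
        also have "\<dots> \<le> exp (- k) / \<beta>" using small \<beta> by (intro divide_right_mono) auto
        finally have "1 - \<theta> (r\<^sup>2 / \<beta>) r x \<le> exp (- k) / \<beta>"
          using one_minus_\<theta>_le[OF b[of r], of r x] by linarith
        then show ?thesis using True k by (simp add: add_increasing2)
      next
        case False
        then have "1 \<le> 2 / k * \<bar>w x\<bar>" using k by (simp add: field_simps)
        moreover have "1 - \<theta> (r\<^sup>2 / \<beta>) r x \<le> 1" using \<theta>_bounds(1)[OF b[of r], of r x] by simp
        moreover have "0 \<le> exp (- k) / \<beta>" using \<beta> by simp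
        ultimately show ?thesis using True by simp
      qed
    qed simp
    have "\<Theta> (r\<^sup>2 / \<beta>) r \<le> (\<integral>x. exp (- k) / \<beta> * indicator annulus x + 2 / k * (indicator annulus x * \<bar>w x\<bar>) \<partial>lborel)"
      unfolding \<Theta>_def w_def
      by (intro integral_mono integrable_one_minus_\<theta> b pt[unfolded w_def] Bochner_Integration.integrable_add integrable_mult_right
          integrable_indicator_annulus integrable_L)
    also have "\<dots> = exp (- k) / \<beta> * ?A + 2 / k * L r"
      unfolding w_def L_def using integrable_indicator_annulus integrable_L[of r]
      by (subst Bochner_Integration.integral_add) auto
    finally show ?thesis by (simp add: k_def)
  qed
  have "filterlim (\<lambda>r. (\<alpha> - 1) * ln r) at_top at_top"
    using \<alpha> by (intro filterlim_tendsto_pos_mult_at_top[OF tendsto_const] ln_at_top) simp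
  then have "((\<lambda>r. exp (- ((\<alpha> - 1) * ln r))) \<longlongrightarrow> 0) at_top"
    by (intro filterlim_compose[OF exp_at_bot]) (simp add: filterlim_uminus_at_top)
  then have "((\<lambda>r. exp (- ((\<alpha> - 1) * ln r)) / \<beta> * ?A + 2 / (\<alpha> - 1) * (L r / ln r)) \<longlongrightarrow> 0 / \<beta> * ?A + 2 / (\<alpha> - 1) * 0) at_top"
    using \<beta> by (intro tendsto_intros L_over_ln_tendsto_0) auto
  then have lim: "((\<lambda>r. exp (- ((\<alpha> - 1) * ln r)) / \<beta> * ?A + 2 / (\<alpha> - 1) * (L r / ln r)) \<longlongrightarrow> 0) at_top" by simp
  show ?thesis
  proof (rule tendsto_sandwich[OF _ _ tendsto_const lim])
    show "eventually (\<lambda>r. 0 \<le> \<Theta> (r\<^sup>2 / \<beta>) r) at_top" using \<Theta>_nonneg[OF b] by simp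
    show "eventually (\<lambda>r. \<Theta> (r\<^sup>2 / \<beta>) r \<le> exp (- ((\<alpha> - 1) * ln r)) / \<beta> * ?A + 2 / (\<alpha> - 1) * (L r / ln r)) at_top"
      using eventually_gt_at_top[of 1] by eventually_elim (rule est)
  qed
qed

lemma integrable_volume: "integrable lborel (\<lambda>x. indicator annulus x * (r ^ (2 * m) * exp (real (2 * m) * u (r *\<^sub>R x))))"
  by (intro integrable_annulus continuous_intros continuous_scaled)

text \<open>Every fixed point eventually lies inside the inner sphere of radius r, so dominated
  convergence applies with exp (n u) as majorant.\<close>

lemma volume_tendsto_0:
  assumes int: "integrable lborel (\<lambda>x. exp (real (2 * m) * u x))"
  shows "(volume \<longlongrightarrow> 0) at_top"
proof -
  define h where "h r y = indicator annulus (inverse r *\<^sub>R y) * exp (real (2 * m) * u y)" for r and y :: 'a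
  have [measurable]: "(\<lambda>x. exp (real (2 * m) * u x)) \<in> borel_measurable borel"
    using borel_measurable_integrable[OF int] by simp
  have [measurable]: "h r \<in> borel_measurable borel" for r
    unfolding h_def[abs_def] by measurable
  have eq: "(\<integral>y. h r y \<partial>lborel) = volume r" if "0 < r" for r
    using that by (subst lborel_integral_scale[OF _ that])
      (simp_all add: h_def volume_def dim ac_simps flip: integral_mult_right_zero)
  have "((\<lambda>r. \<integral>y. h r y \<partial>lborel) \<longlongrightarrow> (\<integral>(y::'a). 0 \<partial>lborel)) at_top"
  proof (rule integral_dominated_convergence_at_top[OF _ _ int])
    show "AE y in lborel. ((\<lambda>r. h r y) \<longlongrightarrow> 0) at_top"
    proof (rule AE_I2)
      fix y :: 'a
      have "eventually (\<lambda>r. 0 = h r y) at_top"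
        using eventually_gt_at_top[of "max 0 (norm y)"]
      proof eventually_elim
        case (elim r)
        then have "norm y < r" by simp
        moreover from this have "0 < r" using norm_ge_zero[of y] by linarith
        ultimately have "norm (inverse r *\<^sub>R y) < 1" by (simp add: field_simps)
        then have "inverse r *\<^sub>R y \<notin> annulus" unfolding annulus_def by simp
        then show ?case by (simp add: h_def)
      qed
      then show "((\<lambda>r. h r y) \<longlongrightarrow> 0) at_top" by (rule Lim_transform_eventually[OF tendsto_const])
    qed
    show "eventually (\<lambda>r. AE y in lborel. norm (h r y) \<le> exp (real (2 * m) * u y)) at_top"
      by (intro always_eventually allI AE_I2) (simp add: h_def indicator_def)
  qed simp_all
  then have lim: "((\<lambda>r. \<integral>y. h r y \<partial>lborel) \<longlongrightarrow> 0) at_top" by simp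
  have "eventually (\<lambda>r. (\<integral>y. h r y \<partial>lborel) = volume r) at_top"
    using eventually_gt_at_top[of 0] by eventually_elim (rule eq)
  then show ?thesis by (rule Lim_transform_eventually[OF lim])
qed

text \<open>With y = r^2 exp (2 u)/\<beta>, the m-th power of y is the volume density up to
  \<beta>^m. Hence 1 - \<theta> <= \<delta> + (y/\<delta>)^m: the first summand covers y <=
  \<delta>, the second exceeds 1 otherwise.\<close>

lemma \<Theta>_tendsto_0_of_finite_volume:
  assumes int: "integrable lborel (\<lambda>x. exp (real (2 * m) * u x))" and \<beta>: "0 < \<beta>"
  shows "((\<lambda>r. \<Theta> (r\<^sup>2 / \<beta>) r) \<longlongrightarrow> 0) at_top"
proof (rule tendstoI)
  fix e :: real assume e: "0 < e"
  define A where "A = measure lborel (annulus :: 'a set)"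
  have b: "0 \<le> r\<^sup>2 / \<beta>" for r using \<beta> by simp
  define \<delta> where "\<delta> = e / (2 * (A + 1))"
  have A: "0 \<le> A" by (simp add: A_def)
  then have \<delta>: "0 < \<delta>" "\<delta> * A < e / 2" using e by (auto simp: \<delta>_def field_simps)
  have est: "\<Theta> (r\<^sup>2 / \<beta>) r \<le> \<delta> * A + volume r / (\<delta> * \<beta>) ^ m" for r
  proof -
    have pt: "indicator annulus x * (1 - \<theta> (r\<^sup>2 / \<beta>) r x)
      \<le> \<delta> * indicator annulus x + 1 / (\<delta> * \<beta>) ^ m * (indicator annulus x * (r ^ (2 * m) * exp (real (2 * m) * u (r *\<^sub>R x))))" for x
    proof (cases "x \<in> annulus")
      case True
      define y where "y = r\<^sup>2 / \<beta> * exp (2 * u (r *\<^sub>R x))"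
      have y: "0 \<le> y" using \<beta> by (simp add: y_def)
      have ym: "1 / (\<delta> * \<beta>) ^ m * (r ^ (2 * m) * exp (real (2 * m) * u (r *\<^sub>R x))) = (y / \<delta>) ^ m"
      proof -
        have "exp (real (2 * m) * u (r *\<^sub>R x)) = exp (2 * u (r *\<^sub>R x)) ^ m"
          by (simp add: ac_simps flip: exp_of_nat_mult)
        moreover have "r ^ (2 * m) = (r\<^sup>2) ^ m" by (rule power_mult)
        ultimately show ?thesis
          by (simp only: y_def power_mult_distrib power_divide) (simp add: ac_simps)
      qed
      have "1 - \<theta> (r\<^sup>2 / \<beta>) r x \<le> \<delta> + (y / \<delta>) ^ m"
      proof (cases "y \<le> \<delta>")
        case small: True
        have "0 \<le> (y / \<delta>) ^ m" using y \<delta> by simp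
        then show ?thesis using one_minus_\<theta>_le[OF b[of r], of r x] small by (simp add: y_def)
      next
        case False
        then have "1 \<le> (y / \<delta>) ^ m" using \<delta> by (intro one_le_power) (simp add: field_simps)
        then show ?thesis using \<theta>_bounds(1)[OF b[of r], of r x] \<delta> by linarith
      qed
      then show ?thesis unfolding ym[symmetric] using True by simp
    qed simp
    have "\<Theta> (r\<^sup>2 / \<beta>) r \<le> (\<integral>x. \<delta> * indicator annulus x + 1 / (\<delta> * \<beta>) ^ m * (indicator annulus x * (r ^ (2 * m) * exp (real (2 * m) * u (r *\<^sub>R x)))) \<partial>lborel)"
      unfolding \<Theta>_def
      by (intro integral_mono integrable_one_minus_\<theta> b pt Bochner_Integration.integrable_add integrable_mult_right
          integrable_indicator_annulus integrable_volume)
    also have "\<dots> = \<delta> * A + 1 / (\<delta> * \<beta>) ^ m * volume r"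
    proof (subst Bochner_Integration.integral_add)
      show "integrable lborel (\<lambda>x. 1 / (\<delta> * \<beta>) ^ m * (indicator annulus x * (r ^ (2 * m) * exp (real (2 * m) * u (r *\<^sub>R x)))))"
        by (intro integrable_mult_right integrable_volume)
    qed (use integrable_indicator_annulus in \<open>simp_all only: A_def integrable_mult_right integral_mult_right_zero volume_def integral_indicator\<close>, simp)
    finally show ?thesis by simp
  qed
  have "((\<lambda>r. volume r / (\<delta> * \<beta>) ^ m) \<longlongrightarrow> 0 / (\<delta> * \<beta>) ^ m) at_top"
    using \<beta> \<delta> by (intro tendsto_intros volume_tendsto_0 int) auto
  then have "eventually (\<lambda>r. volume r / (\<delta> * \<beta>) ^ m < e / 2) at_top"
    by (rule order_tendstoD) (use e in simp)
  then show "eventually (\<lambda>r. dist (\<Theta> (r\<^sup>2 / \<beta>) r) 0 < e) at_top"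
  proof eventually_elim
    case (elim r)
    then have "\<Theta> (r\<^sup>2 / \<beta>) r < e" using est[of r] \<delta>(2) by linarith
    then show ?case using \<Theta>_nonneg[OF b[of r], of r] by simp
  qed
qed

text \<open>If \<alpha> = 0, then u (r x) is o(ln r) in the mean. Where |u (r x)| <= (ln r)/2 the
  density r^n exp (n u) is at least 1, and the remaining part of the annulus is controlled by L r /
  ln r; the volume of large annuli could then not tend to 0.\<close>

lemma \<alpha>_nonzero_of_finite_volume:
  assumes int: "integrable lborel (\<lambda>x. exp (real (2 * m) * u x))"
  shows "\<alpha> \<noteq> 0"
proof
  assume \<alpha>: "\<alpha> = 0"
  let ?A = "measure lborel (annulus :: 'a set)"
  have est: "?A \<le> volume r + 2 * (L r / ln r)" if r: "1 < r" for r
  proof -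
    have ln: "0 < ln r" using r by simp
    have pt: "indicator annulus x \<le> indicator annulus x * (r ^ (2 * m) * exp (real (2 * m) * u (r *\<^sub>R x)))
        + 2 / ln r * (indicator annulus x * \<bar>u (r *\<^sub>R x) + \<alpha> * ln r\<bar>)" for x
    proof (cases "x \<in> annulus")
      case True
      show ?thesis
      proof (cases "\<bar>u (r *\<^sub>R x)\<bar> \<le> ln r / 2")
        case small: True
        have "r ^ (2 * m) = exp (real (2 * m) * ln r)"
          using r by (metis exp_ln exp_of_nat_mult less_trans zero_less_one)
        then have "r ^ (2 * m) * exp (real (2 * m) * u (r *\<^sub>R x)) = exp (real (2 * m) * (ln r + u (r *\<^sub>R x)))"
          by (simp add: exp_add distrib_left)
        also have "\<dots> \<ge> 1"
        proof -
          have "0 \<le> real (2 * m) * (ln r + u (r *\<^sub>R x))" using small ln by (intro mult_nonneg_nonneg) auto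
          then show ?thesis by simp
        qed
        finally show ?thesis using True ln by (simp add: add_increasing2)
      next
        case False
        then have "1 \<le> 2 / ln r * \<bar>u (r *\<^sub>R x) + \<alpha> * ln r\<bar>" using ln \<alpha> by (simp add: field_simps)
        moreover have "0 \<le> r ^ (2 * m) * exp (real (2 * m) * u (r *\<^sub>R x))" using r by simp
        ultimately have "1 \<le> r ^ (2 * m) * exp (real (2 * m) * u (r *\<^sub>R x)) + 2 / ln r * \<bar>u (r *\<^sub>R x) + \<alpha> * ln r\<bar>"
          by linarith
        then show ?thesis using True by simp
      qed
    qed simp
    have "?A = (\<integral>(x::'a). indicator annulus x \<partial>lborel)" by simp
    also have "\<dots> \<le> (\<integral>x. indicator annulus x * (r ^ (2 * m) * exp (real (2 * m) * u (r *\<^sub>R x)))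
        + 2 / ln r * (indicator annulus x * \<bar>u (r *\<^sub>R x) + \<alpha> * ln r\<bar>) \<partial>lborel)"
      by (intro integral_mono pt Bochner_Integration.integrable_add integrable_mult_right
          integrable_indicator_annulus integrable_volume integrable_L)
    also have "\<dots> = volume r + 2 / ln r * L r"
      unfolding Bochner_Integration.integral_add[OF integrable_volume integrable_mult_right[OF integrable_L]]
      by (simp only: volume_def L_def integral_mult_right_zero)
    finally show ?thesis by simp
  qed
  have "((\<lambda>r. volume r + 2 * (L r / ln r)) \<longlongrightarrow> 0 + 2 * 0) at_top"
    by (intro tendsto_intros volume_tendsto_0 L_over_ln_tendsto_0 int)
  moreover have "eventually (\<lambda>r. ?A \<le> volume r + 2 * (L r / ln r)) at_top"
    using eventually_gt_at_top[of 1] by eventually_elim (rule est)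
  ultimately have "?A \<le> 0 + 2 * 0" by (rule tendsto_lowerbound) simp
  then have A0: "?A \<le> 0" by simp
  obtain b :: 'a where b: "b \<in> Basis" using nonempty_Basis by blast
  \<comment> \<open>A ball centred midway between the two bounding spheres shows that the annulus
    has positive measure.\<close>
  have "cball ((3 / 2) *\<^sub>R b) (1 / 4) \<subseteq> (annulus :: 'a set)"
  proof
    fix x assume "x \<in> cball ((3 / 2) *\<^sub>R b) (1 / 4)"
    then have "norm ((3 / 2) *\<^sub>R b - x) \<le> 1 / 4" by (simp add: dist_norm)
    moreover have "norm ((3 / 2) *\<^sub>R b) = 3 / 2" using b by simp
    ultimately show "x \<in> annulus"
      using norm_triangle_ineq2[of "(3 / 2) *\<^sub>R b" x] norm_triangle_ineq2[of x "(3 / 2) *\<^sub>R b"]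
      by (simp add: annulus_def norm_minus_commute)
  qed
  then have "measure lborel (cball ((3 / 2) *\<^sub>R b) (1 / 4)) \<le> ?A"
    using emeasure_annulus[where 'a='a] by (intro measure_mono_fmeasurable) (auto simp: fmeasurable_def)
  moreover have "0 < measure lborel (cball ((3 / 2) *\<^sub>R b) (1 / 4))"
    by (subst content_cball_gt_0_iff) simp
  ultimately show False using A0 by linarith
qed

end

section \<open>The possible values of the total Q-curvature\<close>

theorem theorem1p7:
  fixes u Q :: "real ^ 'n \<Rightarrow> real" and n :: nat
  assumes "n = CARD('n)" and "n \<ge> 4" and "even n"
    and "smooth u"
    and "\<forall>x. (neg_laplacian ^^ (n div 2)) u x = Q x * exp (real n * u x)"
    and "integrable lborel (\<lambda>x. Q x * exp (real n * u x))"
  shows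
    "((\<exists>C>0. \<exists>K. compact K \<and> (\<forall>x. x \<notin> K \<longrightarrow> 0 \<le> scalar_curvature u x \<and> scalar_curvature u x \<le> C))
      \<longrightarrow> (0 \<le> (\<integral>x. Q x * exp (real n * u x) \<partial>lborel) \<and>
           (\<integral>x. Q x * exp (real n * u x) \<partial>lborel)
             \<le> fact (n - 1) * unit_sphere_measure (sphere (0 :: (real ^ 'n) \<times> real) 1) / 2)
        \<or> (\<integral>x. Q x * exp (real n * u x) \<partial>lborel)
             = fact (n - 1) * unit_sphere_measure (sphere (0 :: (real ^ 'n) \<times> real) 1))
     \<and> ((\<exists>C>0. \<exists>K. compact K \<and> (\<forall>x. x \<notin> K \<longrightarrow> 0 \<le> scalar_curvature u x \<and> scalar_curvature u x \<le> C))
          \<and> integrable lborel (\<lambda>x. exp (real n * u x))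
      \<longrightarrow> (\<integral>x. Q x * exp (real n * u x) \<partial>lborel)
             = fact (n - 1) * unit_sphere_measure (sphere (0 :: (real ^ 'n) \<times> real) 1))"
proof -
  obtain m where n: "n = 2 * m" using assms(3) by blast
  have m: "DIM(real ^ 'n) = 2 * m" "2 \<le> m" using assms(1,2) n by simp_all
  define I where "I = (\<integral>x. Q x * exp (real n * u x) \<partial>lborel)"
  define s where "s = fact (n - 1) * unit_sphere_measure (sphere (0 :: (real ^ 'n) \<times> real) 1)"
  have f: "(neg_laplacian ^^ m) u = (\<lambda>x. Q x * exp (real n * u x))"
    using assms(5) n by auto
  have key: "((0 \<le> I \<and> I \<le> s / 2) \<or> I = s) \<and> (integrable lborel (\<lambda>x. exp (real n * u x)) \<longrightarrow> I = s)"
    if C: "0 < C" and K: "compact K" and curv: "\<And>x. x \<notin> K \<Longrightarrow> 0 \<le> scalar_curvature u x \<and> scalar_curvature u x \<le> C"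
    for C K
  proof -
    obtain R where R: "\<And>x. x \<in> K \<Longrightarrow> norm x \<le> R"
      using compact_imp_bounded[OF K] unfolding bounded_iff by blast
    \<comment> \<open>Multiplying by exp (2 u) turns both curvature bounds into bounds on the
      expression in the locale; the upper one becomes a multiple of exp (2 u).\<close>
    have sc: "scalar_curvature u x * exp (2 * u x) = 2 * (real n - 1) * (neg_laplacian u x - (real m - 1) * (norm (gradient u x))\<^sup>2)" for x
      using m(1) n by (simp add: scalar_curvature_def neg_laplacian_def exp_minus field_simps)
    have n1: "0 < 2 * (real n - 1)" using assms(2) by simp
    have lower: "0 \<le> neg_laplacian u x - (real m - 1) * (norm (gradient u x))\<^sup>2" if "R < norm x" for x
    proof -
      have "x \<notin> K" using R[of x] that by auto
      then have "0 \<le> scalar_curvature u x * exp (2 * u x)" using curv by simp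
      then show ?thesis unfolding sc using n1 by (simp add: zero_le_mult_iff)
    qed
    interpret nonneg_curvature_at_infinity u m R
      using m assms(4,6) lower by unfold_locales (simp_all add: f)
    have upper: "S x \<le> C / (2 * (real n - 1)) * exp (2 * u x)" if "R < norm x" for x
    proof -
      have "x \<notin> K" using R[of x] that by auto
      then have "scalar_curvature u x * exp (2 * u x) \<le> C * exp (2 * u x)"
        using curv by (intro mult_right_mono) auto
      then have "2 * (real n - 1) * S x \<le> C * exp (2 * u x)"
        unfolding sc by (simp add: S_def \<kappa>_def)
      then show ?thesis using n1 by (simp add: pos_le_divide_eq mult.commute)
    qed
    have c: "c = s" unfolding c_def s_def n ..
    have s: "0 < s" using c_pos c by simp
    have \<alpha>: "\<alpha> = 2 * I / s" unfolding \<alpha>_def f_def f I_def c ..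
    have C': "0 \<le> C / (2 * (real n - 1))" using C n1 by simp
    have range: "0 \<le> \<alpha>" "\<alpha> \<le> 2" using \<alpha>_bounds by (auto simp: zero_le_mult_iff)
    have two: "I = s" if "\<alpha> * (2 - \<alpha>) \<le> 0" "\<alpha> \<noteq> 0"
    proof -
      have "\<alpha> = 2" using that range by (auto simp: mult_le_0_iff)
      then show ?thesis using s by (simp add: \<alpha> field_simps)
    qed
    \<comment> \<open>As \<alpha> = 2 I / s, the threshold 1 is I = s / 2. Above it, decay of r^2
      exp (2 u) gives the opposite inequality and leaves \<alpha> = 2; below it, the sign of
      \<alpha> is all that remains.\<close>
    have "I = s" if "1 < \<alpha>"
      using that by (intro two \<alpha>_upper[OF upper C'] \<Theta>_tendsto_0_of_decay) auto
    moreover have "0 \<le> I \<and> I \<le> s / 2" if "\<not> 1 < \<alpha>"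
      using that range s by (simp add: \<alpha> field_simps)
    moreover have "I = s" if "integrable lborel (\<lambda>x. exp (real n * u x))"
      using that unfolding n
      by (intro two \<alpha>_upper[OF upper C'] \<Theta>_tendsto_0_of_finite_volume \<alpha>_nonzero_of_finite_volume) auto
    ultimately show ?thesis by blast
  qed
  show ?thesis
    unfolding I_def[symmetric] s_def[symmetric] using key by blast
qed

end
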